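(* Let $g$ be a real analytic Riemannian metric on the ball $B_4\subset\mathbb{R}^m$ and $\Delta$ its Laplacian. There exist constants $K,T>0$ and $\rho_0\in(0,1)$, depending only on $g$, with the following property. If $u$ is real analytic on $B_2$ and $Z_0,L_0>1$ satisfy $$\|\Delta^k u\|_{0,2}\le Z_0L_0^k\,(2k)!\quad\text{for all }k\ge0,$$ then $$\|u\|_{j,\rho_0}\le Z_0\bigl(T\sqrt{L_0}\bigr)^j j!\quad\text{for all }j\ge0,$$ and $$|\partial_x^\alpha u(0)|\le K Z_0L_0^{m/4}\bigl(2T\sqrt{L_0}\bigr)^j j!\quad\text{for all }j\ge0\text{ and all multi-indices }|\alpha|=j.$$ The constants $K,T,\rho_0$ are independent of $u$, $Z_0$, $L_0$.
   Context: $B_R=\{x\in\mathbb{R}^m:|x|<R\}$. For an integer $k\ge0$ and $R>0$, $\|u\|_{k,R}=\sum_{|\alpha|=k}\left(\int_{B_R}|\partial_x^\alpha u(x)|^2\,dx\right)^{1/2}$ (Lebesgue measure). *)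

theory Defs
  imports "HOL-Analysis.Analysis"
begin

text \<open>Points of R^m are vectors of type real^'n with m = CARD('n).
  Multi-indices are functions 'n \<Rightarrow> nat; |alpha| = sum alpha UNIV.\<close>

definition mi_order :: "('n::finite \<Rightarrow> nat) \<Rightarrow> nat" where
  "mi_order \<alpha> = (\<Sum>i\<in>UNIV. \<alpha> i)"

definition real_analytic_on :: "(real^'n::finite \<Rightarrow> real) \<Rightarrow> (real^'n) set \<Rightarrow> bool" where
  "real_analytic_on f U \<longleftrightarrow> (\<forall>x0\<in>U. \<exists>r>0. \<exists>c :: ('n \<Rightarrow> nat) \<Rightarrow> real.
      \<forall>x\<in>ball x0 r. ((\<lambda>\<alpha>. c \<alpha> * (\<Prod>i\<in>UNIV. (x$i - x0$i) ^ \<alpha> i)) has_sum f x) UNIV)"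

definition pd :: "'n::finite \<Rightarrow> (real^'n \<Rightarrow> real) \<Rightarrow> real^'n \<Rightarrow> real" where
  "pd i f x = deriv (\<lambda>t. f (x + t *\<^sub>R axis i 1)) 0"

primrec pd_list :: "'n::finite list \<Rightarrow> (real^'n \<Rightarrow> real) \<Rightarrow> real^'n \<Rightarrow> real" where
  "pd_list [] f = f"
| "pd_list (i # is) f = pd i (pd_list is f)"

text \<open>Multi-index partial derivative (order of differentiation is irrelevant for
  the analytic functions considered).\<close>
definition mpartial :: "('n::finite \<Rightarrow> nat) \<Rightarrow> (real^'n \<Rightarrow> real) \<Rightarrow> real^'n \<Rightarrow> real" where
  "mpartial \<alpha> f = pd_list (SOME xs. \<forall>i. count_list xs i = \<alpha> i) f"

definition ennreal_sqrt :: "ennreal \<Rightarrow> ennreal" where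
  "ennreal_sqrt e = (if e = \<infinity> then \<infinity> else ennreal (sqrt (enn2real e)))"

definition knorm :: "nat \<Rightarrow> real \<Rightarrow> (real^'n::finite \<Rightarrow> real) \<Rightarrow> ennreal" where
  "knorm k R u = (\<Sum>\<alpha>\<in>{\<alpha>::'n \<Rightarrow> nat. mi_order \<alpha> = k}.
      ennreal_sqrt (\<integral>\<^sup>+ x. ennreal ((mpartial \<alpha> u x)\<^sup>2) * indicator (ball 0 R) x \<partial>lborel))"

definition analytic_riemannian_metric_on :: "(real^'n::finite \<Rightarrow> real^'n^'n) \<Rightarrow> (real^'n) set \<Rightarrow> bool" where
  "analytic_riemannian_metric_on g U \<longleftrightarrow>
     (\<forall>i j. real_analytic_on (\<lambda>x. g x $ i $ j) U) \<and>
     (\<forall>x\<in>U. transpose (g x) = g x \<and> (\<forall>v. v \<noteq> 0 \<longrightarrow> v \<bullet> (g x *v v) > 0))"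

definition laplacian :: "(real^'n::finite \<Rightarrow> real^'n^'n) \<Rightarrow> (real^'n \<Rightarrow> real) \<Rightarrow> real^'n \<Rightarrow> real" where
  "laplacian g u x = (1 / sqrt (det (g x))) *
     (\<Sum>i\<in>UNIV. pd i (\<lambda>y. sqrt (det (g y)) * (\<Sum>j\<in>UNIV. matrix_inv (g y) $ i $ j * pd j u y)) x)"

end

theory Submission
  imports Defs
begin

text \<open>
  Near 0 the Laplacian is \<open>\<Sum> a\<^sub>i\<^sub>j \<partial>\<^sub>i \<partial>\<^sub>j + \<Sum> b\<^sub>j \<partial>\<^sub>j\<close> with coefficients whose derivatives of
  order \<open>n\<close> are at most \<open>A S\<^sup>n n!\<close>. Fix the weight \<open>\<phi> = max 0 (\<rho>\<^sup>2 - |x|\<^sup>2)\<close>; since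
  \<open>|\<partial>(\<phi>\<^sup>p)| \<le> 2 p \<phi>\<^bsup>p-1\<^esup>\<close>, one power of \<open>\<phi>\<close> per derivative costs exactly the factors that a
  factorial absorbs. Integrating by parts twice against \<open>\<phi>\<^bsup>2p\<^esup>\<close> gives
  \<open>\<parallel>\<phi>\<^sup>p D\<^sup>2 w\<parallel> \<le> C (\<parallel>\<phi>\<^sup>p a\<^sub>i\<^sub>j \<partial>\<^sub>i\<^sub>j w\<parallel> + p \<parallel>\<phi>\<^bsup>p-1\<^esup> D w\<parallel>)\<close>. Applied to \<open>w = D\<^sup>n \<Delta>\<^sup>k u\<close> with \<open>p = n + 3\<close>,
  and with the commutator \<open>[\<Delta>, D\<^sup>n]\<close> expanded by the Leibniz rule, it yields by induction on \<open>n\<close>,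
  for all \<open>k\<close> simultaneously,
  \<open>\<parallel>\<phi>\<^bsup>n+1\<^esup> D\<^sup>n \<Delta>\<^sup>k u\<parallel> \<le> Z\<^sub>0 L\<^sub>0\<^sup>k (T \<surd>L\<^sub>0)\<^sup>n (n + 2k)!\<close>; the case \<open>n = 1\<close> is an interpolation
  inequality. The pointwise bound follows by a Sobolev inequality on a cube of side \<open>c / \<surd>L\<^sub>0\<close>,
  which is the source of the factor \<open>L\<^sub>0\<^bsup>m/4\<^esup>\<close>.
\<close>

subsection \<open>Partial derivatives and the Leibniz rule\<close>

text \<open>The argument trades two derivatives for one application of the Laplacian. Passing from
  (n + 2, k) to (n, k + 1) leaves (n + 2k)! unchanged, and the additional L0 is paid by two powers
  of \<open>T * sqrt L0\<close>; this is why all k are treated at once and why L0 enters through its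
  square root. The weight replaces a sequence of shrinking balls: there are no boundary terms and no
  radii to choose, and the factor p lost by differentiating it is comparable to the quotient of (n +
  2 + 2k)! by (n + 1 + 2k)!. The elliptic estimate climbs two orders at a time, so odd orders need
  their own start; there the bounds for first and second derivatives refer to each other, and the
  loop closes as a quadratic inequality. In the commutator the coefficients contribute S^k k!;
  against the growth of the derivatives of u this is a geometric series of ratio at most 1/2 once
  \<open>T\<close> is at least \<open>2 * S\<close>. So \<open>T\<close> is determined by the
  coefficients alone.\<close>

definition haspd :: "'n::finite \<Rightarrow> (real^'n \<Rightarrow> real) \<Rightarrow> real \<Rightarrow> real^'n \<Rightarrow> bool" where
  "haspd i f D x \<longleftrightarrow> ((\<lambda>t. f (x + t *\<^sub>R axis i 1)) has_real_derivative D) (at 0)"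

text \<open>\<open>pd\<close> is total, and its value means nothing where the difference quotient
  diverges; hence each order demands \<open>haspd\<close> besides the regularity of
  \<open>pd i f\<close>.\<close>

primrec Ck :: "nat \<Rightarrow> (real^'n::finite) set \<Rightarrow> (real^'n \<Rightarrow> real) \<Rightarrow> bool" where
  "Ck 0 U f \<longleftrightarrow> continuous_on U f"
| "Ck (Suc n) U f \<longleftrightarrow> continuous_on U f \<and>
     (\<forall>i. (\<forall>x\<in>U. haspd i f (pd i f x) x) \<and> Ck n U (pd i f))"

lemma haspd_pd: "haspd i f D x \<Longrightarrow> pd i f x = D"
  unfolding haspd_def pd_def by (rule DERIV_imp_deriv)

lemma haspd_along:
  assumes "haspd i f D (x + s *\<^sub>R axis i 1)"
  shows "((\<lambda>t. f (x + t *\<^sub>R axis i 1)) has_real_derivative D) (at s)"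
  using assms DERIV_shift[of "\<lambda>t. f (x + t *\<^sub>R axis i 1)" D 0 s]
  by (simp add: haspd_def algebra_simps)

lemma eventually_along:
  fixes x :: "real^'n::finite"
  assumes "open U" "x \<in> U"
  shows "eventually (\<lambda>t. x + t *\<^sub>R axis i 1 \<in> U) (nhds 0)"
proof -
  have "open ((\<lambda>t. x + t *\<^sub>R axis i 1) -` U)"
    by (intro open_vimage assms continuous_intros)
  then show ?thesis
    using eventually_nhds_in_open[of _ "0::real"] assms by force
qed

lemma haspd_cong:
  assumes "open U" "x \<in> U" "\<And>y. y \<in> U \<Longrightarrow> f y = h y"
  shows "haspd i f D x \<longleftrightarrow> haspd i h D x"
  unfolding haspd_def
  by (rule DERIV_cong_ev[OF refl _ refl])
     (use eventually_along[OF assms(1,2), of i] assms(3) in \<open>auto elim!: eventually_mono\<close>)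

lemma pd_cong:
  assumes "open U" "x \<in> U" "\<And>y. y \<in> U \<Longrightarrow> f y = h y"
  shows "pd i f x = pd i h x"
  unfolding pd_def
  by (rule deriv_cong_ev[OF _ refl])
     (use eventually_along[OF assms(1,2), of i] assms(3) in \<open>auto elim!: eventually_mono\<close>)

lemma pd_list_cong:
  assumes "open U" "x \<in> U" "\<And>y. y \<in> U \<Longrightarrow> f y = h y"
  shows "pd_list is f x = pd_list is h x"
  using assms(2)
proof (induction "is" arbitrary: x)
  case (Cons i "is")
  then show ?case using pd_cong[OF assms(1) Cons.prems, of "pd_list is f" "pd_list is h"] by simp
qed (simp add: assms)

lemma pd_list_append: "pd_list (xs @ ys) f = pd_list xs (pd_list ys f)"
  by (induction xs) auto

lemma Ck_continuous: "Ck n U f \<Longrightarrow> continuous_on U f"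
  by (cases n) auto

lemma Ck_mono_order: "Ck (Suc n) U f \<Longrightarrow> Ck n U f"
  by (induction n arbitrary: f) auto

lemma Ck_subset: "Ck n U f \<Longrightarrow> V \<subseteq> U \<Longrightarrow> Ck n V f"
  by (induction n arbitrary: f) (auto intro: continuous_on_subset)

lemma Ck_pd: "Ck (Suc n) U f \<Longrightarrow> Ck n U (pd i f)"
  by simp

lemma Ck_haspd: "Ck (Suc n) U f \<Longrightarrow> x \<in> U \<Longrightarrow> haspd i f (pd i f x) x"
  by simp

lemma Ck_cong:
  assumes "open U" "\<And>y. y \<in> U \<Longrightarrow> f y = h y" "Ck n U f"
  shows "Ck n U h"
  using assms(2,3)
proof (induction n arbitrary: f h)
  case (Suc n)
  have "pd i f y = pd i h y" if "y \<in> U" for i y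
    by (rule pd_cong[OF assms(1) that Suc.prems(1)])
  then show ?case
    using Suc haspd_cong[OF assms(1) _ Suc.prems(1)] continuous_on_cong[of U U f h]
    by (simp, metis)
qed (simp cong: continuous_on_cong)

text \<open>Gluing: an analytic function comes with one expansion per point, each valid only near
  that point.\<close>

lemma Ck_local:
  assumes "\<And>x. x \<in> U \<Longrightarrow> \<exists>V. open V \<and> x \<in> V \<and> Ck n V f"
  shows "Ck n U f"
  using assms
proof (induction n arbitrary: f)
  case 0
  then show ?case
    by (auto simp: continuous_on_eq_continuous_within)
       (metis at_within_open continuous_within_subset subset_UNIV)
next
  case (Suc n)
  have "continuous_on U f"
    using Suc.prems
    by (auto simp: continuous_on_eq_continuous_within)
       (metis at_within_open continuous_within_subset subset_UNIV)
  moreover have "haspd i f (pd i f x) x" if "x \<in> U" for i x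
    using Suc.prems[OF that] by auto
  moreover have "Ck n U (pd i f)" for i
    by (rule Suc.IH) (use Suc.prems in fastforce)
  ultimately show ?case by simp
qed

lemma haspd_const: "haspd i (\<lambda>x. c) 0 x"
  unfolding haspd_def by simp

lemma haspd_add: "haspd i f D x \<Longrightarrow> haspd i h E x \<Longrightarrow> haspd i (\<lambda>x. f x + h x) (D + E) x"
  unfolding haspd_def by (rule DERIV_add)

lemma haspd_mult:
  "haspd i f D x \<Longrightarrow> haspd i h E x \<Longrightarrow> haspd i (\<lambda>x. f x * h x) (D * h x + f x * E) x"
  unfolding haspd_def by (drule (1) DERIV_mult) (simp add: algebra_simps)

lemma haspd_sum: "(\<And>k. k \<in> A \<Longrightarrow> haspd i (f k) (D k) x) \<Longrightarrow> haspd i (\<lambda>x. \<Sum>k\<in>A. f k x) (\<Sum>k\<in>A. D k) x"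
  unfolding haspd_def by (rule DERIV_sum)

lemma haspd_inverse:
  assumes "haspd i f D x" "f x \<noteq> 0"
  shows "haspd i (\<lambda>x. 1 / f x) (- D * (1 / f x) * (1 / f x)) x"
  using assms unfolding haspd_def
  by (auto intro!: derivative_eq_intros simp: divide_simps)

lemma Ck_const: "Ck n (U :: (real^'n::finite) set) (\<lambda>x. c)"
proof (induction n arbitrary: c)
  case (Suc n)
  have "pd i (\<lambda>x. c) = (\<lambda>x::real^'n. 0)" for i
    using haspd_pd[OF haspd_const] by blast
  then show ?case using Suc by (simp add: haspd_const)
qed simp

text \<open>A formula \<open>D\<close> for the derivative equals \<open>pd i f\<close> on U only;
  openness of U lets \<open>Ck_cong\<close> transfer its regularity.\<close>

lemma Ck_SucI:
  assumes "open U" "continuous_on U f"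
    "\<And>i x. x \<in> U \<Longrightarrow> haspd i f (D i x) x" "\<And>i. Ck n U (D i)"
  shows "Ck (Suc n) U f"
proof -
  have "pd i f x = D i x" if "x \<in> U" for i x
    using haspd_pd assms(3)[OF that] by blast
  moreover from this have "Ck n U (pd i f)" for i
    using Ck_cong[OF assms(1) _ assms(4)[of i], of "pd i f"] by simp
  ultimately show ?thesis using assms by simp
qed

lemma Ck_add:
  assumes "open U" "Ck n U f" "Ck n U h"
  shows "Ck n U (\<lambda>x. f x + h x)"
  using assms(2,3)
proof (induction n arbitrary: f h)
  case (Suc n)
  show ?case
    by (rule Ck_SucI[OF assms(1), where D = "\<lambda>i x. pd i f x + pd i h x"])
       (use Suc in \<open>auto intro!: continuous_intros haspd_add\<close>)
qed (auto intro: continuous_intros)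

lemma Ck_mult:
  assumes "open U" "Ck n U f" "Ck n U h"
  shows "Ck n U (\<lambda>x. f x * h x)"
  using assms(2,3)
proof (induction n arbitrary: f h)
  case (Suc n)
  show ?case
  proof (rule Ck_SucI[OF assms(1), where D = "\<lambda>i x. pd i f x * h x + f x * pd i h x"])
    show "Ck n U (\<lambda>x. pd i f x * h x + f x * pd i h x)" for i
      using Suc.prems by (intro Ck_add[OF assms(1)] Suc.IH) (auto intro: Ck_mono_order)
  qed (use Suc in \<open>auto intro!: continuous_intros haspd_mult\<close>)
qed (auto intro: continuous_intros)

lemma Ck_sum:
  assumes "open U" "\<And>k. k \<in> A \<Longrightarrow> Ck n U (f k)"
  shows "Ck n U (\<lambda>x. \<Sum>k\<in>A. f k x)"
  using assms(2)
  by (induction A rule: infinite_finite_induct) (auto intro!: Ck_add assms(1) Ck_const)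

lemma Ck_inverse:
  assumes "open U" "Ck n U f" "\<And>x. x \<in> U \<Longrightarrow> f x \<noteq> 0"
  shows "Ck n U (\<lambda>x. 1 / f x)"
  using assms(2)
proof (induction n)
  case (Suc n)
  show ?case
  proof (rule Ck_SucI[OF assms(1), where D = "\<lambda>i x. (- 1) * pd i f x * (1 / f x) * (1 / f x)"])
    show "Ck n U (\<lambda>x. (- 1) * pd i f x * (1 / f x) * (1 / f x))" for i
      using Suc.prems Suc.IH Ck_mono_order[OF Suc.prems]
      by (intro Ck_mult[OF assms(1)] Ck_const) auto
    show "haspd i (\<lambda>x. 1 / f x) ((- 1) * pd i f x * (1 / f x) * (1 / f x)) x" if "x \<in> U" for i x
      using haspd_inverse[of i f "pd i f x" x] Suc.prems assms(3) that by simp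
  qed (use Suc assms(3) in \<open>auto intro!: continuous_intros\<close>)
qed (use assms(3) in \<open>auto intro!: continuous_intros\<close>)

definition smooth :: "(real^'n::finite) set \<Rightarrow> (real^'n \<Rightarrow> real) \<Rightarrow> bool" where
  "smooth U f \<longleftrightarrow> (\<forall>n. Ck n U f)"

lemma smooth_continuous: "smooth U f \<Longrightarrow> continuous_on U f"
  unfolding smooth_def using Ck_continuous by blast

lemma smooth_pd: "smooth U f \<Longrightarrow> smooth U (pd i f)"
  unfolding smooth_def using Ck_pd by blast

lemma smooth_pd_list: "smooth U f \<Longrightarrow> smooth U (pd_list is f)"
  by (induction "is") (auto intro: smooth_pd)

lemma smooth_haspd: "smooth U f \<Longrightarrow> x \<in> U \<Longrightarrow> haspd i f (pd i f x) x"
  unfolding smooth_def using Ck_haspd by blast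

lemma smooth_const: "smooth U (\<lambda>x. c)"
  by (simp add: smooth_def Ck_const)

lemma smooth_add: "open U \<Longrightarrow> smooth U f \<Longrightarrow> smooth U h \<Longrightarrow> smooth U (\<lambda>x. f x + h x)"
  by (simp add: smooth_def Ck_add)

lemma smooth_mult: "open U \<Longrightarrow> smooth U f \<Longrightarrow> smooth U h \<Longrightarrow> smooth U (\<lambda>x. f x * h x)"
  by (simp add: smooth_def Ck_mult)

lemma smooth_sum: "open U \<Longrightarrow> (\<And>k. k \<in> A \<Longrightarrow> smooth U (f k)) \<Longrightarrow> smooth U (\<lambda>x. \<Sum>k\<in>A. f k x)"
  by (simp add: smooth_def Ck_sum)

lemma smooth_inverse: "open U \<Longrightarrow> smooth U f \<Longrightarrow> (\<And>x. x \<in> U \<Longrightarrow> f x \<noteq> 0) \<Longrightarrow> smooth U (\<lambda>x. 1 / f x)"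
  by (simp add: smooth_def Ck_inverse)

lemma smooth_cong: "open U \<Longrightarrow> (\<And>y. y \<in> U \<Longrightarrow> f y = h y) \<Longrightarrow> smooth U f \<Longrightarrow> smooth U h"
  unfolding smooth_def using Ck_cong by blast

lemma smooth_subset: "smooth U f \<Longrightarrow> V \<subseteq> U \<Longrightarrow> smooth V f"
  unfolding smooth_def using Ck_subset by blast

lemma pd_add:
  assumes "smooth U f" "smooth U h" "x \<in> U"
  shows "pd i (\<lambda>x. f x + h x) x = pd i f x + pd i h x"
  using assms by (intro haspd_pd haspd_add smooth_haspd) auto

lemma pd_list_sum:
  assumes "open U" "\<And>k. k \<in> A \<Longrightarrow> smooth U (f k)" "x \<in> U"
  shows "pd_list is (\<lambda>x. \<Sum>k\<in>A. f k x) x = (\<Sum>k\<in>A. pd_list is (f k) x)"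
  using assms(3)
proof (induction "is" arbitrary: x)
  case (Cons i "is")
  have "pd i (pd_list is (\<lambda>x. \<Sum>k\<in>A. f k x)) x = pd i (\<lambda>x. \<Sum>k\<in>A. pd_list is (f k) x) x"
    by (rule pd_cong[OF assms(1) Cons.prems Cons.IH])
  also have "\<dots> = (\<Sum>k\<in>A. pd i (pd_list is (f k)) x)"
    using Cons.prems assms(2) by (intro haspd_pd haspd_sum smooth_haspd smooth_pd_list)
  finally show ?case by simp
qed simp

lemma pd_list_add:
  assumes "open U" "smooth U f" "smooth U h" "x \<in> U"
  shows "pd_list is (\<lambda>x. f x + h x) x = pd_list is f x + pd_list is h x"
  using assms(4)
proof (induction "is" arbitrary: x)
  case (Cons i "is")
  have "pd i (pd_list is (\<lambda>x. f x + h x)) x = pd i (\<lambda>x. pd_list is f x + pd_list is h x) x"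
    by (rule pd_cong[OF assms(1) Cons.prems Cons.IH])
  then show ?case
    using pd_add[OF smooth_pd_list[OF assms(2)] smooth_pd_list[OF assms(3)] Cons.prems] by simp
qed simp

text \<open>All distributions of the differentiations over two factors, each part in the original
  order; a list, so that repeated directions keep their multiplicity. Giving the head to the second
  factor comes first, which puts \<open>([], is)\<close> at the front.\<close>

fun splits :: "'a list \<Rightarrow> ('a list \<times> 'a list) list" where
  "splits [] = [([], [])]"
| "splits (i # is) = map (\<lambda>(xs, ys). (xs, i # ys)) (splits is) @ map (\<lambda>(xs, ys). (i # xs, ys)) (splits is)"

lemma haspd_sum_list:
  "(\<And>k. k \<in> set ks \<Longrightarrow> haspd i (f k) (D k) x) \<Longrightarrow> haspd i (\<lambda>x. \<Sum>k\<leftarrow>ks. f k x) (\<Sum>k\<leftarrow>ks. D k) x"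
  by (induction ks) (auto intro!: haspd_const haspd_add)

lemma pd_list_mult:
  assumes "open U" "smooth U f" "smooth U h" "x \<in> U"
  shows "pd_list is (\<lambda>x. f x * h x) x = (\<Sum>(xs, ys)\<leftarrow>splits is. pd_list xs f x * pd_list ys h x)"
  using assms(4)
proof (induction "is" arbitrary: x)
  case (Cons i "is")
  have "pd i (pd_list is (\<lambda>x. f x * h x)) x
      = pd i (\<lambda>x. \<Sum>p\<leftarrow>splits is. pd_list (fst p) f x * pd_list (snd p) h x) x"
    by (rule pd_cong[OF assms(1) Cons.prems]) (simp add: Cons.IH case_prod_beta)
  also have "\<dots> = (\<Sum>p\<leftarrow>splits is. pd i (pd_list (fst p) f) x * pd_list (snd p) h x
                 + pd_list (fst p) f x * pd i (pd_list (snd p) h) x)"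
    using Cons.prems assms
    by (intro haspd_pd haspd_sum_list haspd_mult smooth_haspd smooth_pd_list)
  finally show ?case
    by (simp add: sum_list_addf case_prod_beta o_def add.commute)
qed simp

lemma splits_length: "(xs, ys) \<in> set (splits is) \<Longrightarrow> length xs + length ys = length is"
  by (induction "is" arbitrary: xs ys) auto

text \<open>Later bounds see only the lengths of the two parts, so the 2^n splittings collapse to a
  binomial sum. The induction needs arbitrary \<open>h\<close>, because a new direction shifts one
  of its arguments; Pascal's rule adds the two shifts.\<close>

lemma splits_binomial:
  fixes h :: "nat \<Rightarrow> nat \<Rightarrow> real"
  shows "(\<Sum>(xs, ys)\<leftarrow>splits is. h (length xs) (length ys))
    = (\<Sum>k\<le>length is. (length is choose k) * h k (length is - k))"
proof (induction "is" arbitrary: h)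
  case (Cons i "is")
  let ?n = "length is"
  have "(\<Sum>(xs, ys)\<leftarrow>splits (i # is). h (length xs) (length ys))
     = (\<Sum>(xs, ys)\<leftarrow>splits is. h (length xs) (Suc (length ys)))
     + (\<Sum>(xs, ys)\<leftarrow>splits is. h (Suc (length xs)) (length ys))"
    by (simp add: case_prod_unfold o_def)
  also have "\<dots> = (\<Sum>k\<le>?n. (?n choose k) * h k (Suc (?n - k)))
     + (\<Sum>k\<le>?n. (?n choose k) * h (Suc k) (?n - k))"
    using Cons.IH[of "\<lambda>a b. h a (Suc b)"] Cons.IH[of "\<lambda>a b. h (Suc a) b"] by simp
  also have "(\<Sum>k\<le>?n. (?n choose k) * h k (Suc (?n - k))) = (\<Sum>k\<le>Suc ?n. (?n choose k) * h k (Suc ?n - k))"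
    by (simp add: Suc_diff_le)
  also have "\<dots> = h 0 (Suc ?n) + (\<Sum>k\<le>?n. (?n choose Suc k) * h (Suc k) (?n - k))"
    by (subst sum.atMost_Suc_shift) simp
  also have "\<dots> + (\<Sum>k\<le>?n. (?n choose k) * h (Suc k) (?n - k))
     = h 0 (Suc ?n) + (\<Sum>k\<le>?n. (Suc ?n choose Suc k) * h (Suc k) (?n - k))"
    by (simp add: sum.distrib algebra_simps)
  also have "\<dots> = (\<Sum>k\<le>Suc ?n. (Suc ?n choose k) * h k (Suc ?n - k))"
    by (simp add: sum.atMost_Suc_shift del: sum.atMost_Suc binomial_Suc_Suc)
  finally show ?case by simp
qed simp

text \<open>Isolates the Leibniz term in which every derivative falls on the second factor: the
  unknown in \<open>fact_bound_inverse\<close> and the leading term of the commutator.\<close>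

lemma splits_Nil_fst: "\<exists>r. splits is = ([], is) # r \<and> (\<forall>(xs, ys)\<in>set r. xs \<noteq> [])"
  by (induction "is") auto

subsection \<open>Real analytic functions\<close>

lemma second_difference:
  fixes x :: "real^'n::finite"
  assumes "Ck 2 U f" "0 < h"
    and U: "\<And>s t. 0 \<le> s \<Longrightarrow> s \<le> h \<Longrightarrow> 0 \<le> t \<Longrightarrow> t \<le> h \<Longrightarrow> x + s *\<^sub>R axis i 1 + t *\<^sub>R axis j 1 \<in> U"
  obtains s t where "0 < s" "s < h" "0 < t" "t < h"
    "f (x + h *\<^sub>R axis i 1 + h *\<^sub>R axis j 1) - f (x + h *\<^sub>R axis i 1) - f (x + h *\<^sub>R axis j 1) + f x
      = h * h * pd j (pd i f) (x + s *\<^sub>R axis i 1 + t *\<^sub>R axis j 1)"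
proof -
  have C: "Ck (Suc (Suc 0)) U f" using assms(1) by (simp add: numeral_2_eq_2)
  define F where "F s = f ((x + h *\<^sub>R axis j 1) + s *\<^sub>R axis i 1) - f (x + s *\<^sub>R axis i 1)" for s
  have F': "DERIV F s :> pd i f ((x + h *\<^sub>R axis j 1) + s *\<^sub>R axis i 1) - pd i f (x + s *\<^sub>R axis i 1)"
    if "0 \<le> s" "s \<le> h" for s
    unfolding F_def
  proof (intro DERIV_diff haspd_along Ck_haspd[OF C])
    show "x + h *\<^sub>R axis j 1 + s *\<^sub>R axis i 1 \<in> U"
      using U[of s h] that \<open>0 < h\<close> by (simp add: algebra_simps)
    show "x + s *\<^sub>R axis i 1 \<in> U"
      using U[of s 0] that \<open>0 < h\<close> by simp
  qed
  obtain s where s: "0 < s" "s < h" and Fs: "F h - F 0 = (h - 0) *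
      (pd i f ((x + h *\<^sub>R axis j 1) + s *\<^sub>R axis i 1) - pd i f (x + s *\<^sub>R axis i 1))"
    using MVT2[OF \<open>0 < h\<close> F'] by blast
  define G where "G t = pd i f ((x + s *\<^sub>R axis i 1) + t *\<^sub>R axis j 1)" for t
  have C1: "Ck (Suc 0) U (pd i f)" using C by simp
  have G': "DERIV G t :> pd j (pd i f) ((x + s *\<^sub>R axis i 1) + t *\<^sub>R axis j 1)"
    if "0 \<le> t" "t \<le> h" for t
    unfolding G_def by (intro haspd_along Ck_haspd[OF C1] U) (use s that in auto)
  obtain t where t: "0 < t" "t < h" and Gt: "G h - G 0 = (h - 0) *
      pd j (pd i f) ((x + s *\<^sub>R axis i 1) + t *\<^sub>R axis j 1)"
    using MVT2[OF \<open>0 < h\<close> G'] by blast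
  have "F h - F 0 = h * (G h - G 0)"
    using Fs by (simp add: G_def add_ac)
  then show ?thesis
    using Gt by (intro that[OF s t]) (simp add: F_def add_ac algebra_simps)
qed

text \<open>The second difference over a square is symmetric in i and j, so by
  \<open>second_difference\<close> both mixed derivatives take a common value somewhere in every
  small square at x; continuity does the rest.\<close>

lemma pd_commute:
  fixes x :: "real^'n::finite"
  assumes "open U" "Ck 2 U f" "x \<in> U"
  shows "pd i (pd j f) x = pd j (pd i f) x"
proof (rule ccontr)
  assume ne: "pd i (pd j f) x \<noteq> pd j (pd i f) x"
  \<comment> \<open>Half the gap: no number is closer than this to both values.\<close>
  define \<epsilon> where "\<epsilon> = \<bar>pd i (pd j f) x - pd j (pd i f) x\<bar> / 2"
  have "\<epsilon> > 0" using ne by (simp add: \<epsilon>_def)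
  have C: "Ck (Suc (Suc 0)) U f" using assms(2) by (simp add: numeral_2_eq_2)
  have cont: "continuous_on U (pd i (pd j f))" "continuous_on U (pd j (pd i f))"
    using C by auto
  obtain d0 where d0: "d0 > 0" "ball x d0 \<subseteq> U" using assms openE by blast
  obtain d1 where d1: "d1 > 0" "\<And>y. y \<in> U \<Longrightarrow> dist y x < d1 \<Longrightarrow> dist (pd i (pd j f) y) (pd i (pd j f) x) < \<epsilon>"
    using cont(1) assms(3) \<open>\<epsilon> > 0\<close> unfolding continuous_on_iff by metis
  obtain d2 where d2: "d2 > 0" "\<And>y. y \<in> U \<Longrightarrow> dist y x < d2 \<Longrightarrow> dist (pd j (pd i f) y) (pd j (pd i f) x) < \<epsilon>"
    using cont(2) assms(3) \<open>\<epsilon> > 0\<close> unfolding continuous_on_iff by metis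
  \<comment> \<open>Every point used lies within \<open>2 * h\<close> of x, so a third of the least
    radius suffices.\<close>
  define h where "h = min d0 (min d1 d2) / 3"
  have h: "h > 0" "2 * h < d0" "2 * h < d1" "2 * h < d2" using d0 d1 d2 by (auto simp: h_def)
  have near: "dist (x + s *\<^sub>R axis k 1 + t *\<^sub>R axis l 1) x \<le> 2 * h"
    if "0 \<le> s" "s \<le> h" "0 \<le> t" "t \<le> h" for s t k l
  proof -
    have "dist (x + s *\<^sub>R axis k 1 + t *\<^sub>R axis l 1) x = norm (s *\<^sub>R axis k (1::real) + t *\<^sub>R axis l 1)"
      by (simp add: dist_norm add.assoc)
    also have "\<dots> \<le> s + t"
      by (rule order_trans[OF norm_triangle_ineq]) (use that in \<open>simp add: norm_axis_1\<close>)
    finally show ?thesis using that by simp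
  qed
  have inU: "x + s *\<^sub>R axis k 1 + t *\<^sub>R axis l 1 \<in> U"
    if "0 \<le> s" "s \<le> h" "0 \<le> t" "t \<le> h" for s t k l
    using near[OF that, of k l] h d0 by (auto simp: dist_commute subset_eq)
  obtain s t where st: "0 < s" "s < h" "0 < t" "t < h"
    "f (x + h *\<^sub>R axis i 1 + h *\<^sub>R axis j 1) - f (x + h *\<^sub>R axis i 1) - f (x + h *\<^sub>R axis j 1) + f x
      = h * h * pd j (pd i f) (x + s *\<^sub>R axis i 1 + t *\<^sub>R axis j 1)"
    by (rule second_difference[OF assms(2) h(1), of x i j]) (use inU in auto)
  obtain s' t' where st': "0 < s'" "s' < h" "0 < t'" "t' < h"
    "f (x + h *\<^sub>R axis j 1 + h *\<^sub>R axis i 1) - f (x + h *\<^sub>R axis j 1) - f (x + h *\<^sub>R axis i 1) + f x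
      = h * h * pd i (pd j f) (x + s' *\<^sub>R axis j 1 + t' *\<^sub>R axis i 1)"
    by (rule second_difference[OF assms(2) h(1), of x j i]) (use inU in auto)
  have comm: "x + h *\<^sub>R axis j 1 + h *\<^sub>R axis i 1 = x + h *\<^sub>R axis i 1 + h *\<^sub>R axis j (1::real)"
    by (simp add: add_ac)
  have "h * h * pd j (pd i f) (x + s *\<^sub>R axis i 1 + t *\<^sub>R axis j 1)
     = h * h * pd i (pd j f) (x + s' *\<^sub>R axis j 1 + t' *\<^sub>R axis i 1)"
    using st(5) st'(5)[unfolded comm] by linarith
  then have eq: "pd j (pd i f) (x + s *\<^sub>R axis i 1 + t *\<^sub>R axis j 1)
     = pd i (pd j f) (x + s' *\<^sub>R axis j 1 + t' *\<^sub>R axis i 1)"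
    using h(1) by simp
  have "dist (pd j (pd i f) (x + s *\<^sub>R axis i 1 + t *\<^sub>R axis j 1)) (pd j (pd i f) x) < \<epsilon>"
    using near[of s t i j] h st by (intro d2(2) inU) auto
  moreover have "dist (pd i (pd j f) (x + s' *\<^sub>R axis j 1 + t' *\<^sub>R axis i 1)) (pd i (pd j f) x) < \<epsilon>"
    using near[of s' t' j i] h st' by (intro d1(2) inU) auto
  moreover have False if "dist A a < \<bar>b - a\<bar> / 2" "dist A b < \<bar>b - a\<bar> / 2" for A a b :: real
    using that dist_triangle3[of b a A] unfolding dist_real_def[of b a] by argo
  ultimately show False
    unfolding \<epsilon>_def eq by blast
qed

lemma pd_list_snoc:
  assumes "open U" "smooth U f" "x \<in> U"
  shows "pd_list is (pd i f) x = pd i (pd_list is f) x"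
  using assms(3)
proof (induction "is" arbitrary: x)
  case (Cons k "is")
  have "pd k (pd_list is (pd i f)) x = pd k (pd i (pd_list is f)) x"
    by (rule pd_cong[OF assms(1) Cons.prems Cons.IH])
  also have "\<dots> = pd i (pd k (pd_list is f)) x"
    using assms(1) _ Cons.prems
    by (rule pd_commute) (use smooth_pd_list[OF assms(2)] in \<open>simp add: smooth_def\<close>)
  finally show ?case by simp
qed simp

section \<open>Power series that converge absolutely on a cube\<close>

text \<open>On a cube all monomials are largest in absolute value at the corner, where they equal
  \<open>s ^ mi_order \<alpha>\<close>. \<open>M\<close> bounds the absolute sum there, and so
  serves both as a sup bound and as the quantity that Cauchy's estimate propagates.\<close>

definition cube_series :: "real^'n::finite \<Rightarrow> real \<Rightarrow> real \<Rightarrow> (real^'n \<Rightarrow> real) \<Rightarrow> bool" where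
  "cube_series x0 s M f \<longleftrightarrow> (\<exists>c :: ('n \<Rightarrow> nat) \<Rightarrow> real.
     (\<forall>F. finite F \<longrightarrow> (\<Sum>\<alpha>\<in>F. \<bar>c \<alpha>\<bar> * s ^ mi_order \<alpha>) \<le> M) \<and>
     (\<forall>x. (\<forall>i. \<bar>x$i - x0$i\<bar> \<le> s) \<longrightarrow>
        ((\<lambda>\<alpha>. c \<alpha> * (\<Prod>i\<in>UNIV. (x$i - x0$i) ^ \<alpha> i)) has_sum f x) UNIV))"

lemma abs_prod_power_le:
  fixes y :: "'a \<Rightarrow> real"
  assumes "\<And>i. i \<in> A \<Longrightarrow> \<bar>y i\<bar> \<le> s"
  shows "\<bar>\<Prod>i\<in>A. y i ^ \<alpha> i\<bar> \<le> s ^ (\<Sum>i\<in>A. \<alpha> i)"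
proof -
  have "\<bar>\<Prod>i\<in>A. y i ^ \<alpha> i\<bar> = (\<Prod>i\<in>A. \<bar>y i\<bar> ^ \<alpha> i)"
    by (simp add: abs_prod power_abs)
  also have "\<dots> \<le> (\<Prod>i\<in>A. s ^ \<alpha> i)"
    using assms by (intro prod_mono) (auto intro!: power_mono)
  finally show ?thesis by (simp add: power_sum)
qed

lemma bounded_sums_summable:
  fixes b :: "'a \<Rightarrow> real"
  assumes "\<And>a. 0 \<le> b a" "\<And>F. finite F \<Longrightarrow> sum b F \<le> M"
  shows "b summable_on UNIV"
proof (rule nonneg_bdd_above_summable_on)
  show "bdd_above (sum b ` {F. F \<subseteq> UNIV \<and> finite F})"
    by (rule bdd_aboveI2[where M = M]) (simp add: assms(2))
qed (rule assms(1))

lemma cube_series_continuous: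
  assumes "cube_series x0 s M f"
  shows "continuous_on {x. \<forall>i. \<bar>x$i - x0$i\<bar> \<le> s} f"
proof (cases "0 \<le> s")
  case True
  obtain c where c: "\<And>F. finite F \<Longrightarrow> (\<Sum>\<alpha>\<in>F. \<bar>c \<alpha>\<bar> * s ^ mi_order \<alpha>) \<le> M"
    and f: "\<And>x. (\<forall>i. \<bar>x$i - x0$i\<bar> \<le> s) \<Longrightarrow>
        ((\<lambda>\<alpha>. c \<alpha> * (\<Prod>i\<in>UNIV. (x$i - x0$i) ^ \<alpha> i)) has_sum f x) UNIV"
    using assms unfolding cube_series_def by blast
  let ?Y = "{x. \<forall>i. \<bar>x$i - x0$i\<bar> \<le> s}"
  have "uniform_limit ?Y (\<lambda>X x. \<Sum>\<alpha>\<in>X. c \<alpha> * (\<Prod>i\<in>UNIV. (x$i - x0$i) ^ \<alpha> i)) f (finite_subsets_at_top UNIV)"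
  proof (rule Weierstrass_m_test_general')
    show "norm (c \<alpha> * (\<Prod>i\<in>UNIV. (x$i - x0$i) ^ \<alpha> i)) \<le> \<bar>c \<alpha>\<bar> * s ^ mi_order \<alpha>" if "x \<in> ?Y" for \<alpha> x
      using abs_prod_power_le[of UNIV "\<lambda>i. x$i - x0$i" s \<alpha>] that
      by (simp add: abs_mult mi_order_def mult_left_mono)
    show "(\<lambda>\<alpha>. \<bar>c \<alpha>\<bar> * s ^ mi_order \<alpha>) summable_on UNIV"
      by (rule bounded_sums_summable[OF _ c]) (use True in auto)
  qed (use f in auto)
  then show ?thesis
    by (rule uniform_limit_theorem[rotated]) (auto intro!: always_eventually continuous_intros)
next
  case False
  then have "\<not> \<bar>x$i - x0$i\<bar> \<le> s" for x i by linarith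
  then show ?thesis by simp
qed

lemma cube_series_bound:
  assumes "cube_series x0 s M f" "\<And>i. \<bar>x$i - x0$i\<bar> \<le> s"
  shows "\<bar>f x\<bar> \<le> M"
proof -
  obtain c where c: "\<And>F. finite F \<Longrightarrow> (\<Sum>\<alpha>\<in>F. \<bar>c \<alpha>\<bar> * s ^ mi_order \<alpha>) \<le> M"
    and f: "((\<lambda>\<alpha>. c \<alpha> * (\<Prod>i\<in>UNIV. (x$i - x0$i) ^ \<alpha> i)) has_sum f x) UNIV"
    using assms unfolding cube_series_def by blast
  have "\<bar>\<Sum>\<alpha>\<in>F. c \<alpha> * (\<Prod>i\<in>UNIV. (x$i - x0$i) ^ \<alpha> i)\<bar> \<le> M" if "finite F" for F
  proof -
    have "\<bar>\<Sum>\<alpha>\<in>F. c \<alpha> * (\<Prod>i\<in>UNIV. (x$i - x0$i) ^ \<alpha> i)\<bar>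
        \<le> (\<Sum>\<alpha>\<in>F. \<bar>c \<alpha>\<bar> * s ^ mi_order \<alpha>)"
      using abs_prod_power_le[of UNIV "\<lambda>i. x$i - x0$i" s] assms(2)
      by (intro order_trans[OF sum_abs] sum_mono) (simp add: abs_mult mi_order_def mult_left_mono)
    then show ?thesis using c[OF that] by simp
  qed
  then show ?thesis
    by (intro tendsto_upperbound[OF tendsto_rabs[OF f[unfolded has_sum_def]]])
       (auto intro!: eventually_finite_subsets_at_top_weakI)
qed

text \<open>The left side is a single term of the binomial expansion of the right. This is Cauchy's
  estimate for a monomial: giving up \<delta> of the radius pays for one derivative.\<close>

lemma power_derivative_bound:
  fixes t \<delta> :: real
  assumes "0 \<le> t" "0 \<le> \<delta>"
  shows "real n * t ^ (n - 1) * \<delta> \<le> (t + \<delta>) ^ n"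
proof (induction n)
  case (Suc n)
  show ?case
  proof (cases n)
    case (Suc m)
    have "real (Suc n) * t ^ n * \<delta> = t * (real n * t ^ (n - 1) * \<delta>) + \<delta> * t ^ n"
      by (simp add: Suc algebra_simps)
    also have "\<dots> \<le> t * (t + \<delta>) ^ n + \<delta> * (t + \<delta>) ^ n"
      using assms Suc.IH by (intro add_mono mult_left_mono power_mono) auto
    finally show ?thesis by (simp add: algebra_simps)
  qed (use assms in simp)
qed simp

text \<open>The theorem on termwise differentiation concerns series over nat; the multi-indices are
  enumerated for its sake.\<close>

lemma countable_enumeration:
  obtains e :: "nat \<Rightarrow> ('n::finite \<Rightarrow> nat)" where "bij e"
proof -
  have "infinite (UNIV :: ('n \<Rightarrow> nat) set)"
  proof
    assume "finite (UNIV :: ('n \<Rightarrow> nat) set)"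
    then have "finite (range (\<lambda>n::nat. (\<lambda>_::'n. n)))" by (rule finite_subset[OF subset_UNIV])
    moreover have "inj (\<lambda>n::nat. (\<lambda>_::'n. n))" by (auto simp: inj_def fun_eq_iff)
    ultimately have "finite (UNIV :: nat set)" by (rule finite_imageD)
    then show False by simp
  qed
  then show ?thesis
    by (rule that[OF bij_betw_from_nat_into[OF countableI_type]])
qed

text \<open>Termwise differentiation: the radius shrinks by \<delta> and the majorant grows by
  \<open>1 / \<delta>\<close> with no further constant, so the estimate can be iterated.\<close>

lemma cube_series_deriv:
  fixes x0 :: "real^'n::finite"
  assumes "cube_series x0 s M f" "0 < \<delta>" "\<delta> < s"
  shows "\<And>x. (\<And>k. \<bar>x$k - x0$k\<bar> \<le> s - \<delta>) \<Longrightarrow> haspd i f (pd i f x) x"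
    and "cube_series x0 (s - \<delta>) (M / \<delta>) (pd i f)"
proof -
  obtain c where c: "\<And>F. finite F \<Longrightarrow> (\<Sum>\<alpha>\<in>F. \<bar>c \<alpha>\<bar> * s ^ mi_order \<alpha>) \<le> M"
    and f: "\<And>x. (\<forall>i. \<bar>x$i - x0$i\<bar> \<le> s) \<Longrightarrow>
        ((\<lambda>\<alpha>. c \<alpha> * (\<Prod>i\<in>UNIV. (x$i - x0$i) ^ \<alpha> i)) has_sum f x) UNIV"
    using assms unfolding cube_series_def by blast
  have s: "0 < s" using assms by simp
  define b where "b \<alpha> = \<bar>c \<alpha>\<bar> * s ^ mi_order \<alpha>" for \<alpha>
  have b: "b summable_on UNIV"
    unfolding b_def by (rule bounded_sums_summable[OF _ c]) (use s in auto)
  obtain e :: "nat \<Rightarrow> ('n \<Rightarrow> nat)" where e: "bij e" by (rule countable_enumeration)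
  have sums_e: "(\<lambda>n. h (e n)) sums S" if "(h has_sum S) UNIV" for h :: "_ \<Rightarrow> real" and S
    using that has_sum_reindex_bij_betw[OF e, of h S] has_sum_imp_sums by blast
  \<comment> \<open>Differentiation lowers the i-th exponent, so the coefficient of the derivative
    at \<beta> comes from the index with that exponent raised by one.\<close>
  define \<phi> where "\<phi> \<beta> = \<beta>(i := Suc (\<beta> i))" for \<beta> :: "'n \<Rightarrow> nat"
  define c' where "c' \<beta> = real (Suc (\<beta> i)) * c (\<phi> \<beta>)" for \<beta>
  have key: "haspd i f D x \<and> ((\<lambda>\<beta>. c' \<beta> * (\<Prod>k\<in>UNIV. (x$k - x0$k) ^ \<beta> k)) has_sum D) UNIV"
    if x: "\<And>k. \<bar>x$k - x0$k\<bar> \<le> s - \<delta>"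
      and D: "D = infsum (\<lambda>\<alpha>. c \<alpha> * (real (\<alpha> i) * (x$i - x0$i) ^ (\<alpha> i - 1) * (\<Prod>k\<in>UNIV-{i}. (x$k - x0$k) ^ \<alpha> k))) UNIV"
    for x D
  proof -
    define P where "P \<alpha> = (\<Prod>k\<in>UNIV-{i}. (x$k - x0$k) ^ \<alpha> k)" for \<alpha>
    define y where "y = x$i - x0$i"
    \<comment> \<open>Half of \<delta> is spent on moving the point; the other half remains for a
      uniform bound on the differentiated terms.\<close>
    define S where "S = {- \<delta> / 2 .. \<delta> / 2}"
    define T where "T \<alpha> \<tau> = c \<alpha> * (real (\<alpha> i) * (y + \<tau>) ^ (\<alpha> i - 1) * P \<alpha>)" for \<alpha> and \<tau> :: real
    have "\<bar>x$k - x0$k\<bar> \<le> s" for k using x[of k] assms by linarith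
    then have "\<bar>P \<alpha>\<bar> \<le> s ^ (\<Sum>k\<in>UNIV-{i}. \<alpha> k)" for \<alpha>
      unfolding P_def by (intro abs_prod_power_le)
    moreover have "mi_order \<alpha> = \<alpha> i + (\<Sum>k\<in>UNIV-{i}. \<alpha> k)" for \<alpha>
      unfolding mi_order_def by (rule sum.remove) auto
    ultimately have P: "s ^ \<alpha> i * \<bar>P \<alpha>\<bar> \<le> s ^ mi_order \<alpha>" for \<alpha>
      using s by (simp add: power_add mult_left_mono)
    have T_bound: "\<bar>T \<alpha> \<tau>\<bar> \<le> b \<alpha> * (2 / \<delta>)" if "\<tau> \<in> S" for \<alpha> \<tau>
    proof -
      have "\<bar>y + \<tau>\<bar> \<le> s - \<delta> / 2" using x[of i] that by (auto simp: y_def S_def)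
      then have "real (\<alpha> i) * \<bar>y + \<tau>\<bar> ^ (\<alpha> i - 1) * (\<delta> / 2) \<le> real (\<alpha> i) * (s - \<delta> / 2) ^ (\<alpha> i - 1) * (\<delta> / 2)"
        using assms by (intro mult_right_mono mult_left_mono power_mono) auto
      also have "\<dots> \<le> s ^ \<alpha> i"
        using power_derivative_bound[of "s - \<delta> / 2" "\<delta> / 2" "\<alpha> i"] assms by simp
      finally have "real (\<alpha> i) * \<bar>y + \<tau>\<bar> ^ (\<alpha> i - 1) \<le> s ^ \<alpha> i * (2 / \<delta>)"
        using assms by (simp add: field_simps)
      then have "\<bar>T \<alpha> \<tau>\<bar> \<le> \<bar>c \<alpha>\<bar> * ((s ^ \<alpha> i * (2 / \<delta>)) * \<bar>P \<alpha>\<bar>)"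
        unfolding T_def abs_mult power_abs abs_of_nat
        by (intro mult_left_mono mult_right_mono) auto
      also have "\<dots> = \<bar>c \<alpha>\<bar> * (s ^ \<alpha> i * \<bar>P \<alpha>\<bar>) * (2 / \<delta>)" by (simp add: mult_ac)
      also have "\<dots> \<le> b \<alpha> * (2 / \<delta>)"
        unfolding b_def using assms P[of \<alpha>] by (intro mult_right_mono mult_left_mono) auto
      finally show ?thesis .
    qed
    have b2: "(\<lambda>\<alpha>. b \<alpha> * (2 / \<delta>)) summable_on UNIV"
      using b by (rule summable_on_cmult_left)
    have sb: "summable (\<lambda>n. b (e n) * (2 / \<delta>))"
      by (rule sums_summable[OF sums_e[OF has_sum_infsum[OF b2]]])
    have along: "((\<lambda>\<alpha>. c \<alpha> * ((y + \<tau>) ^ \<alpha> i * P \<alpha>)) has_sum f (x + \<tau> *\<^sub>R axis i 1)) UNIV"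
      if "\<tau> \<in> S" for \<tau>
    proof -
      have "\<forall>k. \<bar>(x + \<tau> *\<^sub>R axis i 1) $ k - x0 $ k\<bar> \<le> s"
      proof
        fix k
        show "\<bar>(x + \<tau> *\<^sub>R axis i 1) $ k - x0 $ k\<bar> \<le> s"
          using x[of k] that assms by (auto simp: S_def axis_def)
      qed
      moreover have "(\<Prod>k\<in>UNIV. ((x + \<tau> *\<^sub>R axis i 1) $ k - x0 $ k) ^ \<alpha> k) = (y + \<tau>) ^ \<alpha> i * P \<alpha>" for \<alpha>
      proof -
        have "(\<Prod>k\<in>UNIV. ((x + \<tau> *\<^sub>R axis i 1) $ k - x0 $ k) ^ \<alpha> k)
          = ((x + \<tau> *\<^sub>R axis i 1) $ i - x0 $ i) ^ \<alpha> i * (\<Prod>k\<in>UNIV-{i}. ((x + \<tau> *\<^sub>R axis i 1) $ k - x0 $ k) ^ \<alpha> k)"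
          by (rule prod.remove) auto
        also have "(\<Prod>k\<in>UNIV-{i}. ((x + \<tau> *\<^sub>R axis i 1) $ k - x0 $ k) ^ \<alpha> k) = P \<alpha>"
          unfolding P_def by (intro prod.cong) (auto simp: axis_def)
        finally show ?thesis by (simp add: y_def algebra_simps)
      qed
      ultimately show ?thesis using f[of "x + \<tau> *\<^sub>R axis i 1"] by simp
    qed
    have S0: "0 \<in> S" "0 \<in> interior S" using assms by (auto simp: S_def)
    have "(\<lambda>\<alpha>. norm (T \<alpha> 0)) summable_on UNIV"
      by (rule Infinite_Sum.abs_summable_on_comparison_test'[OF b2]) (use T_bound[OF S0(1)] in auto)
    then have hsD: "((\<lambda>\<alpha>. T \<alpha> 0) has_sum D) UNIV"
      unfolding D T_def P_def y_def by (simp add: Infinite_Sum.abs_summable_summable)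
    have D': "((\<lambda>\<tau>. \<Sum>n. c (e n) * ((y + \<tau>) ^ (e n) i * P (e n))) has_field_derivative (\<Sum>n. T (e n) 0)) (at 0)"
    proof (rule has_field_derivative_series'(2)[where S = S and x0 = 0])
      show "((\<lambda>\<tau>. c (e n) * ((y + \<tau>) ^ (e n) i * P (e n))) has_field_derivative T (e n) \<tau>) (at \<tau> within S)" for n \<tau>
        unfolding T_def by (auto intro!: derivative_eq_intros)
      show "uniformly_convergent_on S (\<lambda>n \<tau>. \<Sum>k<n. T (e k) \<tau>)"
        by (rule Weierstrass_m_test'[OF _ sb]) (use T_bound in auto)
      show "summable (\<lambda>n. c (e n) * ((y + 0) ^ (e n) i * P (e n)))"
        by (rule sums_summable[OF sums_e[OF along[OF S0(1)]]])
    qed (use S0 in \<open>auto simp: S_def\<close>)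
    have "(\<Sum>n. T (e n) 0) = D" using sums_e[OF hsD] by (rule sums_unique[symmetric])
    with D' have D'': "((\<lambda>\<tau>. \<Sum>n. c (e n) * ((y + \<tau>) ^ (e n) i * P (e n))) has_field_derivative D) (at 0)"
      by simp
    have "haspd i f D x"
      unfolding haspd_def
    proof (rule has_field_derivative_transform_within_open[OF D'' open_interior S0(2)])
      fix \<tau> assume "\<tau> \<in> interior S"
      then have "\<tau> \<in> S" using interior_subset by blast
      from sums_e[OF along[OF this]] show "(\<Sum>n. c (e n) * ((y + \<tau>) ^ (e n) i * P (e n))) = f (x + \<tau> *\<^sub>R axis i 1)"
        by (rule sums_unique[symmetric])
    qed
    moreover have "((\<lambda>\<beta>. c' \<beta> * (\<Prod>k\<in>UNIV. (x$k - x0$k) ^ \<beta> k)) has_sum D) UNIV"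
    proof -
      \<comment> \<open>Indices outside the range have i-th exponent 0, and their differentiated
        terms vanish.\<close>
      have "((\<lambda>\<alpha>. T \<alpha> 0) has_sum D) (range \<phi>)"
      proof (rule has_sum_cong_neutral[THEN iffD1, OF _ _ _ hsD])
        fix \<alpha> assume "\<alpha> \<in> UNIV - range \<phi>"
        moreover have "\<alpha> = \<phi> (\<alpha>(i := \<alpha> i - 1))" if "\<alpha> i \<noteq> 0"
          using that by (auto simp: \<phi>_def fun_eq_iff)
        ultimately have "\<alpha> i = 0" by blast
        then show "T \<alpha> 0 = 0" by (simp add: T_def)
      qed auto
      moreover have "inj \<phi>"
        by (rule inj_on_inverseI[where g = "\<lambda>\<alpha>. \<alpha>(i := \<alpha> i - 1)"]) (simp add: \<phi>_def)
      ultimately have "((\<lambda>\<beta>. T (\<phi> \<beta>) 0) has_sum D) UNIV"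
        using has_sum_reindex[of \<phi> UNIV "\<lambda>\<alpha>. T \<alpha> 0" D] by (simp add: o_def)
      moreover have "T (\<phi> \<beta>) 0 = c' \<beta> * (\<Prod>k\<in>UNIV. (x$k - x0$k) ^ \<beta> k)" for \<beta>
      proof -
        have "(\<Prod>k\<in>UNIV. (x$k - x0$k) ^ \<beta> k) = y ^ \<beta> i * (\<Prod>k\<in>UNIV-{i}. (x$k - x0$k) ^ \<beta> k)"
          unfolding y_def by (rule prod.remove) auto
        also have "(\<Prod>k\<in>UNIV-{i}. (x$k - x0$k) ^ \<beta> k) = P (\<phi> \<beta>)"
          unfolding P_def by (intro prod.cong) (auto simp: \<phi>_def)
        finally show ?thesis by (simp add: T_def c'_def \<phi>_def)
      qed
      ultimately show ?thesis by simp
    qed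
    ultimately show ?thesis by simp
  qed
  show hp: "haspd i f (pd i f x) x" if "\<And>k. \<bar>x$k - x0$k\<bar> \<le> s - \<delta>" for x
    using key[OF that refl] haspd_pd by force
  show "cube_series x0 (s - \<delta>) (M / \<delta>) (pd i f)"
    unfolding cube_series_def
  proof (intro exI[of _ c'] conjI allI impI)
    fix F :: "('n \<Rightarrow> nat) set" assume F: "finite F"
    \<comment> \<open>Now the whole \<delta> is available, which yields \<open>M / \<delta>\<close>
      and not the weaker \<open>2 * M / \<delta>\<close> that the convergence argument would
      give.\<close>
    have "(\<Sum>\<beta>\<in>F. \<bar>c' \<beta>\<bar> * (s - \<delta>) ^ mi_order \<beta>) \<le> (\<Sum>\<beta>\<in>F. b (\<phi> \<beta>) / \<delta>)"
    proof (rule sum_mono)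
      fix \<beta>
      have o: "mi_order (\<phi> \<beta>) = Suc (mi_order \<beta>)"
        unfolding mi_order_def \<phi>_def by (subst (1 2) sum.remove[of UNIV i]) auto
      have "\<beta> i \<le> mi_order \<beta>" unfolding mi_order_def by (rule member_le_sum) auto
      then have "real (Suc (\<beta> i)) * (s - \<delta>) ^ mi_order \<beta> * \<delta> \<le> real (Suc (mi_order \<beta>)) * (s - \<delta>) ^ mi_order \<beta> * \<delta>"
        using assms by (intro mult_right_mono) auto
      also have "\<dots> \<le> s ^ mi_order (\<phi> \<beta>)"
        using power_derivative_bound[of "s - \<delta>" \<delta> "Suc (mi_order \<beta>)"] assms o by simp
      finally have "real (Suc (\<beta> i)) * (s - \<delta>) ^ mi_order \<beta> \<le> s ^ mi_order (\<phi> \<beta>) / \<delta>"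
        using assms(2) by (simp only: pos_le_divide_eq)
      then have "\<bar>c (\<phi> \<beta>)\<bar> * (real (Suc (\<beta> i)) * (s - \<delta>) ^ mi_order \<beta>) \<le> \<bar>c (\<phi> \<beta>)\<bar> * (s ^ mi_order (\<phi> \<beta>) / \<delta>)"
        by (rule mult_left_mono) simp
      then show "\<bar>c' \<beta>\<bar> * (s - \<delta>) ^ mi_order \<beta> \<le> b (\<phi> \<beta>) / \<delta>"
        unfolding c'_def b_def abs_mult by (simp only: abs_of_nat mult_ac times_divide_eq_right)
    qed
    also have "\<dots> = (\<Sum>\<alpha>\<in>\<phi> ` F. b \<alpha>) / \<delta>"
    proof -
      have "inj_on \<phi> F"
        by (rule inj_on_inverseI[where g = "\<lambda>\<alpha>. \<alpha>(i := \<alpha> i - 1)"]) (simp add: \<phi>_def)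
      then show ?thesis by (simp add: sum.reindex sum_divide_distrib)
    qed
    also have "\<dots> \<le> M / \<delta>"
      using c[of "\<phi> ` F"] F assms by (simp add: b_def divide_right_mono)
    finally show "(\<Sum>\<beta>\<in>F. \<bar>c' \<beta>\<bar> * (s - \<delta>) ^ mi_order \<beta>) \<le> M / \<delta>" .
  next
    fix x assume "\<forall>k. \<bar>x$k - x0$k\<bar> \<le> s - \<delta>"
    then show "((\<lambda>\<beta>. c' \<beta> * (\<Prod>k\<in>UNIV. (x$k - x0$k) ^ \<beta> k)) has_sum pd i f x) UNIV"
      using key[OF _ refl, of x] haspd_pd by force
  qed
qed

lemma cube_series_pd_list:
  assumes "cube_series x0 s M f" "0 < \<delta>" "real (length is) * \<delta> < s"
  shows "cube_series x0 (s - real (length is) * \<delta>) (M / \<delta> ^ length is) (pd_list is f)"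
  using assms(3)
proof (induction "is")
  case (Cons i "is")
  have lt: "real (length is) * \<delta> < s - \<delta>" using Cons.prems by (simp add: algebra_simps)
  then have "cube_series x0 (s - real (length is) * \<delta>) (M / \<delta> ^ length is) (pd_list is f)"
    using assms(2) by (intro Cons.IH) simp
  from cube_series_deriv(2)[OF this assms(2), of i] lt show ?case
    by (simp add: algebra_simps)
qed (use assms in simp)

lemma cube_series_Ck:
  fixes x0 :: "real^'n::finite"
  assumes "cube_series x0 s M f" "q < s" "0 < q"
  shows "Ck n {x. \<forall>i. \<bar>x$i - x0$i\<bar> < q} f"
  using assms
proof (induction n arbitrary: f s M)
  case 0
  have "{x. \<forall>i. \<bar>x$i - x0$i\<bar> < q} \<subseteq> {x. \<forall>i. \<bar>x$i - x0$i\<bar> \<le> s}"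
    using 0 by (auto intro: order.trans[OF less_imp_le])
  then show ?case
    using continuous_on_subset[OF cube_series_continuous[OF 0(1)]] by simp
next
  case (Suc n)
  \<comment> \<open>Each derivative consumes half of the remaining gap above q, so the gap never
    closes.\<close>
  define \<delta> where "\<delta> = (s - q) / 2"
  have \<delta>: "0 < \<delta>" "\<delta> < s" "q < s - \<delta>" using Suc.prems by (auto simp: \<delta>_def field_simps)
  have "{x. \<forall>i. \<bar>x$i - x0$i\<bar> < q} \<subseteq> {x. \<forall>i. \<bar>x$i - x0$i\<bar> \<le> s}"
    using Suc.prems by (auto intro: order.trans[OF less_imp_le])
  then have "continuous_on {x. \<forall>i. \<bar>x$i - x0$i\<bar> < q} f"
    using continuous_on_subset[OF cube_series_continuous[OF Suc.prems(1)]] by blast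
  moreover have "haspd i f (pd i f x) x" if "\<forall>i. \<bar>x$i - x0$i\<bar> < q" for i x
    by (rule cube_series_deriv(1)[OF Suc.prems(1) \<delta>(1,2)]) (use that \<delta>(3) in \<open>auto intro: order.trans[OF less_imp_le]\<close>)
  moreover have "Ck n {x. \<forall>i. \<bar>x$i - x0$i\<bar> < q} (pd i f)" for i
    using cube_series_deriv(2)[OF Suc.prems(1) \<delta>(1,2)] \<delta>(3) Suc.prems(3) by (rule Suc.IH)
  ultimately show ?case by simp
qed

text \<open>At the corner of a small cube the given expansion is a convergent sum of the terms
  \<open>c \<alpha> * s ^ mi_order \<alpha>\<close>; unordered convergence of reals is absolute,
  which gives the majorant.\<close>

lemma real_analytic_cube_series:
  fixes x0 :: "real^'n::finite"
  assumes "real_analytic_on f U" "x0 \<in> U"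
  obtains s M where "s > 0" "cube_series x0 s M f"
proof -
  obtain r c where r: "r > 0" and f: "\<And>x. x \<in> ball x0 r \<Longrightarrow> ((\<lambda>\<alpha>. c \<alpha> * (\<Prod>i\<in>UNIV. (x$i - x0$i) ^ \<alpha> i)) has_sum f x) UNIV"
    using assms unfolding real_analytic_on_def by blast
  define s where "s = r / (2 * real CARD('n))"
  have s: "s > 0" using r by (simp add: s_def)
  have ball: "x \<in> ball x0 r" if "\<forall>i. \<bar>x$i - x0$i\<bar> \<le> s" for x
  proof -
    have "dist x0 x \<le> (\<Sum>i\<in>UNIV. \<bar>(x0 - x) $ i\<bar>)"
      unfolding dist_norm by (rule norm_le_l1_cart)
    also have "\<dots> \<le> (\<Sum>i\<in>(UNIV::'n set). s)"
      by (rule sum_mono) (use that in \<open>simp add: abs_minus_commute\<close>)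
    also have "\<dots> < r" using r by (simp add: s_def)
    finally show ?thesis by simp
  qed
  define x1 where "x1 = (\<chi> i. x0 $ i + s)"
  have "(\<lambda>\<alpha>. c \<alpha> * (\<Prod>i\<in>UNIV. (x1$i - x0$i) ^ \<alpha> i)) summable_on UNIV"
    using f[OF ball[of x1]] s by (auto simp: x1_def summable_on_def)
  then have "(\<lambda>\<alpha>. c \<alpha> * s ^ mi_order \<alpha>) summable_on UNIV"
    by (simp add: x1_def mi_order_def power_sum)
  then have "(\<lambda>\<alpha>. \<bar>c \<alpha>\<bar> * s ^ mi_order \<alpha>) summable_on UNIV"
    using s by (subst (asm) summable_on_iff_abs_summable_on_real) (simp add: abs_mult)
  then have "(\<Sum>\<alpha>\<in>F. \<bar>c \<alpha>\<bar> * s ^ mi_order \<alpha>) \<le> infsum (\<lambda>\<alpha>. \<bar>c \<alpha>\<bar> * s ^ mi_order \<alpha>) UNIV"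
    if "finite F" for F
    using s that by (intro finite_sum_le_infsum) auto
  then have "cube_series x0 s (infsum (\<lambda>\<alpha>. \<bar>c \<alpha>\<bar> * s ^ mi_order \<alpha>) UNIV) f"
    unfolding cube_series_def using f ball by blast
  then show ?thesis using that s by blast
qed

lemma real_analytic_smooth:
  fixes f :: "real^'n::finite \<Rightarrow> real"
  assumes "real_analytic_on f U"
  shows "smooth U f"
  unfolding smooth_def
proof (intro allI Ck_local)
  fix n and x0 :: "real^'n" assume "x0 \<in> U"
  then obtain s M where s: "s > 0" and "cube_series x0 s M f" using real_analytic_cube_series assms by blast
  then have "Ck n {x. \<forall>i. \<bar>x$i - x0$i\<bar> < s / 2} f" by (intro cube_series_Ck) auto
  moreover have "open {x::real^'n. \<forall>i. \<bar>x$i - x0$i\<bar> < s / 2}"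
    unfolding Collect_all_eq by (intro open_INT ballI finite open_Collect_less continuous_intros)
  ultimately show "\<exists>V. open V \<and> x0 \<in> V \<and> Ck n V f"
    using s by (intro exI[of _ "{x. \<forall>i. \<bar>x$i - x0$i\<bar> < s / 2}"]) auto
qed

section \<open>Cauchy estimates\<close>

definition fact_bound :: "(real^'n::finite) set \<Rightarrow> (real^'n \<Rightarrow> real) \<Rightarrow> real \<Rightarrow> real \<Rightarrow> bool" where
  "fact_bound U f A R \<longleftrightarrow> (\<forall>is. \<forall>x\<in>U. \<bar>pd_list is f x\<bar> \<le> A * R ^ length is * fact (length is))"

text \<open>The quotient of \<open>n ^ n\<close> by \<open>fact n\<close> is one term of the
  exponential series at n.\<close>

lemma power_self_le_fact: "real n ^ n \<le> exp 1 ^ n * fact n"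
proof -
  have "real n ^ n / fact n \<le> exp (real n)"
    using sum_le_suminf[OF summable_exp_generic[of "real n"], of "{n}"]
    by (simp add: exp_def divide_inverse mult.commute)
  moreover have "exp (real n) = exp 1 ^ n" using exp_of_nat_mult[of n "1::real"] by simp
  ultimately show ?thesis by (simp add: field_simps)
qed

lemma real_analytic_fact_bound:
  fixes f :: "real^'n::finite \<Rightarrow> real"
  assumes "real_analytic_on f U" "x0 \<in> U"
  obtains r A R where "r > 0" "A \<ge> 0" "R \<ge> 0" "fact_bound (ball x0 r) f A R"
proof -
  obtain s M where s: "s > 0" and cube_series: "cube_series x0 s M f" using real_analytic_cube_series assms by blast
  have M: "M \<ge> 0" using cube_series_bound[OF cube_series, of x0] s by simp
  have "\<bar>pd_list is f x\<bar> \<le> M * (2 * exp 1 / s) ^ length is * fact (length is)"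
    if x: "x \<in> ball x0 (s / 2)" for "is" x
  proof -
    define n where "n = length is"
    have x': "\<bar>x$k - x0$k\<bar> \<le> s / 2" for k
      using component_le_norm_cart[of "x - x0" k] x by (simp add: dist_norm norm_minus_commute)
    show ?thesis
    proof (cases "n = 0")
      case True
      have "\<bar>x$k - x0$k\<bar> \<le> s" for k using x'[of k] s by linarith
      then show ?thesis using cube_series_bound[OF cube_series, of x] True unfolding n_def by simp
    next
      case False
      \<comment> \<open>The n derivatives share half of the radius equally and together cost
        \<open>(2 * n / s) ^ n\<close>, which \<open>power_self_le_fact\<close> turns into a
        factorial.\<close>
      define \<delta> where "\<delta> = s / (2 * real n)"
      have \<delta>: "0 < \<delta>" "real n * \<delta> = s / 2" using s False by (auto simp: \<delta>_def)
      have "cube_series x0 (s - real n * \<delta>) (M / \<delta> ^ n) (pd_list is f)"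
        unfolding n_def by (rule cube_series_pd_list[OF cube_series \<delta>(1)]) (use \<delta> s in \<open>simp add: n_def\<close>)
      moreover have "s - real n * \<delta> = s / 2" using \<delta> by simp
      ultimately have "cube_series x0 (s / 2) (M / \<delta> ^ n) (pd_list is f)" by simp
      then have "\<bar>pd_list is f x\<bar> \<le> M / \<delta> ^ n"
        by (rule cube_series_bound) (rule x')
      also have "\<dots> = M * (2 / s) ^ n * real n ^ n"
        by (simp add: \<delta>_def power_divide power_mult_distrib)
      also have "\<dots> \<le> M * (2 / s) ^ n * (exp 1 ^ n * fact n)"
        using M s power_self_le_fact[of n] by (intro mult_left_mono) auto
      finally show ?thesis by (simp add: n_def power_divide power_mult_distrib)
    qed
  qed
  then show ?thesis
    using that[of "s / 2" M "2 * exp 1 / s"] s M unfolding fact_bound_def by simp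
qed

subsection \<open>Factorial derivative bounds and the coefficients of the Laplacian\<close>

lemma splits_rest:
  fixes h :: "nat \<Rightarrow> nat \<Rightarrow> real"
  assumes "splits is = ([], is) # r"
  shows "(\<Sum>(xs, ys)\<leftarrow>r. h (length xs) (length ys))
    = (\<Sum>k=1..length is. (length is choose k) * h k (length is - k))"
proof -
  have "h 0 (length is) + (\<Sum>(xs, ys)\<leftarrow>r. h (length xs) (length ys))
      = (\<Sum>k\<le>length is. (length is choose k) * h k (length is - k))"
    using splits_binomial[of h "is"] by (simp add: assms)
  also have "\<dots> = h 0 (length is) + (\<Sum>k=1..length is. (length is choose k) * h k (length is - k))"
    by (simp add: atMost_atLeast0 sum.atLeast_Suc_atMost)
  finally show ?thesis by simp
qed

lemma abs_sum_list_splits_le: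
  assumes "\<And>xs ys. (xs, ys) \<in> set r \<Longrightarrow> \<bar>F xs ys\<bar> \<le> h (length xs) (length ys)"
  shows "\<bar>\<Sum>(xs, ys)\<leftarrow>r. F xs ys\<bar> \<le> (\<Sum>(xs, ys)\<leftarrow>r. (h (length xs) (length ys) :: real))"
proof -
  have "\<bar>\<Sum>(xs, ys)\<leftarrow>r. F xs ys\<bar> \<le> (\<Sum>(xs, ys)\<leftarrow>r. \<bar>F xs ys\<bar>)"
    using sum_list_abs[of "map (\<lambda>(xs, ys). F xs ys) r"] by (simp add: o_def case_prod_unfold)
  also have "\<dots> \<le> (\<Sum>(xs, ys)\<leftarrow>r. h (length xs) (length ys))"
    by (rule sum_list_mono) (use assms in auto)
  finally show ?thesis .
qed

lemma binomial_fact_real: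
  "k \<le> n \<Longrightarrow> real (n choose k) * fact k * fact (n - k) = fact n"
  by (simp add: binomial_fact)

lemma fact_bound_mono:
  assumes "fact_bound U f A R" "V \<subseteq> U" "A \<le> A'" "0 \<le> R" "R \<le> R'" "0 \<le> A"
  shows "fact_bound V f A' R'"
  unfolding fact_bound_def
proof (intro allI ballI)
  fix "is" x assume "x \<in> V"
  then have "\<bar>pd_list is f x\<bar> \<le> A * R ^ length is * fact (length is)"
    using assms by (auto simp: fact_bound_def)
  also have "\<dots> \<le> A' * R' ^ length is * fact (length is)"
    using assms by (intro mult_right_mono mult_mono power_mono) auto
  finally show "\<bar>pd_list is f x\<bar> \<le> A' * R' ^ length is * fact (length is)" .
qed

lemma fact_bound_add:
  assumes "open U" "smooth U f" "smooth U h" "fact_bound U f A R" "fact_bound U h A R"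
  shows "fact_bound U (\<lambda>x. f x + h x) (2 * A) R"
  unfolding fact_bound_def
proof (intro allI ballI)
  fix "is" x assume x: "x \<in> U"
  have "\<bar>pd_list is f x\<bar> \<le> A * R ^ length is * fact (length is)"
    "\<bar>pd_list is h x\<bar> \<le> A * R ^ length is * fact (length is)"
    using assms x by (auto simp: fact_bound_def)
  then show "\<bar>pd_list is (\<lambda>x. f x + h x) x\<bar> \<le> 2 * A * R ^ length is * fact (length is)"
    using pd_list_add[OF assms(1-3) x, of "is"] by simp
qed

text \<open>The factorials cancel the binomial coefficients, so all n + 1 Leibniz terms have the
  same bound; \<open>n + 1 \<le> 2 ^ n\<close> hides their number in a doubled
  \<open>R\<close>.\<close>

lemma fact_bound_mult:
  fixes U :: "(real^'n::finite) set"
  assumes "open U" "smooth U f" "smooth U h" "fact_bound U f A R" "fact_bound U h A R" "0 \<le> A" "0 \<le> R"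
  shows "fact_bound U (\<lambda>x. f x * h x) (A * A) (2 * R)"
  unfolding fact_bound_def
proof (intro allI ballI)
  fix "is" :: "'n list" and x assume x: "x \<in> U"
  let ?n = "length is"
  let ?h = "\<lambda>k l. (A * R ^ k * fact k) * (A * R ^ l * fact l)"
  have b: "\<bar>pd_list xs f x\<bar> \<le> A * R ^ length xs * fact (length xs)"
    "\<bar>pd_list xs h x\<bar> \<le> A * R ^ length xs * fact (length xs)" for xs
    using assms x by (auto simp: fact_bound_def)
  have "\<bar>pd_list is (\<lambda>x. f x * h x) x\<bar> \<le> (\<Sum>(xs, ys)\<leftarrow>splits is. ?h (length xs) (length ys))"
    unfolding pd_list_mult[OF assms(1-3) x]
    by (rule abs_sum_list_splits_le) (use b assms in \<open>auto simp: abs_mult intro!: mult_mono\<close>)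
  also have "\<dots> = (\<Sum>k\<le>?n. (?n choose k) * ?h k (?n - k))" by (rule splits_binomial)
  also have "\<dots> = (\<Sum>k\<le>?n. A * A * R ^ ?n * fact ?n)"
  proof (rule sum.cong)
    fix k assume "k \<in> {..?n}"
    then have k: "k \<le> ?n" by simp
    have "(?n choose k) * ?h k (?n - k) = A * A * (R ^ k * R ^ (?n - k)) * (real (?n choose k) * fact k * fact (?n - k))"
      by (simp only: mult_ac)
    also have "R ^ k * R ^ (?n - k) = R ^ ?n" using k by (simp flip: power_add)
    finally show "(?n choose k) * ?h k (?n - k) = A * A * R ^ ?n * fact ?n"
      using binomial_fact_real[OF k] by simp
  qed simp
  also have "\<dots> = real (Suc ?n) * (A * A * R ^ ?n * fact ?n)" by simp
  also have "\<dots> \<le> 2 ^ ?n * (A * A * R ^ ?n * fact ?n)"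
  proof (rule mult_right_mono)
    have "Suc ?n \<le> 2 ^ ?n" by (simp add: Suc_leI less_exp)
    then show "real (Suc ?n) \<le> 2 ^ ?n" by (metis of_nat_le_iff of_nat_numeral of_nat_power)
  qed (use assms in auto)
  finally show "\<bar>pd_list is (\<lambda>x. f x * h x) x\<bar> \<le> A * A * (2 * R) ^ ?n * fact ?n"
    by (simp add: power_mult_distrib mult_ac)
qed

text \<open>The doubled \<open>R\<close> absorbs the factor n + 1 by which the factorial
  grows.\<close>

lemma fact_bound_pd:
  fixes U :: "(real^'n::finite) set"
  assumes "fact_bound U f A R" "0 \<le> A" "0 \<le> R"
  shows "fact_bound U (pd i f) (A * R) (2 * R)"
  unfolding fact_bound_def
proof (intro allI ballI)
  fix "is" :: "'n list" and x assume x: "x \<in> U"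
  let ?n = "length is"
  have "\<bar>pd_list (is @ [i]) f x\<bar> \<le> A * R ^ length (is @ [i]) * fact (length (is @ [i]))"
    using assms x unfolding fact_bound_def by blast
  then have "\<bar>pd_list is (pd i f) x\<bar> \<le> real (Suc ?n) * (A * R * R ^ ?n * fact ?n)"
    by (simp add: pd_list_append algebra_simps)
  also have "\<dots> \<le> 2 ^ ?n * (A * R * R ^ ?n * fact ?n)"
  proof (rule mult_right_mono)
    have "Suc ?n \<le> 2 ^ ?n" by (simp add: Suc_leI less_exp)
    then show "real (Suc ?n) \<le> 2 ^ ?n" by (metis of_nat_le_iff of_nat_numeral of_nat_power)
  qed (use assms in auto)
  finally show "\<bar>pd_list is (pd i f) x\<bar> \<le> A * R * (2 * R) ^ ?n * fact ?n"
    by (simp add: power_mult_distrib mult_ac)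
qed

lemma pd_const: "pd i (\<lambda>x. c) = (\<lambda>x. 0)"
  using haspd_pd[OF haspd_const] by blast

lemma pd_list_const: "pd_list is (\<lambda>x. c) = (\<lambda>x. if is = [] then c else 0)"
  by (induction "is") (auto simp: pd_const)

lemma fact_bound_const: "fact_bound U (\<lambda>x. c) \<bar>c\<bar> 0"
  unfolding fact_bound_def by (auto simp: pd_list_const)

lemma geometric_tail_le:
  fixes \<theta> :: real
  assumes "0 \<le> \<theta>" "\<theta> \<le> 1 / 2"
  shows "(\<Sum>k=1..n. \<theta> ^ k) \<le> 2 * \<theta>" "(\<Sum>k\<le>n. \<theta> ^ k) \<le> 2"
proof -
  have *: "(\<Sum>k\<le>n. \<theta> ^ k) \<le> 2" for n
  proof (induction n)
    case (Suc n)
    have "(\<Sum>k\<le>Suc n. \<theta> ^ k) = 1 + \<theta> * (\<Sum>k\<le>n. \<theta> ^ k)"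
      by (subst sum.atMost_Suc_shift) (simp add: sum_distrib_left)
    also have "\<dots> \<le> 1 + (1 / 2) * 2"
      using assms Suc by (intro add_mono mult_mono sum_nonneg) auto
    finally show ?case by simp
  qed simp
  show "(\<Sum>k\<le>n. \<theta> ^ k) \<le> 2" by (rule *)
  show "(\<Sum>k=1..n. \<theta> ^ k) \<le> 2 * \<theta>"
  proof (cases n)
    case (Suc m)
    have "(\<Sum>k=1..n. \<theta> ^ k) = \<theta> * (\<Sum>k\<le>m. \<theta> ^ k)"
      using sum.shift_bounds_cl_Suc_ivl[of "\<lambda>k. \<theta> ^ k" 0 m]
      by (simp add: Suc sum_distrib_left atMost_atLeast0)
    also have "\<dots> \<le> \<theta> * 2" using * assms by (intro mult_left_mono)
    finally show ?thesis by simp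
  qed (use assms in simp)
qed

text \<open>Differentiating \<open>f * (1 / f) = 1\<close> and solving for the term with all
  derivatives on \<open>1 / f\<close> gives a recursion in their number. The other terms form a
  geometric series in \<open>R / S\<close>, and the last two conditions on \<open>S\<close> make its
  sum small enough to reproduce the constant \<open>1 / d\<close>.\<close>

lemma fact_bound_inverse:
  assumes U: "open U" "smooth U f" and fb: "fact_bound U f A R"
    and d: "0 < d" "\<And>x. x \<in> U \<Longrightarrow> d \<le> \<bar>f x\<bar>" and AR: "0 \<le> A" "0 \<le> R"
    and S: "0 < S" "2 * R \<le> S" "2 * A * R \<le> d * S"
  shows "fact_bound U (\<lambda>x. 1 / f x) (1 / d) S"
  unfolding fact_bound_def
proof (intro allI ballI)
  fix "is" x assume x: "x \<in> U"
  have nz: "f y \<noteq> 0" if "y \<in> U" for y using d(2)[OF that] d(1) by auto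
  let ?h = "\<lambda>x. 1 / f x"
  have sh: "smooth U ?h" by (rule smooth_inverse[OF U]) (rule nz)
  show "\<bar>pd_list is ?h x\<bar> \<le> (1 / d) * S ^ length is * fact (length is)"
  proof (induction "length is" arbitrary: "is" rule: less_induct)
    case less
    let ?n = "length is"
    show ?case
    proof (cases "is = []")
      case True
      then show ?thesis using d(2)[OF x] d(1) by (simp add: frac_le)
    next
      case False
      obtain r where r: "splits is = ([], is) # r" and rn: "\<forall>(xs, ys)\<in>set r. xs \<noteq> []"
        using splits_Nil_fst by blast
      let ?p = "\<lambda>k l. (A * R ^ k * fact k) * ((1 / d) * S ^ l * fact l)"
      define \<theta> where "\<theta> = R / S"
      have \<theta>: "0 \<le> \<theta>" "\<theta> \<le> 1 / 2" "2 * A * \<theta> \<le> d" "R = \<theta> * S"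
        using S AR by (auto simp: \<theta>_def field_simps)
      \<comment> \<open>A non-empty list of derivatives annihilates the constant 1.\<close>
      have "0 = pd_list is (\<lambda>x. f x * ?h x) x"
        using pd_list_cong[OF U(1) x, of "\<lambda>x. f x * ?h x" "\<lambda>x. 1" "is"] nz False
        by (simp add: pd_list_const)
      also have "\<dots> = f x * pd_list is ?h x + (\<Sum>(xs, ys)\<leftarrow>r. pd_list xs f x * pd_list ys ?h x)"
        unfolding pd_list_mult[OF U sh x] r by simp
      finally have "\<bar>f x * pd_list is ?h x\<bar> = \<bar>\<Sum>(xs, ys)\<leftarrow>r. pd_list xs f x * pd_list ys ?h x\<bar>"
        by linarith
      also have "\<dots> \<le> (\<Sum>(xs, ys)\<leftarrow>r. ?p (length xs) (length ys))"
      proof (rule abs_sum_list_splits_le)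
        fix xs ys assume m: "(xs, ys) \<in> set r"
        have "length xs + length ys = ?n" using m r splits_length[of xs ys "is"] by simp
        moreover have "xs \<noteq> []" using rn m by auto
        ultimately have "length ys < ?n" by (cases xs) auto
        then have "\<bar>pd_list ys ?h x\<bar> \<le> (1 / d) * S ^ length ys * fact (length ys)" by (rule less)
        then show "\<bar>pd_list xs f x * pd_list ys ?h x\<bar> \<le> ?p (length xs) (length ys)"
          unfolding abs_mult using fb x AR by (intro mult_mono) (auto simp: fact_bound_def)
      qed
      also have "\<dots> = (\<Sum>k=1..?n. (?n choose k) * ?p k (?n - k))" by (rule splits_rest[OF r])
      also have "\<dots> = (\<Sum>k=1..?n. (A / d * S ^ ?n * fact ?n) * \<theta> ^ k)"
      proof (rule sum.cong)
        fix k assume "k \<in> {1..?n}"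
        then have k: "k \<le> ?n" by simp
        have "(?n choose k) * ?p k (?n - k)
          = A / d * (S ^ k * S ^ (?n - k)) * (real (?n choose k) * fact k * fact (?n - k)) * \<theta> ^ k"
          by (simp add: \<theta>(4) power_mult_distrib)
        also have "S ^ k * S ^ (?n - k) = S ^ ?n" using k by (simp flip: power_add)
        finally show "(?n choose k) * ?p k (?n - k) = (A / d * S ^ ?n * fact ?n) * \<theta> ^ k"
          using binomial_fact_real[OF k] by simp
      qed simp
      also have "\<dots> = (A / d * S ^ ?n * fact ?n) * (\<Sum>k=1..?n. \<theta> ^ k)" by (simp add: sum_distrib_left)
      also have "\<dots> \<le> (A / d * S ^ ?n * fact ?n) * (2 * \<theta>)"
        using geometric_tail_le(1)[OF \<theta>(1,2)] AR d S by (intro mult_left_mono) auto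
      also have "\<dots> = (2 * A * \<theta> / d) * (S ^ ?n * fact ?n)" by (simp add: mult_ac)
      also have "\<dots> \<le> 1 * (S ^ ?n * fact ?n)"
        using \<theta> d S by (intro mult_right_mono) (auto simp: field_simps)
      finally have "\<bar>f x\<bar> * \<bar>pd_list is ?h x\<bar> \<le> S ^ ?n * fact ?n" by (simp add: abs_mult)
      moreover have "d * \<bar>pd_list is ?h x\<bar> \<le> \<bar>f x\<bar> * \<bar>pd_list is ?h x\<bar>"
        using d(2)[OF x] by (rule mult_right_mono) simp
      ultimately have "d * \<bar>pd_list is ?h x\<bar> \<le> S ^ ?n * fact ?n" by linarith
      then show ?thesis using d(1) by (simp add: field_simps)
    qed
  qed
qed

text \<open>With all constants existential, closure properties compose without bookkeeping; common
  constants for finitely many coefficients are extracted by \<open>ana_at_family\<close>.\<close>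

definition ana_at :: "real^'n::finite \<Rightarrow> (real^'n \<Rightarrow> real) \<Rightarrow> bool" where
  "ana_at x0 f \<longleftrightarrow> (\<exists>r>0. \<exists>A\<ge>0. \<exists>R\<ge>0. smooth (ball x0 r) f \<and> fact_bound (ball x0 r) f A R)"

lemma ana_at_family:
  assumes "finite I" "\<And>k. k \<in> I \<Longrightarrow> ana_at x0 (f k)"
  shows "\<exists>r>0. \<exists>A\<ge>0. \<exists>R\<ge>0. \<forall>k\<in>I. smooth (ball x0 r) (f k) \<and> fact_bound (ball x0 r) (f k) A R"
  using assms
proof (induction I)
  case empty
  show ?case by (auto intro: exI[of _ 1])
next
  case (insert k I)
  then obtain r A R where 1: "r > 0" "A \<ge> 0" "R \<ge> 0"
    "\<forall>k\<in>I. smooth (ball x0 r) (f k) \<and> fact_bound (ball x0 r) (f k) A R" by blast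
  obtain r' A' R' where 2: "r' > 0" "A' \<ge> 0" "R' \<ge> 0"
    "smooth (ball x0 r') (f k)" "fact_bound (ball x0 r') (f k) A' R'"
    using insert.prems[of k] unfolding ana_at_def by blast
  have "smooth (ball x0 (min r r')) (f l) \<and> fact_bound (ball x0 (min r r')) (f l) (max A A') (max R R')"
    if "l \<in> insert k I" for l
  proof (cases "l = k")
    case True
    then show ?thesis
      using 2 by (auto intro!: smooth_subset[OF 2(4)] fact_bound_mono[OF 2(5)])
  next
    case False
    then have l: "smooth (ball x0 r) (f l)" "fact_bound (ball x0 r) (f l) A R" using that 1 by auto
    then show ?thesis
      using 1 by (auto intro!: smooth_subset[OF l(1)] fact_bound_mono[OF l(2)])
  qed
  then show ?case
    using 1 2 by (intro exI[of _ "min r r'"] exI[of _ "max A A'"] exI[of _ "max R R'"] conjI) auto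
qed

lemma ana_at_at_pair:
  assumes "ana_at x0 f" "ana_at x0 h"
  obtains r A R where "r > 0" "A \<ge> 0" "R \<ge> 0" "smooth (ball x0 r) f" "smooth (ball x0 r) h"
    "fact_bound (ball x0 r) f A R" "fact_bound (ball x0 r) h A R"
  using ana_at_family[of "{True, False}" x0 "\<lambda>t. if t then f else h"] assms that
  by fastforce

lemma ana_at_const: "ana_at x0 (\<lambda>x. c)"
  unfolding ana_at_def
  by (intro exI[of _ "1::real"] exI[of _ "\<bar>c\<bar>"] exI[of _ "0::real"] conjI smooth_const fact_bound_const) auto

lemma ana_at_add: assumes "ana_at x0 f" "ana_at x0 h" shows "ana_at x0 (\<lambda>x. f x + h x)"
proof -
  obtain r A R where *: "r > 0" "A \<ge> 0" "R \<ge> 0" "smooth (ball x0 r) f" "smooth (ball x0 r) h"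
    "fact_bound (ball x0 r) f A R" "fact_bound (ball x0 r) h A R"
    using ana_at_at_pair[OF assms] by metis
  show ?thesis unfolding ana_at_def
    using * by (intro exI[of _ r] exI[of _ "2 * A"] exI[of _ R] conjI smooth_add fact_bound_add) auto
qed

lemma ana_at_mult: assumes "ana_at x0 f" "ana_at x0 h" shows "ana_at x0 (\<lambda>x. f x * h x)"
proof -
  obtain r A R where *: "r > 0" "A \<ge> 0" "R \<ge> 0" "smooth (ball x0 r) f" "smooth (ball x0 r) h"
    "fact_bound (ball x0 r) f A R" "fact_bound (ball x0 r) h A R"
    using ana_at_at_pair[OF assms] by metis
  show ?thesis unfolding ana_at_def
    using * by (intro exI[of _ r] exI[of _ "A * A"] exI[of _ "2 * R"] conjI smooth_mult fact_bound_mult) auto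
qed

lemma ana_at_sum: "(\<And>k. k \<in> I \<Longrightarrow> ana_at x0 (f k)) \<Longrightarrow> ana_at x0 (\<lambda>x. \<Sum>k\<in>I. f k x)"
  by (induction I rule: infinite_finite_induct) (auto intro!: ana_at_const ana_at_add)

lemma ana_at_prod: "(\<And>k. k \<in> I \<Longrightarrow> ana_at x0 (f k)) \<Longrightarrow> ana_at x0 (\<lambda>x. \<Prod>k\<in>I. f k x)"
  by (induction I rule: infinite_finite_induct) (auto intro!: ana_at_const ana_at_mult)

lemma ana_at_pd: assumes "ana_at x0 f" shows "ana_at x0 (pd i f)"
proof -
  obtain r A R where *: "r > 0" "A \<ge> 0" "R \<ge> 0" "smooth (ball x0 r) f" "fact_bound (ball x0 r) f A R"
    using assms unfolding ana_at_def by blast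
  show ?thesis unfolding ana_at_def
    using * by (intro exI[of _ r] exI[of _ "A * R"] exI[of _ "2 * R"] conjI smooth_pd fact_bound_pd) auto
qed

lemma ana_at_inverse: assumes "ana_at x0 f" "f x0 \<noteq> 0" shows "ana_at x0 (\<lambda>x. 1 / f x)"
proof -
  obtain r A R where *: "r > 0" "A \<ge> 0" "R \<ge> 0" "smooth (ball x0 r) f" "fact_bound (ball x0 r) f A R"
    using assms unfolding ana_at_def by blast
  define d where "d = \<bar>f x0\<bar> / 2"
  have d: "d > 0" using assms by (simp add: d_def)
  have "isCont f x0"
    using smooth_continuous[OF *(4)] *(1) by (simp add: continuous_on_eq_continuous_at)
  then obtain e where e: "e > 0" "\<And>x. dist x x0 < e \<Longrightarrow> dist (f x) (f x0) < d"
    using d unfolding continuous_at_eps_delta by blast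
  define q where "q = min r e"
  have q: "q > 0" "ball x0 q \<subseteq> ball x0 r" using * e by (auto simp: q_def)
  have dl: "d \<le> \<bar>f x\<bar>" if "x \<in> ball x0 q" for x
  proof -
    have "dist (f x) (f x0) < d" using e(2)[of x] that by (simp add: q_def dist_commute)
    then show ?thesis unfolding d_def dist_real_def by linarith
  qed
  \<comment> \<open>The sum of all lower bounds on \<open>S\<close> that
    \<open>fact_bound_inverse\<close> imposes.\<close>
  define S where "S = 1 + 2 * R + 2 * A * R / d"
  have "0 \<le> 2 * A * R / d" using * d by simp
  then have S: "0 < S" "2 * R \<le> S" using *(3) by (auto simp: S_def)
  have "2 * A * R = d * (2 * A * R / d)" using d by simp
  also have "\<dots> \<le> d * S" using d *(3) by (intro mult_left_mono) (auto simp: S_def)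
  finally have S2: "2 * A * R \<le> d * S" .
  have sm: "smooth (ball x0 q) f" using *(4) q(2) by (rule smooth_subset)
  have "fact_bound (ball x0 q) f A R" using *(5) q(2) by (rule fact_bound_mono) (use * in auto)
  then have "fact_bound (ball x0 q) (\<lambda>x. 1 / f x) (1 / d) S"
    by (rule fact_bound_inverse[OF open_ball sm]) (use * d dl S S2 in auto)
  moreover have "smooth (ball x0 q) (\<lambda>x. 1 / f x)"
    by (rule smooth_inverse[OF open_ball sm]) (use dl d in force)
  ultimately show ?thesis unfolding ana_at_def using q d S by (intro exI[of _ q] exI[of _ "1 / d"] exI[of _ S] conjI) auto
qed

lemma fact_bound_cong:
  assumes "open U" "\<And>y. y \<in> U \<Longrightarrow> f y = h y" "fact_bound U f A R"
  shows "fact_bound U h A R"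
  unfolding fact_bound_def
proof (intro allI ballI)
  fix "is" x assume x: "x \<in> U"
  have "pd_list is f x = pd_list is h x" by (rule pd_list_cong[OF assms(1) x assms(2)])
  then show "\<bar>pd_list is h x\<bar> \<le> A * R ^ length is * fact (length is)"
    using assms(3) x unfolding fact_bound_def by metis
qed

lemma ana_at_cong:
  assumes "open U" "x0 \<in> U" "\<And>y. y \<in> U \<Longrightarrow> f y = h y" "ana_at x0 f"
  shows "ana_at x0 h"
proof -
  obtain r A R where *: "r > 0" "A \<ge> 0" "R \<ge> 0" "smooth (ball x0 r) f" "fact_bound (ball x0 r) f A R"
    using assms unfolding ana_at_def by blast
  obtain e where e: "e > 0" "ball x0 e \<subseteq> U" using assms(1,2) openE by blast
  define q where "q = min r e"
  have q: "q > 0" "ball x0 q \<subseteq> ball x0 r" "ball x0 q \<subseteq> U" using * e by (auto simp: q_def)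
  have sm: "smooth (ball x0 q) f" using *(4) q(2) by (rule smooth_subset)
  have fb: "fact_bound (ball x0 q) f A R" using *(5) q(2) by (rule fact_bound_mono) (use * in auto)
  have eq: "f y = h y" if "y \<in> ball x0 q" for y using assms(3) q(3) that by blast
  show ?thesis unfolding ana_at_def
    using * q smooth_cong[OF open_ball eq sm] fact_bound_cong[OF open_ball eq fb] by blast
qed

lemma real_analytic_ana_at:
  assumes "real_analytic_on f U" "open U" "x0 \<in> U"
  shows "ana_at x0 f"
proof -
  obtain r A R where *: "r > 0" "A \<ge> 0" "R \<ge> 0" "fact_bound (ball x0 r) f A R"
    using real_analytic_fact_bound[OF assms(1,3)] by metis
  obtain e where e: "e > 0" "ball x0 e \<subseteq> U" using assms(2,3) openE by blast
  have "smooth (ball x0 (min r e)) f"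
    by (rule smooth_subset[OF real_analytic_smooth[OF assms(1)]]) (use e in auto)
  moreover have "fact_bound (ball x0 (min r e)) f A R"
    by (rule fact_bound_mono[OF *(4)]) (use * in auto)
  ultimately show ?thesis
    unfolding ana_at_def using * e by (intro exI[of _ "min r e"] exI[of _ A] exI[of _ R] conjI) auto
qed

section \<open>The inverse metric and the expanded Laplacian\<close>

lemma ana_at_det:
  fixes G :: "real^'m::finite \<Rightarrow> real^'n^'n::finite"
  assumes "\<And>i j. ana_at x0 (\<lambda>x. G x $ i $ j)"
  shows "ana_at x0 (\<lambda>x. det (G x))"
  unfolding det_def by (intro ana_at_sum ana_at_mult ana_at_const ana_at_prod assms)

lemma pos_def_det_nonzero:
  fixes A :: "real^'n^'n"
  assumes "\<And>v. v \<noteq> 0 \<Longrightarrow> v \<bullet> (A *v v) > 0"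
  shows "det A \<noteq> 0"
proof -
  have "\<forall>v. A *v v = 0 \<longrightarrow> v = 0" using assms by force
  then have "\<exists>B. B ** A = mat 1" by (simp add: matrix_left_invertible_ker)
  then show ?thesis using invertible_left_inverse invertible_det_nz by blast
qed

lemma matrix_inv_mult:
  fixes A :: "real^'n^'n"
  assumes "det A \<noteq> 0"
  shows "A ** matrix_inv A = mat 1"
proof -
  have "\<exists>B. A ** B = mat 1 \<and> B ** A = mat 1"
    using assms by (simp add: invertible_det_nz[symmetric] invertible_def)
  then show ?thesis unfolding matrix_inv_def by (rule someI2_ex) simp
qed

text \<open>Cramer's rule makes the inverse entries quotients of polynomials in the entries, to
  which the closure properties of \<open>ana_at\<close> apply.\<close>

lemma matrix_inv_cramer:
  fixes A :: "real^'n^'n"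
  assumes "det A \<noteq> 0"
  shows "matrix_inv A $ k $ j = det (\<chi> i l. if l = k then axis j 1 $ i else A $ i $ l) / det A"
proof -
  have "A *v (matrix_inv A *v axis j 1) = axis j 1"
    using matrix_inv_mult[OF assms] by (simp add: matrix_vector_mul_assoc)
  then have "(matrix_inv A *v axis j 1) $ k = det (\<chi> i l. if l = k then axis j 1 $ i else A $ i $ l) / det A"
    using cramer[OF assms, of "matrix_inv A *v axis j 1" "axis j 1"]
    by (metis (no_types, lifting) vec_lambda_beta)
  moreover have "(matrix_inv A *v axis j 1) $ k = matrix_inv A $ k $ j"
    by (simp add: matrix_vector_mult_basis column_def)
  ultimately show ?thesis by simp
qed

text \<open>With \<open>\<xi> = A *v \<eta>\<close> the form of the inverse at \<xi> is the form of
  \<open>A\<close> at \<eta>.\<close>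

lemma matrix_inv_pos_def:
  fixes A :: "real^'n^'n"
  assumes "\<And>v. v \<noteq> 0 \<Longrightarrow> v \<bullet> (A *v v) > 0" "\<xi> \<noteq> 0"
  shows "\<xi> \<bullet> (matrix_inv A *v \<xi>) > 0"
proof -
  let ?\<eta> = "matrix_inv A *v \<xi>"
  have "A *v ?\<eta> = \<xi>"
    using matrix_inv_mult[OF pos_def_det_nonzero[OF assms(1)]] by (simp add: matrix_vector_mul_assoc)
  moreover from this have "?\<eta> \<noteq> 0" using assms(2) by auto
  ultimately show ?thesis using assms(1)[of ?\<eta>] by (simp add: inner_commute)
qed

text \<open>For a negative argument \<open>sqrt\<close> is \<open>- sqrt \<bar>_\<bar>\<close>, so the logarithmic derivative has the same form for both
  signs and \<open>det g \<noteq> 0\<close> suffices below.\<close>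

lemma haspd_sqrt:
  assumes "haspd i f D x" "f x \<noteq> 0"
  shows "haspd i (\<lambda>x. sqrt (f x)) (sqrt (f x) * (D / (2 * f x))) x"
proof -
  have "DERIV sqrt (f x) :> sqrt (f x) / (2 * f x)"
    by (rule DERIV_real_sqrt_generic[OF assms(2)])
       (simp_all add: divide_simps real_sqrt_mult_self flip: real_sqrt_mult)
  then have "DERIV sqrt (f (x + 0 *\<^sub>R axis i 1)) :> sqrt (f x) / (2 * f x)" by simp
  from DERIV_chain2[OF this assms(1)[unfolded haspd_def]]
  show ?thesis unfolding haspd_def by (simp add: mult_ac)
qed

text \<open>The square root of the determinant cancels against the prefactor and survives only in
  its logarithmic derivative, so the coefficients are rational in the metric and its first
  derivatives.\<close>

lemma laplacian_expand:
  fixes g :: "real^'n::finite \<Rightarrow> real^'n^'n"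
  assumes U: "open U" "x \<in> U"
    and sm: "\<And>i j. smooth U (\<lambda>x. matrix_inv (g x) $ i $ j)" "smooth U (\<lambda>x. det (g x))" "smooth U v"
    and nz: "det (g x) \<noteq> 0"
  shows "laplacian g v x = (\<Sum>i\<in>UNIV. \<Sum>j\<in>UNIV. matrix_inv (g x) $ i $ j * pd i (pd j v) x)
    + (\<Sum>j\<in>UNIV. (\<Sum>i\<in>UNIV. pd i (\<lambda>x. matrix_inv (g x) $ i $ j) x
          + matrix_inv (g x) $ i $ j * (pd i (\<lambda>x. det (g x)) x * (1 / det (g x)) * (1 / 2))) * pd j v x)"
proof -
  let ?d = "\<lambda>x. det (g x)"
  let ?a = "\<lambda>i j x. matrix_inv (g x) $ i $ j"
  let ?s = "sqrt (?d x)"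
  have s: "?s \<noteq> 0" using nz by simp
  have *: "pd i (\<lambda>y. sqrt (?d y) * (\<Sum>j\<in>UNIV. ?a i j y * pd j v y)) x
     = ?s * (pd i ?d x / (2 * ?d x)) * (\<Sum>j\<in>UNIV. ?a i j x * pd j v x)
       + ?s * (\<Sum>j\<in>UNIV. pd i (?a i j) x * pd j v x + ?a i j x * pd i (pd j v) x)" for i
    using U sm nz by (intro haspd_pd haspd_mult haspd_sqrt haspd_sum smooth_haspd[of U] smooth_pd) auto
  have "laplacian g v x = (\<Sum>i\<in>UNIV. (pd i ?d x / (2 * ?d x)) * (\<Sum>j\<in>UNIV. ?a i j x * pd j v x)
       + (\<Sum>j\<in>UNIV. pd i (?a i j) x * pd j v x + ?a i j x * pd i (pd j v) x))"
  proof -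
    have "(1 / c) * (\<Sum>i\<in>UNIV. c * p i * y i + c * z i) = (\<Sum>i\<in>(UNIV::'n set). p i * y i + z i)"
      if "c \<noteq> 0" for c :: real and p y z
      using that by (simp add: sum_distrib_left add_divide_distrib distrib_left)
    from this[OF s] show ?thesis
      unfolding laplacian_def by (simp only: *)
  qed
  also have "\<dots> = (\<Sum>i\<in>UNIV. \<Sum>j\<in>UNIV. ?a i j x * pd i (pd j v) x)
     + (\<Sum>i\<in>UNIV. \<Sum>j\<in>UNIV. (pd i (?a i j) x + ?a i j x * (pd i ?d x * (1 / ?d x) * (1 / 2))) * pd j v x)"
    by (simp add: sum.distrib sum_distrib_left sum_distrib_right sum_divide_distrib algebra_simps)
  also have "(\<Sum>i\<in>UNIV. \<Sum>j\<in>UNIV. (pd i (?a i j) x + ?a i j x * (pd i ?d x * (1 / ?d x) * (1 / 2))) * pd j v x)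
     = (\<Sum>j\<in>UNIV. (\<Sum>i\<in>UNIV. pd i (?a i j) x + ?a i j x * (pd i ?d x * (1 / ?d x) * (1 / 2))) * pd j v x)"
    by (subst sum.swap) (simp add: sum_distrib_right)
  finally show ?thesis .
qed

abbreviation principal :: "('n::finite \<Rightarrow> 'n \<Rightarrow> real^'n \<Rightarrow> real) \<Rightarrow> (real^'n \<Rightarrow> real) \<Rightarrow> real^'n \<Rightarrow> real" where
  "principal a v x \<equiv> \<Sum>i\<in>UNIV. \<Sum>j\<in>UNIV. a i j x * pd i (pd j v) x"

text \<open>All later constants are computed from the numbers obtained here, hence from the metric
  alone. The bound \<open>r \<le> 1\<close> keeps the weight at most 1.\<close>

lemma laplacian_coefficients:
  fixes g :: "real^'n::finite \<Rightarrow> real^'n^'n"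
  assumes "analytic_riemannian_metric_on g (ball 0 4)"
  obtains a :: "'n \<Rightarrow> 'n \<Rightarrow> real^'n \<Rightarrow> real" and b :: "'n \<Rightarrow> real^'n \<Rightarrow> real" and r A R l
  where "0 < r" "r \<le> 1" "0 \<le> A" "0 \<le> R" "0 < l"
    "\<And>i j. smooth (ball 0 r) (a i j)" "\<And>i j. fact_bound (ball 0 r) (a i j) A R"
    "\<And>j. smooth (ball 0 r) (b j)" "\<And>j. fact_bound (ball 0 r) (b j) A R"
    "\<And>x \<xi>. x \<in> ball 0 r \<Longrightarrow> l * (\<Sum>i\<in>UNIV. (\<xi> i)\<^sup>2) \<le> (\<Sum>i\<in>UNIV. \<Sum>j\<in>UNIV. a i j x * \<xi> i * \<xi> j)"
    "\<And>v x. smooth (ball 0 r) v \<Longrightarrow> x \<in> ball 0 r \<Longrightarrow>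
       laplacian g v x = principal a v x + (\<Sum>j\<in>UNIV. b j x * pd j v x)"
proof -
  have an: "\<And>i j. real_analytic_on (\<lambda>x. g x $ i $ j) (ball 0 4)"
    and pd: "\<And>x v. x \<in> ball 0 4 \<Longrightarrow> v \<noteq> 0 \<Longrightarrow> v \<bullet> (g x *v v) > 0"
    using assms unfolding analytic_riemannian_metric_on_def by auto
  have nz: "det (g x) \<noteq> 0" if "x \<in> ball 0 4" for x
    using pd[OF that] by (rule pos_def_det_nonzero)
  define d where "d x = det (g x)" for x
  define a where "a i j x = matrix_inv (g x) $ i $ j" for i j x
  have deq: "d = (\<lambda>x. det (g x))" by (simp add: fun_eq_iff d_def)
  have aeq: "a i j = (\<lambda>x. matrix_inv (g x) $ i $ j)" for i j by (simp add: fun_eq_iff a_def)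
  define b where "b j x = (\<Sum>i\<in>UNIV. pd i (a i j) x + a i j x * (pd i d x * (1 / d x) * (1 / 2)))" for j x
  have g: "ana_at 0 (\<lambda>x. g x $ i $ j)" for i j
    by (rule real_analytic_ana_at[OF an]) auto
  have d_ana: "ana_at 0 d" unfolding d_def by (rule ana_at_det[OF g])
  have di: "ana_at 0 (\<lambda>x. 1 / d x)" by (rule ana_at_inverse[OF d_ana]) (use nz[of 0] in \<open>simp add: d_def\<close>)
  have a_ana: "ana_at 0 (a k j)" for k j
  proof (rule ana_at_cong)
    show "det (\<chi> i l. if l = k then axis j 1 $ i else g x $ i $ l) * (1 / d x) = a k j x"
      if "x \<in> ball 0 4" for x
      using matrix_inv_cramer[OF nz[OF that]] by (simp add: a_def d_def)
    have "ana_at 0 (\<lambda>x. (\<chi> i l. if l = k then axis j 1 $ i else g x $ i $ l) $ p $ q)" for p q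
      by (cases "q = k") (auto intro: ana_at_const g)
    then show "ana_at 0 (\<lambda>x. det (\<chi> i l. if l = k then axis j 1 $ i else g x $ i $ l) * (1 / d x))"
      by (intro ana_at_mult di ana_at_det)
  qed auto
  have b_ana: "ana_at 0 (b j)" for j
    unfolding b_def by (intro ana_at_sum ana_at_add ana_at_mult ana_at_pd ana_at_const a_ana d_ana di)
  obtain r1 A1 R1 where 1: "r1 > 0" "A1 \<ge> 0" "R1 \<ge> 0"
    "\<forall>k\<in>UNIV. smooth (ball 0 r1) (case_prod a k) \<and> fact_bound (ball 0 r1) (case_prod a k) A1 R1"
    using ana_at_family[of UNIV 0 "case_prod a"] a_ana by (auto simp: case_prod_unfold)
  obtain r2 A2 R2 where 2: "r2 > 0" "A2 \<ge> 0" "R2 \<ge> 0"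
    "\<forall>k\<in>UNIV. smooth (ball 0 r2) (b k) \<and> fact_bound (ball 0 r2) (b k) A2 R2"
    using ana_at_family[of UNIV 0 b] b_ana by auto
  obtain r3 where 3: "r3 > 0" "smooth (ball 0 r3) d" using d_ana unfolding ana_at_def by blast
  define q where "q = min (min r1 r2) (min r3 1)"
  have q: "q > 0" "q \<le> r1" "q \<le> r2" "q \<le> r3" "q \<le> 1" using 1 2 3 by (auto simp: q_def)
  \<comment> \<open>Halving puts the closed ball of radius r inside the region of smoothness, as
    compactness requires.\<close>
  define r where "r = q / 2"
  have r: "0 < r" "r \<le> 1" "r < q" using q by (auto simp: r_def)
  have sa: "smooth (ball 0 q) (a i j)" for i j
    using smooth_subset[OF _ subset_ball[OF q(2)], of 0 "a i j"] 1(4) by auto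
  \<comment> \<open>The ellipticity constant is the minimum of this form over the closed ball times
    the unit sphere; homogeneity extends it to all vectors.\<close>
  define Q where "Q p = (\<Sum>i\<in>UNIV. \<Sum>j\<in>UNIV. a i j (fst p) * snd p $ i * snd p $ j)" for p :: "(real^'n) \<times> (real^'n)"
  let ?K = "cball (0::real^'n) r \<times> sphere (0::real^'n) 1"
  have Qeq: "Q (x, \<xi>) = \<xi> \<bullet> (matrix_inv (g x) *v \<xi>)" for x \<xi>
    unfolding Q_def a_def
    by (simp add: inner_vec_def matrix_vector_mult_def sum_distrib_left mult_ac)
  have "continuous_on ?K (\<lambda>p. a i j (fst p))" for i j
  proof (rule continuous_on_compose2[OF smooth_continuous[OF sa[of i j]]])
    show "continuous_on ?K fst" by (intro continuous_intros)
    show "fst ` ?K \<subseteq> ball 0 q" using r by auto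
  qed
  then have "continuous_on ?K Q" unfolding Q_def by (intro continuous_intros)
  moreover have "compact ?K" by (intro compact_Times compact_cball compact_sphere)
  moreover have "?K \<noteq> {}"
    using r(1) norm_axis_1[of "undefined :: 'n"] by (auto intro!: exI[of _ "axis undefined 1"] exI[of _ 0] simp: dist_norm)
  ultimately obtain p where p: "p \<in> ?K" "\<And>y. y \<in> ?K \<Longrightarrow> Q p \<le> Q y"
    using continuous_attains_inf[of ?K Q] by metis
  define l where "l = Q p"
  have p4: "fst p \<in> ball 0 4" "snd p \<noteq> 0" using p(1) r by (auto simp: mem_Times_iff)
  have l: "l > 0"
    using matrix_inv_pos_def[OF pd[OF p4(1)] p4(2)] Qeq[of "fst p" "snd p"] by (simp add: l_def)
  have ell: "l * (\<Sum>i\<in>UNIV. (\<xi> i)\<^sup>2) \<le> (\<Sum>i\<in>UNIV. \<Sum>j\<in>UNIV. a i j x * \<xi> i * \<xi> j)"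
    if "x \<in> ball 0 r" for x and \<xi> :: "'n \<Rightarrow> real"
  proof (cases "(\<chi> i. \<xi> i) = (0 :: real^'n)")
    case True
    then have "\<xi> i = 0" for i by (simp add: vec_eq_iff)
    then show ?thesis by simp
  next
    case False
    define z where "z = (\<chi> i. \<xi> i)"
    define n where "n = norm z"
    have n: "n > 0" using False by (simp add: z_def n_def)
    have n2: "n\<^sup>2 = (\<Sum>i\<in>UNIV. (\<xi> i)\<^sup>2)"
      by (simp add: n_def z_def norm_vec_def L2_set_def sum_nonneg)
    have "l \<le> Q (x, (1 / n) *\<^sub>R z)"
      unfolding l_def by (rule p(2)) (use that n in \<open>simp add: n_def\<close>)
    also have "\<dots> = (\<Sum>i\<in>UNIV. \<Sum>j\<in>UNIV. a i j x * \<xi> i * \<xi> j) / n\<^sup>2"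
      unfolding Q_def by (simp add: z_def sum_divide_distrib power2_eq_square mult_ac)
    finally show ?thesis using n by (simp add: n2[symmetric] field_simps)
  qed
  show ?thesis
  proof (rule that[of r "max A1 A2" "max R1 R2" l a b])
    show "smooth (ball 0 r) (a i j)" for i j
      by (rule smooth_subset[OF sa]) (use r in auto)
    show "smooth (ball 0 r) (b j)" for j
      by (rule smooth_subset[of "ball 0 r2"]) (use 2 r q in auto)
    show "fact_bound (ball 0 r) (a i j) (max A1 A2) (max R1 R2)" for i j
      by (rule fact_bound_mono[of "ball 0 r1" _ A1 R1]) (use 1 r q in auto)
    show "fact_bound (ball 0 r) (b j) (max A1 A2) (max R1 R2)" for j
      by (rule fact_bound_mono[of "ball 0 r2" _ A2 R2]) (use 2 r q in auto)
    show "laplacian g v x = principal a v x + (\<Sum>j\<in>UNIV. b j x * pd j v x)"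
      if "smooth (ball 0 r) v" "x \<in> ball 0 r" for v x
    proof -
      have "laplacian g v x = (\<Sum>i\<in>UNIV. \<Sum>j\<in>UNIV. matrix_inv (g x) $ i $ j * pd i (pd j v) x)
        + (\<Sum>j\<in>UNIV. (\<Sum>i\<in>UNIV. pd i (\<lambda>x. matrix_inv (g x) $ i $ j) x
          + matrix_inv (g x) $ i $ j * (pd i (\<lambda>x. det (g x)) x * (1 / det (g x)) * (1 / 2))) * pd j v x)"
      proof (rule laplacian_expand[OF open_ball that(2) _ _ that(1)])
        show "smooth (ball 0 r) (\<lambda>x. matrix_inv (g x) $ i $ j)" for i j
          using smooth_subset[OF sa[of i j] subset_ball[OF less_imp_le[OF r(3)]]] by (simp add: aeq)
        show "smooth (ball 0 r) (\<lambda>x. det (g x))"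
          using smooth_subset[OF 3(2) subset_ball, of r] r q by (simp add: deq)
        show "det (g x) \<noteq> 0" using nz[of x] that(2) r by simp
      qed
      then show ?thesis unfolding b_def aeq deq .
    qed
  qed (use r l ell 1 2 in auto)
qed

subsection \<open>Weighted L2 norms and integration by parts\<close>

text \<open>The Bochner integral of a non-integrable function is 0, so this behaves as a norm only
  where integrability is known; hence the side condition \<open>csupp\<close> below.\<close>

definition L2 :: "(real^'n::finite \<Rightarrow> real) \<Rightarrow> real" where
  "L2 f = sqrt (\<integral>x. (f x)\<^sup>2 \<partial>lborel)"

definition csupp :: "real \<Rightarrow> (real^'n::finite \<Rightarrow> real) \<Rightarrow> bool" where
  "csupp \<rho> f \<longleftrightarrow> continuous_on UNIV f \<and> (\<forall>x. \<rho> \<le> norm x \<longrightarrow> f x = 0)"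

lemma csupp_integrable:
  assumes "csupp \<rho> f"
  shows "integrable lborel f"
proof -
  have "integrable lborel (\<lambda>x. indicator (cball 0 \<rho>) x *\<^sub>R f x)"
    using assms unfolding csupp_def
    by (intro borel_integrable_compact compact_cball) (auto intro: continuous_on_subset)
  moreover have "(\<lambda>x. indicator (cball 0 \<rho>) x *\<^sub>R f x) = f"
    using assms by (auto simp: csupp_def fun_eq_iff indicator_def)
  ultimately show ?thesis by simp
qed

lemma csupp_add: "csupp \<rho> f \<Longrightarrow> csupp \<rho> h \<Longrightarrow> csupp \<rho> (\<lambda>x. f x + h x)"
  unfolding csupp_def by (auto intro: continuous_intros)

lemma csupp_mult: "csupp \<rho> f \<Longrightarrow> csupp \<rho> h \<Longrightarrow> csupp \<rho> (\<lambda>x. f x * h x)"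
  unfolding csupp_def by (auto intro: continuous_intros)

lemma csupp_cmult: "csupp \<rho> f \<Longrightarrow> csupp \<rho> (\<lambda>x. c * f x)"
  unfolding csupp_def by (auto intro: continuous_intros)

lemma csupp_abs: "csupp \<rho> f \<Longrightarrow> csupp \<rho> (\<lambda>x. \<bar>f x\<bar>)"
  unfolding csupp_def by (auto intro: continuous_intros)

lemma csupp_power2: "csupp \<rho> f \<Longrightarrow> csupp \<rho> (\<lambda>x. (f x)\<^sup>2)"
  unfolding csupp_def by (auto intro: continuous_intros)

lemma csupp_zero: "csupp \<rho> (\<lambda>x. 0)"
  unfolding csupp_def by auto

lemma csupp_sum: "(\<And>k. k \<in> A \<Longrightarrow> csupp \<rho> (f k)) \<Longrightarrow> csupp \<rho> (\<lambda>x. \<Sum>k\<in>A. f k x)"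
  unfolding csupp_def by (auto intro: continuous_intros)

lemma csupp_sum_list: "(\<And>k. k \<in> set A \<Longrightarrow> csupp \<rho> (f k)) \<Longrightarrow> csupp \<rho> (\<lambda>x. \<Sum>k\<leftarrow>A. f k x)"
  by (induction A) (auto intro: csupp_add csupp_zero)

lemma continuous_on_extend_zero:
  fixes f :: "real^'n::finite \<Rightarrow> real"
  assumes "continuous_on (ball 0 R) f" "\<rho> < R" "\<And>x. \<rho> \<le> norm x \<Longrightarrow> f x = 0"
  shows "continuous_on UNIV f"
proof -
  have o: "open {x::real^'n. \<rho> < norm x}" by (intro open_Collect_less continuous_intros)
  have "continuous_on {x. \<rho> < norm x} f"
    using continuous_on_cong[of "{x. \<rho> < norm x}" "{x. \<rho> < norm x}" f "\<lambda>x. 0"] assms(3) by simp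
  then have "continuous_on (ball 0 R \<union> {x. \<rho> < norm x}) f"
    by (intro continuous_on_open_Un assms o) auto
  moreover have "ball 0 R \<union> {x::real^'n. \<rho> < norm x} = UNIV" using assms(2) by auto
  ultimately show ?thesis by simp
qed

text \<open>Nothing is known of \<open>w\<close> outside \<open>ball 0 R\<close>, but the other
  factor already vanishes there.\<close>

lemma csupp_mult_local:
  assumes "csupp \<rho> f" "continuous_on (ball 0 R) w" "\<rho> < R"
  shows "csupp \<rho> (\<lambda>x. f x * w x)"
  unfolding csupp_def
proof
  have "continuous_on (ball 0 R) (\<lambda>x. f x * w x)"
    using assms(1) unfolding csupp_def
    by (intro continuous_intros assms(2)) (auto intro: continuous_on_subset)
  then show "continuous_on UNIV (\<lambda>x. f x * w x)"
    by (rule continuous_on_extend_zero[OF _ assms(3)]) (use assms(1) in \<open>simp add: csupp_def\<close>)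
qed (use assms(1) in \<open>simp add: csupp_def\<close>)

lemma L2_nonneg: "0 \<le> L2 f"
  by (simp add: L2_def)

lemma L2_square: "(L2 f)\<^sup>2 = (\<integral>x. (f x)\<^sup>2 \<partial>lborel)"
  by (simp add: L2_def)

text \<open>The integral of (f + t h)^2 is non-negative for every t; the minimising t gives the
  claim.\<close>

lemma L2_cauchy_schwarz:
  assumes "csupp \<rho> f" "csupp \<rho> h"
  shows "\<bar>\<integral>x. f x * h x \<partial>lborel\<bar> \<le> L2 f * L2 h"
proof -
  define A B C where "A = (\<integral>x. (f x)\<^sup>2 \<partial>lborel)" and "B = (\<integral>x. f x * h x \<partial>lborel)"
    and "C = (\<integral>x. (h x)\<^sup>2 \<partial>lborel)"
  have int: "integrable lborel (\<lambda>x. (f x)\<^sup>2)" "integrable lborel (\<lambda>x. f x * h x)" "integrable lborel (\<lambda>x. (h x)\<^sup>2)"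
    using assms by (auto intro!: csupp_integrable csupp_power2 csupp_mult)
  have Q: "0 \<le> A + 2 * t * B + t\<^sup>2 * C" for t
  proof -
    have "0 \<le> (\<integral>x. (f x + t * h x)\<^sup>2 \<partial>lborel)" by simp
    also have "\<dots> = (\<integral>x. (f x)\<^sup>2 + (2 * t) * (f x * h x) + t\<^sup>2 * (h x)\<^sup>2 \<partial>lborel)"
      by (rule Bochner_Integration.integral_cong) (auto simp: power2_eq_square algebra_simps)
    also have "\<dots> = A + 2 * t * B + t\<^sup>2 * C"
      using int by (simp add: A_def B_def C_def)
    finally show ?thesis .
  qed
  have C: "0 \<le> C" and A: "0 \<le> A" by (auto simp: A_def C_def)
  have "B\<^sup>2 \<le> A * C"
  proof (cases "C = 0")
    case True
    have "B = 0"
    proof (rule ccontr)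
      assume "B \<noteq> 0"
      \<comment> \<open>At this t the expression takes the value -1.\<close>
      with Q[of "- (A + 1) / (2 * B)"] True show False by (simp add: field_simps)
    qed
    then show ?thesis using True by simp
  next
    case False
    have "0 \<le> A + 2 * (- B / C) * B + (- B / C)\<^sup>2 * C" by (rule Q)
    also have "\<dots> = A - B\<^sup>2 / C" using False by (simp add: power2_eq_square field_simps)
    finally show ?thesis using C False by (simp add: field_simps)
  qed
  then have "sqrt (B\<^sup>2) \<le> sqrt (A * C)" by (rule real_sqrt_le_mono)
  then show ?thesis unfolding L2_def A_def[symmetric] B_def[symmetric] C_def[symmetric]
    by (simp add: real_sqrt_mult)
qed

lemma L2_triangle:
  assumes "csupp \<rho> f" "csupp \<rho> h"
  shows "L2 (\<lambda>x. f x + h x) \<le> L2 f + L2 h"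
proof (rule power2_le_imp_le)
  have int: "integrable lborel (\<lambda>x. (f x)\<^sup>2)" "integrable lborel (\<lambda>x. f x * h x)" "integrable lborel (\<lambda>x. (h x)\<^sup>2)"
    using assms by (auto intro!: csupp_integrable csupp_power2 csupp_mult)
  have "(L2 (\<lambda>x. f x + h x))\<^sup>2 = (\<integral>x. (f x)\<^sup>2 + 2 * (f x * h x) + (h x)\<^sup>2 \<partial>lborel)"
    unfolding L2_square by (rule Bochner_Integration.integral_cong) (auto simp: power2_eq_square algebra_simps)
  also have "\<dots> = (L2 f)\<^sup>2 + 2 * (\<integral>x. f x * h x \<partial>lborel) + (L2 h)\<^sup>2"
    using int by (simp add: L2_square)
  also have "\<dots> \<le> (L2 f)\<^sup>2 + 2 * (L2 f * L2 h) + (L2 h)\<^sup>2"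
    using L2_cauchy_schwarz[OF assms] by simp
  finally show "(L2 (\<lambda>x. f x + h x))\<^sup>2 \<le> (L2 f + L2 h)\<^sup>2"
    by (simp add: power2_eq_square algebra_simps)
qed (simp add: L2_nonneg)

lemma L2_le:
  assumes "csupp \<rho> f" "csupp \<rho> h" "0 \<le> c" "\<And>x. \<bar>f x\<bar> \<le> c * \<bar>h x\<bar>"
  shows "L2 f \<le> c * L2 h"
proof (rule power2_le_imp_le)
  have "(L2 f)\<^sup>2 \<le> (\<integral>x. c\<^sup>2 * (h x)\<^sup>2 \<partial>lborel)"
    unfolding L2_square
  proof (rule integral_mono)
    show "(f x)\<^sup>2 \<le> c\<^sup>2 * (h x)\<^sup>2" for x
      using power_mono[OF assms(4), of x 2] by (simp add: power_mult_distrib)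
  qed (use assms in \<open>auto intro!: csupp_integrable csupp_power2 csupp_cmult\<close>)
  also have "\<dots> = (c * L2 h)\<^sup>2" by (simp add: L2_square power_mult_distrib)
  finally show "(L2 f)\<^sup>2 \<le> (c * L2 h)\<^sup>2" .
qed (use assms(3) L2_nonneg[of h] in simp)

lemma L2_zero: "L2 (\<lambda>x. 0) = 0"
  by (simp add: L2_def)

lemma L2_sum:
  assumes "\<And>k. k \<in> A \<Longrightarrow> csupp \<rho> (f k)"
  shows "L2 (\<lambda>x. \<Sum>k\<in>A. f k x) \<le> (\<Sum>k\<in>A. L2 (f k))"
  using assms
proof (induction A rule: infinite_finite_induct)
  case (insert k A)
  have "L2 (\<lambda>x. f k x + (\<Sum>k\<in>A. f k x)) \<le> L2 (f k) + L2 (\<lambda>x. \<Sum>k\<in>A. f k x)"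
    using insert.prems by (intro L2_triangle[of \<rho>] csupp_sum) auto
  also have "\<dots> \<le> L2 (f k) + (\<Sum>k\<in>A. L2 (f k))" using insert by simp
  finally show ?case using insert by simp
qed (auto simp: L2_zero)

lemma L2_sum_list:
  assumes "\<And>k. k \<in> set A \<Longrightarrow> csupp \<rho> (f k)"
  shows "L2 (\<lambda>x. \<Sum>k\<leftarrow>A. f k x) \<le> (\<Sum>k\<leftarrow>A. L2 (f k))"
  using assms
proof (induction A)
  case (Cons k A)
  have "L2 (\<lambda>x. f k x + (\<Sum>k\<leftarrow>A. f k x)) \<le> L2 (f k) + L2 (\<lambda>x. \<Sum>k\<leftarrow>A. f k x)"
    using Cons.prems by (intro L2_triangle[of \<rho>] csupp_sum_list) auto
  also have "\<dots> \<le> L2 (f k) + (\<Sum>k\<leftarrow>A. L2 (f k))" using Cons by simp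
  finally show ?case by simp
qed (auto simp: L2_zero)

lemma integral_bilinear_bound:
  assumes "csupp \<rho> F" "csupp \<rho> f" "csupp \<rho> h" "0 \<le> c" "\<And>x. \<bar>F x\<bar> \<le> c * (\<bar>f x\<bar> * \<bar>h x\<bar>)"
  shows "\<bar>\<integral>x. F x \<partial>lborel\<bar> \<le> c * (L2 f * L2 h)"
proof -
  have "\<bar>\<integral>x. F x \<partial>lborel\<bar> \<le> (\<integral>x. \<bar>F x\<bar> \<partial>lborel)" by (rule integral_abs_bound)
  also have "\<dots> \<le> (\<integral>x. c * (\<bar>f x\<bar> * \<bar>h x\<bar>) \<partial>lborel)"
    using assms by (intro integral_mono csupp_integrable csupp_cmult csupp_mult csupp_abs) auto
  also have "\<dots> = c * (\<integral>x. \<bar>f x\<bar> * \<bar>h x\<bar> \<partial>lborel)" by simp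
  also have "\<dots> \<le> c * (L2 (\<lambda>x. \<bar>f x\<bar>) * L2 (\<lambda>x. \<bar>h x\<bar>))"
    using L2_cauchy_schwarz[OF csupp_abs[OF assms(2)] csupp_abs[OF assms(3)]] assms(4)
    by (intro mult_left_mono) auto
  finally show ?thesis by (simp add: L2_def)
qed

lemma integral_translate:
  fixes F :: "real^'n::finite \<Rightarrow> real"
  assumes "F \<in> borel_measurable borel"
  shows "(\<integral>x. F (c + x) \<partial>lborel) = (\<integral>x. F x \<partial>lborel)"
proof -
  have "(\<integral>x. F x \<partial>lborel) = (\<integral>x. F x \<partial>distr lborel borel ((+) c))"
    by (simp add: lborel_distr_plus)
  also have "\<dots> = (\<integral>x. F (c + x) \<partial>lborel)"
    using assms by (subst integral_distr) auto
  finally show ?thesis by simp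
qed

text \<open>Translation invariance makes the difference quotients integrate to zero.\<close>

lemma integral_pd_zero:
  fixes F F' :: "real^'n::finite \<Rightarrow> real"
  assumes F: "csupp \<rho> F" and F': "csupp \<rho> F'" and pd: "\<And>x. haspd i F (F' x) x"
  shows "(\<integral>x. F' x \<partial>lborel) = 0"
proof -
  define e where "e = (axis i 1 :: real^'n)"
  define h where "h n = inverse (real (Suc n))" for n
  have h: "0 < h n" "h n \<le> 1" for n by (auto simp: h_def field_simps)
  have h0: "h \<longlonglongrightarrow> 0" unfolding h_def by (rule LIMSEQ_inverse_real_of_nat)
  define D where "D n x = (F (x + h n *\<^sub>R e) - F x) / h n" for n x
  have meas: "F \<in> borel_measurable borel" "F' \<in> borel_measurable borel"
    using F F' by (auto simp: csupp_def intro: borel_measurable_continuous_onI)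
  obtain B where B: "B \<ge> 0" "\<And>x. \<bar>F' x\<bar> \<le> B"
  proof -
    have "bounded (F' ` cball 0 \<rho>)"
      using F' unfolding csupp_def
      by (intro compact_imp_bounded compact_continuous_image compact_cball) (auto intro: continuous_on_subset)
    then obtain B where "\<forall>y\<in>F' ` cball 0 \<rho>. norm y \<le> B"
      unfolding bounded_iff by blast
    then have B: "norm (F' x) \<le> B" if "x \<in> cball 0 \<rho>" for x using that by blast
    have "\<bar>F' x\<bar> \<le> max B 0" for x
      using B[of x] F' by (cases "norm x \<le> \<rho>") (auto simp: csupp_def)
    then show ?thesis using that[of "max B 0"] by simp
  qed
  \<comment> \<open>The shifts have length at most 1, so the quotients vanish outside radius
    \<open>\<rho> + 1\<close>; inside, the mean value theorem bounds them by
    \<open>B\<close>.\<close>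
  have "(\<lambda>n. integral\<^sup>L lborel (D n)) \<longlonglongrightarrow> integral\<^sup>L lborel F'"
  proof (rule integral_dominated_convergence[where w = "\<lambda>x. indicator (cball 0 (\<rho> + 1)) x *\<^sub>R B"])
    show "F' \<in> borel_measurable lborel" using meas by simp
    show "D n \<in> borel_measurable lborel" for n
      unfolding D_def using meas(1) by simp measurable
    show "integrable lborel (\<lambda>x. indicator (cball (0::real^'n) (\<rho> + 1)) x *\<^sub>R B)"
      by (intro borel_integrable_compact compact_cball continuous_intros)
    show "AE x in lborel. (\<lambda>n. D n x) \<longlonglongrightarrow> F' x"
    proof (rule AE_I2)
      fix x
      have "((\<lambda>t. (F (x + t *\<^sub>R e) - F x) / t) \<longlongrightarrow> F' x) (at 0)"
        using pd[of x] unfolding haspd_def e_def[symmetric] DERIV_def by simp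
      moreover have "filterlim h (at 0) sequentially"
        using h0 h by (auto simp: filterlim_at less_imp_neq[OF h(1), symmetric] intro!: always_eventually)
      ultimately show "(\<lambda>n. D n x) \<longlonglongrightarrow> F' x"
        unfolding D_def by (rule filterlim_compose)
    qed
    show "AE x in lborel. norm (D n x) \<le> indicator (cball 0 (\<rho> + 1)) x *\<^sub>R B" for n
    proof (rule AE_I2)
      fix x
      show "norm (D n x) \<le> indicator (cball 0 (\<rho> + 1)) x *\<^sub>R B"
      proof (cases "norm x \<le> \<rho> + 1")
        case True
        have "DERIV (\<lambda>t. F (x + t *\<^sub>R e)) t :> F' (x + t *\<^sub>R e)" for t
          unfolding e_def by (rule haspd_along[OF pd])
        then obtain t where "F (x + h n *\<^sub>R e) - F (x + 0 *\<^sub>R e) = (h n - 0) * F' (x + t *\<^sub>R e)"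
          using MVT2[OF h(1)[of n], of "\<lambda>t. F (x + t *\<^sub>R e)" "\<lambda>t. F' (x + t *\<^sub>R e)"] by blast
        then have "D n x = F' (x + t *\<^sub>R e)" using h(1)[of n] by (simp add: D_def)
        then show ?thesis using B(2) True by simp
      next
        case False
        have "norm x - norm (h n *\<^sub>R e) \<le> norm (x + h n *\<^sub>R e)" by (rule norm_diff_ineq)
        moreover have "norm (h n *\<^sub>R e) \<le> 1" using h[of n] by (simp add: e_def norm_axis_1)
        ultimately have "\<rho> \<le> norm (x + h n *\<^sub>R e)" using False by linarith
        then show ?thesis using F False by (simp add: D_def csupp_def)
      qed
    qed
  qed
  moreover have "integral\<^sup>L lborel (D n) = 0" for n
  proof -
    have i: "integrable lborel F" by (rule csupp_integrable[OF F])
    have "integrable (distr lborel borel ((+) (h n *\<^sub>R e))) F" using i by (simp add: lborel_distr_plus)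
    then have i2: "integrable lborel (\<lambda>x. F (h n *\<^sub>R e + x))" using meas by (subst (asm) integrable_distr_eq) auto
    have "(\<integral>x. F (h n *\<^sub>R e + x) - F x \<partial>lborel) = 0"
      using i i2 integral_translate[OF meas(1), of "h n *\<^sub>R e"] by simp
    then show ?thesis unfolding D_def by (simp add: add.commute)
  qed
  ultimately show ?thesis by (simp add: LIMSEQ_const_iff)
qed

section \<open>The weight and its derivatives\<close>

definition wt :: "real \<Rightarrow> real^'n::finite \<Rightarrow> real" where
  "wt \<rho> x = max 0 (\<rho>\<^sup>2 - (norm x)\<^sup>2)"

abbreviation wL2 :: "real \<Rightarrow> nat \<Rightarrow> (real^'n::finite \<Rightarrow> real) \<Rightarrow> real" where
  "wL2 \<rho> p f \<equiv> L2 (\<lambda>x. wt \<rho> x ^ p * f x)"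

lemma wt_nonneg: "0 \<le> wt \<rho> x" by (simp add: wt_def)

lemma wt_le_1: "0 < \<rho> \<Longrightarrow> \<rho> \<le> 1 \<Longrightarrow> wt \<rho> x \<le> 1"
  using power_le_one[of \<rho> 2] by (simp add: wt_def) (smt (verit) zero_le_power2)

lemma wt_zero: "0 < \<rho> \<Longrightarrow> \<rho> \<le> norm x \<Longrightarrow> wt \<rho> x = 0"
  by (simp add: wt_def power_mono)

lemma csupp_wt:
  assumes "0 < \<rho>" "\<rho> < R" "continuous_on (ball 0 R) w" "1 \<le> p"
  shows "csupp \<rho> (\<lambda>x. wt \<rho> x ^ p * w x)"
proof (rule csupp_mult_local[OF _ assms(3,2)])
  show "csupp \<rho> (\<lambda>x. wt \<rho> x ^ p)"
    unfolding csupp_def using assms wt_zero[of \<rho>]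
    by (auto simp: wt_def[abs_def] intro!: continuous_intros)
qed

text \<open>From the second power on the positive part is differentiable also at 0, where its
  difference quotient is again a positive power of the positive part. Hence the exponents
  \<open>Suc (Suc k)\<close> wherever the weight is differentiated.\<close>

lemma DERIV_positive_part_power:
  "DERIV (\<lambda>t. max 0 t ^ Suc (Suc k)) t :> real (Suc (Suc k)) * max 0 t ^ Suc k"
proof (cases "t = 0")
  case True
  have "((\<lambda>h. max 0 h ^ Suc k) \<longlongrightarrow> max 0 0 ^ Suc k) (at (0::real))"
    by (intro tendsto_intros)
  then have "((\<lambda>h. max 0 h ^ Suc k) \<longlongrightarrow> 0) (at (0::real))" by simp
  then have "((\<lambda>h. max 0 h ^ Suc (Suc k) / h) \<longlongrightarrow> 0) (at (0::real))"
    by (rule Lim_transform_eventually) (auto simp: eventually_at_filter max_def intro!: always_eventually)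
  then show ?thesis using True by (simp add: DERIV_def)
next
  case False
  show ?thesis
  proof (cases "t > 0")
    case True
    have "((\<lambda>t. t ^ Suc (Suc k)) has_field_derivative real (Suc (Suc k)) * max 0 t ^ Suc k) (at t)"
      using True DERIV_pow[of "Suc (Suc k)" t] by (simp add: max_def)
    then show ?thesis
      by (rule has_field_derivative_transform_within_open[where S = "{0<..}"]) (use True in \<open>auto simp: max_def\<close>)
  next
    case neg: False
    have "((\<lambda>t. 0) has_field_derivative real (Suc (Suc k)) * max 0 t ^ Suc k) (at t)"
      using neg False by (auto simp: max_def)
    then show ?thesis
      by (rule has_field_derivative_transform_within_open[where S = "{..<0}"]) (use neg False in \<open>auto simp: max_def\<close>)
  qed
qed

lemma haspd_wt_power:
  "haspd i (\<lambda>x. wt \<rho> x ^ Suc (Suc k)) (real (Suc (Suc k)) * wt \<rho> x ^ Suc k * (- 2 * x $ i)) x"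
proof -
  have "((\<lambda>t. \<rho>\<^sup>2 - (x + t *\<^sub>R axis i 1) \<bullet> (x + t *\<^sub>R axis i 1)) has_real_derivative (- 2 * x $ i)) (at 0)"
    unfolding inner_add_left inner_add_right
    by (auto intro!: derivative_eq_intros simp: inner_axis inner_axis' )
  from DERIV_chain2[OF DERIV_positive_part_power this] show ?thesis
    unfolding haspd_def wt_def power2_norm_eq_inner by simp
qed

text \<open>Outside \<open>ball 0 R\<close> nothing is known of \<open>G\<close>, but there the
  product vanishes on a neighbourhood, so it is differentiable everywhere.\<close>

lemma integral_weighted_pd:
  assumes \<rho>: "0 < \<rho>" "\<rho> < R" and G: "smooth (ball 0 R) G"
  shows "(\<integral>x. real (Suc (Suc k)) * wt \<rho> x ^ Suc k * (- 2 * x $ i) * G x + wt \<rho> x ^ Suc (Suc k) * pd i G x \<partial>lborel) = 0"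
proof (rule integral_pd_zero)
  have o: "open {x::real^'n. \<rho> < norm x}" by (intro open_Collect_less continuous_intros)
  have c: "continuous_on (ball 0 R) G" "continuous_on (ball 0 R) (pd i G)"
    using G smooth_continuous smooth_pd by blast+
  show "csupp \<rho> (\<lambda>x. wt \<rho> x ^ Suc (Suc k) * G x)" by (rule csupp_wt[OF \<rho> c(1)]) simp
  have "csupp \<rho> (\<lambda>x. real (Suc (Suc k)) * (wt \<rho> x ^ Suc k * ((- 2 * x $ i) * G x)) + wt \<rho> x ^ Suc (Suc k) * pd i G x)"
    by (intro csupp_add csupp_cmult csupp_wt[OF \<rho>] continuous_intros c) auto
  then show "csupp \<rho> (\<lambda>x. real (Suc (Suc k)) * wt \<rho> x ^ Suc k * (- 2 * x $ i) * G x + wt \<rho> x ^ Suc (Suc k) * pd i G x)"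
    by (simp only: mult.assoc)
  fix x
  show "haspd i (\<lambda>x. wt \<rho> x ^ Suc (Suc k) * G x)
    (real (Suc (Suc k)) * wt \<rho> x ^ Suc k * (- 2 * x $ i) * G x + wt \<rho> x ^ Suc (Suc k) * pd i G x) x"
  proof (cases "norm x < R")
    case True
    then have "haspd i G (pd i G x) x" using smooth_haspd[OF G, of x] by simp
    then show ?thesis by (intro haspd_mult haspd_wt_power)
  next
    case False
    then have x: "\<rho> < norm x" using \<rho> by simp
    then have "wt \<rho> x = 0" using \<rho> wt_zero[of \<rho> x] by simp
    moreover have "haspd i (\<lambda>x. wt \<rho> x ^ Suc (Suc k) * G x) 0 x"
    proof (rule iffD1[OF haspd_cong[OF o] haspd_const])
      show "x \<in> {x. \<rho> < norm x}" using x by simp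
      show "0 = wt \<rho> y ^ Suc (Suc k) * G y" if "y \<in> {x. \<rho> < norm x}" for y
        using that wt_zero[of \<rho> y] \<rho> by simp
    qed
    ultimately show ?thesis by simp
  qed
qed

subsection \<open>The elliptic estimate\<close>

lemma smooth_pd2: "smooth U w \<Longrightarrow> smooth U (pd i (pd j w))"
  by (intro smooth_pd)

lemma smooth_pd_commute: "open U \<Longrightarrow> smooth U w \<Longrightarrow> x \<in> U \<Longrightarrow> pd i (pd j w) x = pd j (pd i w) x"
  by (rule pd_commute) (auto simp: smooth_def)

text \<open>The dichotomy behind pointwise claims on weighted functions: either the weight
  annihilates everything or the point lies where smoothness is known.\<close>

lemma weight_zero_or_ball: "0 < \<rho> \<Longrightarrow> \<rho> < R \<Longrightarrow> wt \<rho> x = 0 \<or> x \<in> ball 0 R"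
  using wt_zero[of \<rho> x] by fastforce

text \<open>Differentiation costs the weight one of its 2p powers. The others are divided as p - 1
  for \<open>f\<close> and p for \<open>h\<close>, the powers that belong to derivatives of
  consecutive orders.\<close>

lemma weighted_integration_by_parts:
  fixes a f h :: "real^'n::finite \<Rightarrow> real"
  assumes \<rho>: "0 < \<rho>" "\<rho> < R" "R \<le> 1"
    and a: "smooth (ball 0 R) a" and f: "smooth (ball 0 R) f" and h: "smooth (ball 0 R) h"
    and B: "0 \<le> B" "\<And>x. x \<in> ball 0 R \<Longrightarrow> \<bar>a x\<bar> \<le> B" "\<And>x i. x \<in> ball 0 R \<Longrightarrow> \<bar>pd i a x\<bar> \<le> B"
    and p: "2 \<le> p"
  shows "\<bar>\<integral>x. wt \<rho> x ^ (2 * p) * (a x * (pd k f x * h x + f x * pd k h x)) \<partial>lborel\<bar>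
    \<le> 5 * real p * B * (wL2 \<rho> (p - 1) f * wL2 \<rho> p h)"
proof -
  let ?U = "ball (0::real^'n) R"
  note in_wt = weight_zero_or_ball[OF \<rho>(1,2)]
  note c = smooth_continuous[OF a] smooth_continuous[OF f] smooth_continuous[OF h]
    smooth_continuous[OF smooth_pd[OF a]] smooth_continuous[OF smooth_pd[OF f]] smooth_continuous[OF smooth_pd[OF h]]
  define G where "G x = a x * (f x * h x)" for x
  have G: "smooth ?U G" unfolding G_def by (intro smooth_mult open_ball a f h)
  obtain q where q: "2 * p = Suc (Suc q)" using p by (metis Suc_1 le_Suc_ex mult_2 add_Suc_right add_Suc)
  define M where "M x = wt \<rho> x ^ (2 * p) * (a x * (pd k f x * h x + f x * pd k h x))" for x
  \<comment> \<open>The terms in which the derivative hits the weight or the coefficient; no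
    derivative of \<open>f\<close> or \<open>h\<close> occurs.\<close>
  define E where "E x = wt \<rho> x ^ (2 * p - 1) * (f x * h x * (real (2 * p) * (- 2 * x $ k) * a x + wt \<rho> x * pd k a x))" for x
  have "continuous_on ?U (wt \<rho>)" unfolding wt_def[abs_def] by (intro continuous_intros)
  then have cs: "csupp \<rho> M" "csupp \<rho> E" unfolding M_def E_def
    using p by (intro csupp_wt[OF \<rho>(1,2)] continuous_intros c; simp)+
  have "(\<integral>x. E x + M x \<partial>lborel)
    = (\<integral>x. real (Suc (Suc q)) * wt \<rho> x ^ Suc q * (- 2 * x $ k) * G x + wt \<rho> x ^ Suc (Suc q) * pd k G x \<partial>lborel)"
  proof (rule Bochner_Integration.integral_cong[OF refl])
    fix x :: "real^'n"
    show "E x + M x = real (Suc (Suc q)) * wt \<rho> x ^ Suc q * (- 2 * x $ k) * G x + wt \<rho> x ^ Suc (Suc q) * pd k G x"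
      using in_wt[of x]
    proof
      assume "wt \<rho> x = 0" then show ?thesis by (simp add: E_def M_def q)
    next
      assume x: "x \<in> ?U"
      then have "pd k G x = pd k a x * (f x * h x) + a x * (pd k f x * h x + f x * pd k h x)"
        unfolding G_def by (intro haspd_pd haspd_mult smooth_haspd[of ?U] a f h)
      then show ?thesis unfolding E_def M_def q by (simp add: G_def algebra_simps)
    qed
  qed
  also have "\<dots> = 0" by (rule integral_weighted_pd[OF \<rho>(1,2) G])
  finally have "\<bar>\<integral>x. M x \<partial>lborel\<bar> = \<bar>\<integral>x. E x \<partial>lborel\<bar>"
    using csupp_integrable[OF cs(1)] csupp_integrable[OF cs(2)] by simp
  also have "\<dots> \<le> 5 * real p * B * (wL2 \<rho> (p - 1) f * wL2 \<rho> p h)"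
  proof (rule integral_bilinear_bound[OF cs(2)])
    show "csupp \<rho> (\<lambda>x. wt \<rho> x ^ (p - 1) * f x)" "csupp \<rho> (\<lambda>x. wt \<rho> x ^ p * h x)"
      using p by (intro csupp_wt[OF \<rho>(1,2)] c; simp)+
    show "0 \<le> 5 * real p * B" using B by simp
    fix x :: "real^'n"
    show "\<bar>E x\<bar> \<le> 5 * real p * B * (\<bar>wt \<rho> x ^ (p - 1) * f x\<bar> * \<bar>wt \<rho> x ^ p * h x\<bar>)"
      using in_wt[of x]
    proof
      assume "wt \<rho> x = 0" then show ?thesis using p B(1) by (simp add: E_def power_0_left)
    next
      assume x: "x \<in> ?U"
      have w0: "0 \<le> wt \<rho> x" "wt \<rho> x \<le> 1" using wt_nonneg wt_le_1[of \<rho> x] \<rho> by auto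
      have xk: "\<bar>x $ k\<bar> \<le> 1" using component_le_norm_cart[of x k] x \<rho> by simp
      have "\<bar>real (2 * p) * (- 2 * x $ k) * a x + wt \<rho> x * pd k a x\<bar>
         \<le> real (2 * p) * (2 * \<bar>x $ k\<bar>) * \<bar>a x\<bar> + wt \<rho> x * \<bar>pd k a x\<bar>"
        using w0 by (intro order_trans[OF abs_triangle_ineq]) (simp add: abs_mult)
      also have "\<dots> \<le> real (2 * p) * (2 * 1) * B + 1 * B"
        using B x xk w0 by (intro add_mono mult_mono) auto
      \<comment> \<open>The weight contributes 4 p B and the coefficient B, at most p B: hence the
        5.\<close>
      also have "\<dots> \<le> 5 * real p * B"
        using mult_right_mono[of 1 "real p" B] B(1) p by (simp add: algebra_simps)
      finally have "\<bar>E x\<bar> \<le> wt \<rho> x ^ (2 * p - 1) * (\<bar>f x * h x\<bar> * (5 * real p * B))"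
        unfolding E_def abs_mult[of "wt \<rho> x ^ (2 * p - 1)"] abs_mult[of "f x * h x"]
        using w0 by (intro mult_mono) auto
      also have "2 * p - 1 = (p - 1) + p" using p by simp
      finally show ?thesis using w0 by (simp add: abs_mult power_add mult_ac)
    qed
  qed
  finally show ?thesis unfolding M_def .
qed

text \<open>The third-order terms of the two divergences
  \<open>\<partial>\<^sub>k (\<phi>\<^bsup>2p\<^esup> a w\<^sub>j w\<^sub>i\<^sub>k) - \<partial>\<^sub>i (\<phi>\<^bsup>2p\<^esup> a w\<^sub>j w\<^sub>k\<^sub>k)\<close> cancel.\<close>

lemma energy_exchange:
  fixes w a :: "real^'n::finite \<Rightarrow> real"
  assumes \<rho>: "0 < \<rho>" "\<rho> < R" "R \<le> 1"
    and w: "smooth (ball 0 R) w" and a: "smooth (ball 0 R) a"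
    and B: "0 \<le> B" "\<And>x. x \<in> ball 0 R \<Longrightarrow> \<bar>a x\<bar> \<le> B" "\<And>x i. x \<in> ball 0 R \<Longrightarrow> \<bar>pd i a x\<bar> \<le> B"
    and p: "2 \<le> p"
  shows "\<bar>(\<integral>x. wt \<rho> x ^ (2 * p) * (a x * pd j (pd k w) x * pd i (pd k w) x) \<partial>lborel)
      - (\<integral>x. wt \<rho> x ^ (2 * p) * (a x * pd i (pd j w) x * pd k (pd k w) x) \<partial>lborel)\<bar>
    \<le> 5 * real p * B * wL2 \<rho> (p - 1) (pd j w)
        * (wL2 \<rho> p (pd i (pd k w)) + wL2 \<rho> p (pd k (pd k w)))"
proof -
  note sw = smooth_pd[OF w] smooth_pd2[OF w]
  note ibp = weighted_integration_by_parts[OF \<rho> a sw(1) sw(2) B p]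
  let ?T = "\<lambda>x. wt \<rho> x ^ (2 * p) * (a x * (pd j w x * pd k (pd i (pd k w)) x))"
  let ?M1 = "\<lambda>x. wt \<rho> x ^ (2 * p) * (a x * pd j (pd k w) x * pd i (pd k w) x)"
  let ?M2 = "\<lambda>x. wt \<rho> x ^ (2 * p) * (a x * pd i (pd j w) x * pd k (pd k w) x)"
  have int: "integrable lborel ?T" "integrable lborel ?M1" "integrable lborel ?M2"
    using p by (intro csupp_integrable[of \<rho>] csupp_wt[OF \<rho>(1,2)] continuous_intros
        smooth_continuous[of "ball 0 R"] smooth_pd w a; simp)+
  have "(\<integral>x. wt \<rho> x ^ (2 * p) * (a x * (pd k (pd j w) x * pd i (pd k w) x + pd j w x * pd k (pd i (pd k w)) x)) \<partial>lborel)
    = (\<integral>x. ?M1 x + ?T x \<partial>lborel)"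
  proof (rule Bochner_Integration.integral_cong[OF refl])
    fix x :: "real^'n"
    show "wt \<rho> x ^ (2 * p) * (a x * (pd k (pd j w) x * pd i (pd k w) x + pd j w x * pd k (pd i (pd k w)) x)) = ?M1 x + ?T x"
      using weight_zero_or_ball[OF \<rho>(1,2), of x] smooth_pd_commute[OF open_ball w, of x k j] p
      by (auto simp: power_0_left algebra_simps)
  qed
  moreover have "(\<integral>x. wt \<rho> x ^ (2 * p) * (a x * (pd i (pd j w) x * pd k (pd k w) x + pd j w x * pd i (pd k (pd k w)) x)) \<partial>lborel)
    = (\<integral>x. ?M2 x + ?T x \<partial>lborel)"
  proof (rule Bochner_Integration.integral_cong[OF refl])
    fix x :: "real^'n"
    show "wt \<rho> x ^ (2 * p) * (a x * (pd i (pd j w) x * pd k (pd k w) x + pd j w x * pd i (pd k (pd k w)) x)) = ?M2 x + ?T x"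
      using weight_zero_or_ball[OF \<rho>(1,2), of x] smooth_pd_commute[OF open_ball sw(1), of x i k] p
      by (auto simp: power_0_left algebra_simps)
  qed
  ultimately show ?thesis
    using ibp[of k j i k] ibp[of i j k k] int by (simp add: algebra_simps)
qed

text \<open>For fixed k, ellipticity is applied to the vector of the weighted
  \<open>pd i (pd k w)\<close>; \<open>energy_exchange\<close> then converts the form into the
  principal part times \<open>pd k (pd k w)\<close>. The result is quadratic in the Hessian norm on
  the left and linear on the right.\<close>

lemma elliptic_estimate:
  fixes w :: "real^'n::finite \<Rightarrow> real"
  assumes \<rho>: "0 < \<rho>" "\<rho> < R" "R \<le> 1"
    and w: "smooth (ball 0 R) w" and a: "\<And>i j. smooth (ball 0 R) (a i j)"
    and B: "0 \<le> B" "\<And>x i j. x \<in> ball 0 R \<Longrightarrow> \<bar>a i j x\<bar> \<le> B" "\<And>x i j k. x \<in> ball 0 R \<Longrightarrow> \<bar>pd k (a i j) x\<bar> \<le> B"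
    and l: "0 < l" "\<And>x \<xi>. x \<in> ball 0 R \<Longrightarrow> l * (\<Sum>i\<in>UNIV. (\<xi> i)\<^sup>2) \<le> (\<Sum>i\<in>UNIV. \<Sum>j\<in>UNIV. a i j x * \<xi> i * \<xi> j)"
    and p: "2 \<le> p"
    and X: "wL2 \<rho> p (principal a w) \<le> X"
    and Y: "\<And>j. wL2 \<rho> (p - 1) (pd j w) \<le> Y"
  shows "wL2 \<rho> p (pd i0 (pd k0 w)) \<le> (real CARD('n) + 10 * real CARD('n) ^ 3 * B) / l * (X + real p * Y)"
proof -
  let ?U = "ball (0::real^'n) R"
  let ?m = "real CARD('n)"
  note sw = smooth_pd[OF w] smooth_pd2[OF w]
  note c = smooth_continuous[OF sw(1)] smooth_continuous[OF sw(2)] smooth_continuous[OF a]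
  define v where "v i k x = wt \<rho> x ^ p * pd i (pd k w) x" for i k x
  \<comment> \<open>One norm for the whole Hessian: it bounds every second derivative on the right,
    so one factor cancels against the left.\<close>
  define N where "N = sqrt (\<Sum>k\<in>UNIV. \<Sum>i\<in>UNIV. (L2 (v i k))\<^sup>2)"
  have N2: "N\<^sup>2 = (\<Sum>k\<in>UNIV. \<Sum>i\<in>UNIV. (L2 (v i k))\<^sup>2)" by (simp add: N_def sum_nonneg)
  have N0: "0 \<le> N" by (simp add: N_def sum_nonneg)
  have vN: "L2 (v i k) \<le> N" for i k
  proof (rule power2_le_imp_le[OF _ N0])
    have "(L2 (v i k))\<^sup>2 \<le> (\<Sum>i\<in>UNIV. (L2 (v i k))\<^sup>2)"
      by (rule member_le_sum) auto
    also have "\<dots> \<le> (\<Sum>k\<in>UNIV. \<Sum>i\<in>UNIV. (L2 (v i k))\<^sup>2)"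
      by (rule member_le_sum[where f = "\<lambda>k. \<Sum>i\<in>UNIV. (L2 (v i k))\<^sup>2"]) (auto intro: sum_nonneg)
    finally show "(L2 (v i k))\<^sup>2 \<le> N\<^sup>2" by (simp add: N2)
  qed
  have X0: "0 \<le> X" using X L2_nonneg order_trans by blast
  have Y0: "0 \<le> Y" using Y L2_nonneg order_trans by blast
  have csv: "csupp \<rho> (v i k)" for i k
    unfolding v_def using p by (intro csupp_wt[OF \<rho>(1,2)] c) simp
  note in_wt = weight_zero_or_ball[OF \<rho>(1,2)]
  define I where "I i j k = (\<integral>x. wt \<rho> x ^ (2 * p) * (a i j x * pd j (pd k w) x * pd i (pd k w) x) \<partial>lborel)" for i j k
  define J where "J i j k = (\<integral>x. wt \<rho> x ^ (2 * p) * (a i j x * pd i (pd j w) x * pd k (pd k w) x) \<partial>lborel)" for i j k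
  have csI: "csupp \<rho> (\<lambda>x. wt \<rho> x ^ (2 * p) * (a i j x * pd j (pd k w) x * pd i (pd k w) x))" for i j k
    using p by (intro csupp_wt[OF \<rho>(1,2)] continuous_intros c) simp
  have csJ: "csupp \<rho> (\<lambda>x. wt \<rho> x ^ (2 * p) * (a i j x * pd i (pd j w) x * pd k (pd k w) x))" for i j k
    using p by (intro csupp_wt[OF \<rho>(1,2)] continuous_intros c) simp
  have IJ: "I i j k \<le> J i j k + 10 * real p * B * Y * N" for i j k
  proof -
    have "\<bar>I i j k - J i j k\<bar> \<le> 5 * real p * B * wL2 \<rho> (p - 1) (pd j w) * (L2 (v i k) + L2 (v k k))"
      unfolding I_def J_def v_def by (rule energy_exchange[OF \<rho> w a B(1) B(2) B(3) p])
    also have "\<dots> \<le> 5 * real p * B * Y * (N + N)"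
      using Y vN B(1) Y0 by (intro mult_mono add_mono) (auto simp: L2_nonneg)
    finally show ?thesis by simp
  qed
  have "l * (\<Sum>i\<in>UNIV. (L2 (v i k))\<^sup>2) \<le> (\<Sum>i\<in>UNIV. \<Sum>j\<in>UNIV. I i j k)" for k
  proof -
    have "l * (\<Sum>i\<in>UNIV. (L2 (v i k))\<^sup>2) = (\<integral>x. l * (\<Sum>i\<in>UNIV. (v i k x)\<^sup>2) \<partial>lborel)"
      unfolding L2_square using csupp_integrable[OF csupp_power2[OF csv]] by simp
    also have "\<dots> \<le> (\<integral>x. (\<Sum>i\<in>UNIV. \<Sum>j\<in>UNIV. wt \<rho> x ^ (2 * p) * (a i j x * pd j (pd k w) x * pd i (pd k w) x)) \<partial>lborel)"
    proof (rule integral_mono)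
      show "integrable lborel (\<lambda>x. l * (\<Sum>i\<in>UNIV. (v i k x)\<^sup>2))"
        by (intro csupp_integrable[of \<rho>] csupp_cmult csupp_sum csupp_power2 csv)
      show "integrable lborel (\<lambda>x. \<Sum>i\<in>UNIV. \<Sum>j\<in>UNIV. wt \<rho> x ^ (2 * p) * (a i j x * pd j (pd k w) x * pd i (pd k w) x))"
        by (intro csupp_integrable[of \<rho>] csupp_sum csI)
      fix x :: "real^'n"
      show "l * (\<Sum>i\<in>UNIV. (v i k x)\<^sup>2) \<le> (\<Sum>i\<in>UNIV. \<Sum>j\<in>UNIV. wt \<rho> x ^ (2 * p) * (a i j x * pd j (pd k w) x * pd i (pd k w) x))"
        using in_wt[of x]
      proof
        assume "wt \<rho> x = 0" then show ?thesis using p by (simp add: v_def power_0_left)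
      next
        assume "x \<in> ?U"
        from l(2)[OF this, of "\<lambda>i. v i k x"]
        have "l * (\<Sum>i\<in>UNIV. (v i k x)\<^sup>2) \<le> (\<Sum>i\<in>UNIV. \<Sum>j\<in>UNIV. a i j x * v i k x * v j k x)" .
        also have "\<dots> = (\<Sum>i\<in>UNIV. \<Sum>j\<in>UNIV. wt \<rho> x ^ (2 * p) * (a i j x * pd j (pd k w) x * pd i (pd k w) x))"
          unfolding v_def mult_2 power_add by (simp add: mult_ac)
        finally show ?thesis .
      qed
    qed
    also have "\<dots> = (\<Sum>i\<in>UNIV. \<Sum>j\<in>UNIV. I i j k)"
      unfolding I_def using csupp_integrable[OF csI] by simp
    finally show ?thesis .
  qed
  then have "l * N\<^sup>2 \<le> (\<Sum>k\<in>UNIV. \<Sum>i\<in>UNIV. \<Sum>j\<in>UNIV. I i j k)"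
    unfolding N2 by (simp add: sum_distrib_left sum_mono)
  also have "\<dots> \<le> (\<Sum>k\<in>(UNIV::'n set). \<Sum>i\<in>(UNIV::'n set). \<Sum>j\<in>(UNIV::'n set). J i j k + 10 * real p * B * Y * N)"
    by (intro sum_mono IJ)
  also have "\<dots> = (\<Sum>k\<in>UNIV. \<Sum>i\<in>UNIV. \<Sum>j\<in>UNIV. J i j k) + ?m ^ 3 * (10 * real p * B * Y * N)"
    by (simp add: sum.distrib power3_eq_cube)
  also have "(\<Sum>k\<in>UNIV. \<Sum>i\<in>UNIV. \<Sum>j\<in>UNIV. J i j k) \<le> (\<Sum>k\<in>(UNIV::'n set). X * N)"
  proof (rule sum_mono)
    fix k
    have "(\<Sum>i\<in>UNIV. \<Sum>j\<in>UNIV. J i j k) = (\<integral>x. (\<Sum>i\<in>UNIV. \<Sum>j\<in>UNIV. wt \<rho> x ^ (2 * p) * (a i j x * pd i (pd j w) x * pd k (pd k w) x)) \<partial>lborel)"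
      unfolding J_def using csupp_integrable[OF csJ] by simp
    also have "\<dots> = (\<integral>x. (wt \<rho> x ^ p * principal a w x) * v k k x \<partial>lborel)"
      unfolding v_def mult_2 power_add by (simp add: sum_distrib_left sum_distrib_right mult_ac)
    also have "\<dots> \<le> wL2 \<rho> p (principal a w) * L2 (v k k)"
    proof -
      have "csupp \<rho> (\<lambda>x. wt \<rho> x ^ p * principal a w x)"
        using p by (intro csupp_wt[OF \<rho>(1,2)] continuous_intros c) simp
      from order_trans[OF abs_ge_self L2_cauchy_schwarz[OF this csv[of k k]]] show ?thesis .
    qed
    also have "\<dots> \<le> X * N" using X vN X0 by (intro mult_mono) (auto simp: L2_nonneg)
    finally show "(\<Sum>i\<in>UNIV. \<Sum>j\<in>UNIV. J i j k) \<le> X * N" .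
  qed
  finally have main: "l * N\<^sup>2 \<le> (?m * X + 10 * ?m ^ 3 * B * (real p * Y)) * N"
    by (simp add: algebra_simps)
  have "l * N \<le> ?m * X + 10 * ?m ^ 3 * B * (real p * Y)"
  proof (cases "N = 0")
    case True
    then show ?thesis using X0 Y0 B(1) by simp
  next
    case False
    then show ?thesis using main N0 by (simp add: power2_eq_square flip: mult.assoc)
  qed
  also have "\<dots> \<le> (?m + 10 * ?m ^ 3 * B) * (X + real p * Y)"
    using X0 Y0 B(1) by (simp add: algebra_simps)
  finally have "N \<le> (?m + 10 * ?m ^ 3 * B) / l * (X + real p * Y)"
    using l(1) by (simp add: field_simps)
  then show ?thesis using vN[of i0 k0] unfolding v_def by (rule order_trans[rotated])
qed

text \<open>Integrate by parts in the square of \<open>pd i v\<close>. The four powers of the weight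
  split as 2 + 2 and as 1 + 3, always one more than the order of the derivative.\<close>

lemma gradient_interpolation:
  fixes v :: "real^'n::finite \<Rightarrow> real"
  assumes \<rho>: "0 < \<rho>" "\<rho> < R" "R \<le> 1" and v: "smooth (ball 0 R) v"
  shows "(wL2 \<rho> 2 (pd i v))\<^sup>2 \<le> wL2 \<rho> 1 v *
      (wL2 \<rho> 3 (pd i (pd i v)) + 10 * wL2 \<rho> 2 (pd i v))"
proof -
  note c = smooth_continuous[OF v] smooth_continuous[OF smooth_pd[OF v]] smooth_continuous[OF smooth_pd2[OF v]]
  define F1 where "F1 x = (wt \<rho> x ^ 2 * pd i v x)\<^sup>2" for x
  define F2 where "F2 x = (wt \<rho> x ^ 1 * v x) * (wt \<rho> x ^ 3 * pd i (pd i v) x)" for x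
  have cs: "csupp \<rho> (\<lambda>x. wt \<rho> x ^ 1 * v x)" "csupp \<rho> (\<lambda>x. wt \<rho> x ^ 2 * pd i v x)"
    "csupp \<rho> (\<lambda>x. wt \<rho> x ^ 3 * pd i (pd i v) x)"
    by (intro csupp_wt[OF \<rho>(1,2)] c; simp)+
  have int: "integrable lborel F1" "integrable lborel F2"
    unfolding F1_def F2_def
    by (rule csupp_integrable[OF csupp_power2[OF cs(2)]] csupp_integrable[OF csupp_mult[OF cs(1,3)]])+
  have "wt \<rho> x ^ (2 * 2) * (1 * (pd i v x * pd i v x + v x * pd i (pd i v) x)) = F1 x + F2 x" for x
    by (simp add: F1_def F2_def algebra_simps power2_eq_square power3_eq_cube eval_nat_numeral)
  \<comment> \<open>The coefficient is the constant 1, bounded by \<open>B = 1\<close>; with p = 2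
    the factor 5 p becomes 10.\<close>
  then have "\<bar>\<integral>x. F1 x + F2 x \<partial>lborel\<bar>
      \<le> 5 * real 2 * 1 * (wL2 \<rho> (2 - 1) v * wL2 \<rho> 2 (pd i v))"
    using weighted_integration_by_parts[OF \<rho> smooth_const[of _ 1] v smooth_pd[OF v, of i], of 1 2 i]
    by (simp add: pd_const)
  moreover have "\<bar>\<integral>x. F2 x \<partial>lborel\<bar> \<le> wL2 \<rho> 1 v * wL2 \<rho> 3 (pd i (pd i v))"
    unfolding F2_def by (rule L2_cauchy_schwarz[OF cs(1,3)])
  ultimately show ?thesis
    unfolding L2_square F1_def[symmetric] using int by (simp add: algebra_simps)
qed

subsection \<open>Commutators with iterated derivatives\<close>

text \<open>The data on which the constants \<open>C\<close>, \<open>E\<close> and \<open>T\<close>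
  may depend; no function to be estimated is among them.\<close>

locale elliptic_operator =
  fixes \<rho> R A S l :: real
    and a :: "'n::finite \<Rightarrow> 'n \<Rightarrow> real^'n \<Rightarrow> real" and b :: "'n \<Rightarrow> real^'n \<Rightarrow> real"
  assumes \<rho>: "0 < \<rho>" "\<rho> < R" "R \<le> 1"
    and AS: "0 \<le> A" "0 \<le> S" and l: "0 < l"
    and sa: "\<And>i j. smooth (ball 0 R) (a i j)" and fa: "\<And>i j. fact_bound (ball 0 R) (a i j) A S"
    and sb: "\<And>j. smooth (ball 0 R) (b j)" and fb: "\<And>j. fact_bound (ball 0 R) (b j) A S"
    and ell: "\<And>x \<xi>. x \<in> ball 0 R \<Longrightarrow> l * (\<Sum>i\<in>UNIV. (\<xi> i)\<^sup>2) \<le> (\<Sum>i\<in>UNIV. \<Sum>j\<in>UNIV. a i j x * \<xi> i * \<xi> j)"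
begin

definition op :: "(real^'n \<Rightarrow> real) \<Rightarrow> real^'n \<Rightarrow> real" where
  "op v x = principal a v x + (\<Sum>j\<in>UNIV. b j x * pd j v x)"

lemmas in_wt = weight_zero_or_ball[OF \<rho>(1,2)]

lemma smooth_op: "smooth (ball 0 R) v \<Longrightarrow> smooth (ball 0 R) (op v)"
  unfolding op_def[abs_def] by (intro smooth_add smooth_sum smooth_mult open_ball sa sb smooth_pd)

text \<open>The weight is at most 1, so lowering its exponent increases the norm; a positive
  exponent keeps the cutoff.\<close>

lemma L2_weight_coefficient:
  assumes "continuous_on (ball 0 R) q" "continuous_on (ball 0 R) f" "1 \<le> s" "s \<le> p" "0 \<le> c"
    "\<And>x. x \<in> ball 0 R \<Longrightarrow> \<bar>q x\<bar> \<le> c"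
  shows "L2 (\<lambda>x. wt \<rho> x ^ p * (q x * f x)) \<le> c * wL2 \<rho> s f"
proof (rule L2_le[OF _ _ assms(5)])
  show "csupp \<rho> (\<lambda>x. wt \<rho> x ^ p * (q x * f x))" "csupp \<rho> (\<lambda>x. wt \<rho> x ^ s * f x)"
    using assms by (intro csupp_wt[OF \<rho>(1,2)] continuous_intros; simp)+
  fix x
  show "\<bar>wt \<rho> x ^ p * (q x * f x)\<bar> \<le> c * \<bar>wt \<rho> x ^ s * f x\<bar>"
    using in_wt[of x]
  proof
    assume "wt \<rho> x = 0" then show ?thesis using assms by (simp add: power_0_left)
  next
    assume x: "x \<in> ball 0 R"
    have w: "0 \<le> wt \<rho> x" "wt \<rho> x \<le> 1" using wt_nonneg wt_le_1[of \<rho> x] \<rho> by auto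
    have "\<bar>q x\<bar> * (wt \<rho> x ^ p * \<bar>f x\<bar>) \<le> c * (wt \<rho> x ^ s * \<bar>f x\<bar>)"
      using assms x w by (intro mult_mono power_decreasing) auto
    then show ?thesis using w by (simp add: abs_mult mult_ac)
  qed
qed

lemma L2_weight_mono:
  assumes "continuous_on (ball 0 R) f" "1 \<le> s" "s \<le> p"
  shows "wL2 \<rho> p f \<le> wL2 \<rho> s f"
  using L2_weight_coefficient[of "\<lambda>x. 1" f s p 1] assms by simp

text \<open>The list \<open>r\<close> is arbitrary so that one bound serves both all splittings, for
  \<open>b\<close>, and those without the leading term, for \<open>a\<close>.\<close>

lemma leibniz_L2:
  assumes q: "smooth (ball 0 R) q" "fact_bound (ball 0 R) q A S" and h: "smooth (ball 0 R) h"
    and H: "\<And>xs ys. (xs, ys) \<in> set r \<Longrightarrow> wL2 \<rho> p (pd_list ys h) \<le> H (length ys)"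
    and p: "1 \<le> p"
  shows "csupp \<rho> (\<lambda>x. wt \<rho> x ^ p * (\<Sum>(xs, ys)\<leftarrow>r. pd_list xs q x * pd_list ys h x))"
    "L2 (\<lambda>x. wt \<rho> x ^ p * (\<Sum>(xs, ys)\<leftarrow>r. pd_list xs q x * pd_list ys h x))
      \<le> (\<Sum>(xs, ys)\<leftarrow>r. (A * S ^ length xs * fact (length xs)) * H (length ys))"
proof -
  have c: "continuous_on (ball 0 R) (pd_list xs q)" "continuous_on (ball 0 R) (pd_list xs h)" for xs
    using q h smooth_continuous smooth_pd_list by blast+
  have eq: "wt \<rho> x ^ p * (\<Sum>(xs, ys)\<leftarrow>r. pd_list xs q x * pd_list ys h x)
     = (\<Sum>z\<leftarrow>r. wt \<rho> x ^ p * (pd_list (fst z) q x * pd_list (snd z) h x))" for x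
    by (simp add: sum_list_const_mult case_prod_unfold)
  have cs: "csupp \<rho> (\<lambda>x. wt \<rho> x ^ p * (pd_list (fst z) q x * pd_list (snd z) h x))" for z
    by (intro csupp_wt[OF \<rho>(1,2)] continuous_intros c p)
  show "csupp \<rho> (\<lambda>x. wt \<rho> x ^ p * (\<Sum>(xs, ys)\<leftarrow>r. pd_list xs q x * pd_list ys h x))"
    unfolding eq by (intro csupp_sum_list cs)
  have "L2 (\<lambda>x. wt \<rho> x ^ p * (\<Sum>(xs, ys)\<leftarrow>r. pd_list xs q x * pd_list ys h x))
     \<le> (\<Sum>z\<leftarrow>r. L2 (\<lambda>x. wt \<rho> x ^ p * (pd_list (fst z) q x * pd_list (snd z) h x)))"
    unfolding eq by (rule L2_sum_list[OF cs])
  also have "\<dots> \<le> (\<Sum>z\<leftarrow>r. (A * S ^ length (fst z) * fact (length (fst z))) * H (length (snd z)))"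
  proof (rule sum_list_mono)
    fix z assume z: "z \<in> set r"
    have "L2 (\<lambda>x. wt \<rho> x ^ p * (pd_list (fst z) q x * pd_list (snd z) h x))
      \<le> (A * S ^ length (fst z) * fact (length (fst z))) * wL2 \<rho> p (pd_list (snd z) h)"
      using q AS p by (intro L2_weight_coefficient c) (auto simp: fact_bound_def)
    also have "\<dots> \<le> (A * S ^ length (fst z) * fact (length (fst z))) * H (length (snd z))"
      using AS H[of "fst z" "snd z"] z by (intro mult_left_mono) auto
    finally show "L2 (\<lambda>x. wt \<rho> x ^ p * (pd_list (fst z) q x * pd_list (snd z) h x))
      \<le> (A * S ^ length (fst z) * fact (length (fst z))) * H (length (snd z))" .
  qed
  finally show "L2 (\<lambda>x. wt \<rho> x ^ p * (\<Sum>(xs, ys)\<leftarrow>r. pd_list xs q x * pd_list ys h x))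
      \<le> (\<Sum>(xs, ys)\<leftarrow>r. (A * S ^ length xs * fact (length xs)) * H (length ys))"
    by (simp add: case_prod_unfold)
qed

text \<open>The sum for the principal coefficients starts at k = 1, because its term k = 0 is the
  left side itself. Therefore only derivatives of order at most n + 1 occur on the right, apart from
  those of \<open>op v\<close>.\<close>

lemma principal_part_bound:
  fixes "is" :: "'n list" and M :: "nat \<Rightarrow> real"
  defines "n \<equiv> length is"
  assumes v: "smooth (ball 0 R) v"
    and M: "\<And>ys. length ys \<le> n + 1 \<Longrightarrow> wL2 \<rho> (length ys + 1) (pd_list ys v) \<le> M (length ys)"
  shows "wL2 \<rho> (n + 3) (principal a (pd_list is v))
    \<le> wL2 \<rho> (n + 1) (pd_list is (op v))
      + real CARD('n) ^ 2 * (\<Sum>k=1..n. (n choose k) * ((A * S ^ k * fact k) * M (n - k + 2)))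
      + real CARD('n) * (\<Sum>k\<le>n. (n choose k) * ((A * S ^ k * fact k) * M (n - k + 1)))"
proof -
  let ?U = "ball (0::real^'n) R"
  let ?p = "n + 3"
  obtain r where r: "splits is = ([], is) # r" and rn: "\<forall>(xs, ys)\<in>set r. xs \<noteq> []"
    using splits_Nil_fst by blast
  have sv: "smooth ?U (pd j v)" "smooth ?U (pd i (pd j v))" for i j by (intro smooth_pd v)+
  define f1 where "f1 i j x = wt \<rho> x ^ ?p * (\<Sum>(xs, ys)\<leftarrow>r. pd_list xs (a i j) x * pd_list ys (pd i (pd j v)) x)" for i j x
  define f2 where "f2 j x = wt \<rho> x ^ ?p * (\<Sum>(xs, ys)\<leftarrow>splits is. pd_list xs (b j) x * pd_list ys (pd j v) x)" for j x
  define f0 where "f0 x = wt \<rho> x ^ ?p * pd_list is (op v) x" for x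
  have H1: "L2 (\<lambda>x. wt \<rho> x ^ ?p * pd_list ys (pd i (pd j v)) x) \<le> M (length ys + 2)"
    if "(xs, ys) \<in> set r" for xs ys i j
  proof -
    have "length xs + length ys = n" using that r splits_length[of xs ys "is"] by (simp add: n_def)
    moreover have "xs \<noteq> []" using rn that by auto
    \<comment> \<open>At least one derivative falls on the coefficient, so the order
      \<open>length ys + 2\<close> is at most n + 1.\<close>
    ultimately have ly: "length ys + 1 \<le> n" by (cases xs) auto
    have "L2 (\<lambda>x. wt \<rho> x ^ ?p * pd_list ys (pd i (pd j v)) x) \<le> wL2 \<rho> (length ys + 3) (pd_list ys (pd i (pd j v)))"
      using ly by (intro L2_weight_mono smooth_continuous smooth_pd_list sv) auto
    also have "\<dots> \<le> M (length ys + 2)"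
      using M[of "ys @ [i, j]"] ly by (simp add: pd_list_append eval_nat_numeral)
    finally show ?thesis .
  qed
  have H2: "L2 (\<lambda>x. wt \<rho> x ^ ?p * pd_list ys (pd j v) x) \<le> M (length ys + 1)"
    if "(xs, ys) \<in> set (splits is)" for xs ys j
  proof -
    have ly: "length ys \<le> n" using splits_length[OF that] by (simp add: n_def)
    have "L2 (\<lambda>x. wt \<rho> x ^ ?p * pd_list ys (pd j v) x) \<le> wL2 \<rho> (length ys + 2) (pd_list ys (pd j v))"
      using ly by (intro L2_weight_mono smooth_continuous smooth_pd_list sv) auto
    also have "\<dots> \<le> M (length ys + 1)"
      using M[of "ys @ [j]"] ly by (simp add: pd_list_append eval_nat_numeral)
    finally show ?thesis .
  qed
  have cs1: "csupp \<rho> (f1 i j)" and L1: "L2 (f1 i j)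
      \<le> (\<Sum>(xs, ys)\<leftarrow>r. (A * S ^ length xs * fact (length xs)) * M (length ys + 2))" for i j
    unfolding f1_def[abs_def]
    by (rule leibniz_L2[OF sa fa sv(2), where H = "\<lambda>k. M (k + 2)"]; (erule H1)?; simp)+
  have cs2: "csupp \<rho> (f2 j)" and L2': "L2 (f2 j)
      \<le> (\<Sum>(xs, ys)\<leftarrow>splits is. (A * S ^ length xs * fact (length xs)) * M (length ys + 1))" for j
    unfolding f2_def[abs_def]
    by (rule leibniz_L2[OF sb fb sv(1), where H = "\<lambda>k. M (k + 1)"]; (erule H2)?; simp)+
  have cs0: "csupp \<rho> f0"
    unfolding f0_def by (intro csupp_wt[OF \<rho>(1,2)] smooth_continuous smooth_pd_list smooth_op v) simp
  have eq: "wt \<rho> x ^ ?p * principal a (pd_list is v) x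
     = f0 x + (- 1) * ((\<Sum>i\<in>UNIV. \<Sum>j\<in>UNIV. f1 i j x) + (\<Sum>j\<in>UNIV. f2 j x))" for x
    using in_wt[of x]
  proof
    assume "wt \<rho> x = 0" then show ?thesis by (simp add: f0_def f1_def f2_def power_0_left)
  next
    assume x: "x \<in> ?U"
    have swap: "pd_list is (pd i (pd j v)) x = pd i (pd j (pd_list is v)) x" for i j
    proof -
      have "pd_list is (pd i (pd j v)) x = pd i (pd_list is (pd j v)) x"
        by (rule pd_list_snoc[OF open_ball sv(1) x])
      also have "\<dots> = pd i (pd j (pd_list is v)) x"
        by (rule pd_cong[OF open_ball x pd_list_snoc[OF open_ball v]])
      finally show ?thesis .
    qed
    have "pd_list is (op v) x = pd_list is (\<lambda>x. \<Sum>i\<in>UNIV. \<Sum>j\<in>UNIV. a i j x * pd i (pd j v) x) x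
        + pd_list is (\<lambda>x. \<Sum>j\<in>UNIV. b j x * pd j v x) x"
      unfolding op_def[abs_def] by (intro pd_list_add[of ?U] open_ball x smooth_sum smooth_mult sa sb sv)
    also have "pd_list is (\<lambda>x. \<Sum>j\<in>UNIV. b j x * pd j v x) x = (\<Sum>j\<in>UNIV. pd_list is (\<lambda>x. b j x * pd j v x) x)"
      by (intro pd_list_sum[of ?U] open_ball x smooth_mult sb sv)
    also have "\<dots> = (\<Sum>j\<in>UNIV. \<Sum>(xs, ys)\<leftarrow>splits is. pd_list xs (b j) x * pd_list ys (pd j v) x)"
      by (intro sum.cong refl pd_list_mult[of ?U] open_ball x sb sv)
    also have "pd_list is (\<lambda>x. \<Sum>i\<in>UNIV. \<Sum>j\<in>UNIV. a i j x * pd i (pd j v) x) x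
      = (\<Sum>i\<in>UNIV. pd_list is (\<lambda>x. \<Sum>j\<in>UNIV. a i j x * pd i (pd j v) x) x)"
      by (intro pd_list_sum[of ?U] open_ball x smooth_sum smooth_mult sa sv)
    also have "\<dots> = (\<Sum>i\<in>UNIV. \<Sum>j\<in>UNIV. pd_list is (\<lambda>x. a i j x * pd i (pd j v) x) x)"
      by (intro sum.cong refl pd_list_sum[of ?U] open_ball x smooth_mult sa sv)
    also have "\<dots> = (\<Sum>i\<in>UNIV. \<Sum>j\<in>UNIV. \<Sum>(xs, ys)\<leftarrow>splits is. pd_list xs (a i j) x * pd_list ys (pd i (pd j v)) x)"
      by (intro sum.cong refl pd_list_mult[of ?U] open_ball x sa sv)
    also have "\<dots> = principal a (pd_list is v) x
       + (\<Sum>i\<in>UNIV. \<Sum>j\<in>UNIV. \<Sum>(xs, ys)\<leftarrow>r. pd_list xs (a i j) x * pd_list ys (pd i (pd j v)) x)"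
      unfolding r by (simp add: swap sum.distrib)
    finally show ?thesis
      by (simp add: f0_def f1_def f2_def sum_distrib_left[symmetric] algebra_simps)
  qed
  have "L2 (\<lambda>x. wt \<rho> x ^ ?p * principal a (pd_list is v) x)
     \<le> L2 f0 + L2 (\<lambda>x. (- 1) * ((\<Sum>i\<in>UNIV. \<Sum>j\<in>UNIV. f1 i j x) + (\<Sum>j\<in>UNIV. f2 j x)))"
    unfolding eq by (intro L2_triangle[of \<rho>] csupp_cmult csupp_add csupp_sum cs0 cs1 cs2)
  also have "L2 (\<lambda>x. (- 1) * ((\<Sum>i\<in>UNIV. \<Sum>j\<in>UNIV. f1 i j x) + (\<Sum>j\<in>UNIV. f2 j x)))
    = L2 (\<lambda>x. (\<Sum>i\<in>UNIV. \<Sum>j\<in>UNIV. f1 i j x) + (\<Sum>j\<in>UNIV. f2 j x))"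
    unfolding L2_def by (simp only: power_mult_distrib) simp
  also have "\<dots> \<le> L2 (\<lambda>x. \<Sum>i\<in>UNIV. \<Sum>j\<in>UNIV. f1 i j x) + L2 (\<lambda>x. \<Sum>j\<in>UNIV. f2 j x)"
    by (intro L2_triangle[of \<rho>] csupp_sum cs1 cs2)
  also have "L2 (\<lambda>x. \<Sum>i\<in>UNIV. \<Sum>j\<in>UNIV. f1 i j x) \<le> (\<Sum>i\<in>UNIV. \<Sum>j\<in>UNIV. L2 (f1 i j))"
    by (intro order_trans[OF L2_sum[of _ \<rho>]] csupp_sum cs1 sum_mono L2_sum[of _ \<rho>])
  also have "\<dots> \<le> (\<Sum>i\<in>(UNIV::'n set). \<Sum>j\<in>(UNIV::'n set). \<Sum>k=1..n. (n choose k) * ((A * S ^ k * fact k) * M (n - k + 2)))"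
  proof (intro sum_mono)
    fix i j
    have "L2 (f1 i j) \<le> (\<Sum>(xs, ys)\<leftarrow>r. (A * S ^ length xs * fact (length xs)) * M (length ys + 2))"
      by (rule L1)
    also have "\<dots> = (\<Sum>k=1..n. (n choose k) * ((A * S ^ k * fact k) * M (n - k + 2)))"
      unfolding n_def by (rule splits_rest[OF r])
    finally show "L2 (f1 i j) \<le> (\<Sum>k=1..n. (n choose k) * ((A * S ^ k * fact k) * M (n - k + 2)))" .
  qed
  also have "L2 (\<lambda>x. \<Sum>j\<in>UNIV. f2 j x) \<le> (\<Sum>j\<in>UNIV. L2 (f2 j))"
    by (rule L2_sum[OF cs2])
  also have "\<dots> \<le> (\<Sum>j\<in>(UNIV::'n set). \<Sum>k\<le>n. (n choose k) * ((A * S ^ k * fact k) * M (n - k + 1)))"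
  proof (intro sum_mono)
    fix j
    have "L2 (f2 j) \<le> (\<Sum>(xs, ys)\<leftarrow>splits is. (A * S ^ length xs * fact (length xs)) * M (length ys + 1))"
      by (rule L2')
    also have "\<dots> = (\<Sum>k\<le>n. (n choose k) * ((A * S ^ k * fact k) * M (n - k + 1)))"
      unfolding n_def by (rule splits_binomial)
    finally show "L2 (f2 j) \<le> (\<Sum>k\<le>n. (n choose k) * ((A * S ^ k * fact k) * M (n - k + 1)))" .
  qed
  also have "L2 f0 \<le> wL2 \<rho> (n + 1) (pd_list is (op v))"
    unfolding f0_def by (intro L2_weight_mono smooth_continuous smooth_pd_list smooth_op v) auto
  finally show ?thesis by (simp add: power2_eq_square)
qed

text \<open>The constant of \<open>elliptic_estimate\<close> for the bound \<open>A + A * S\<close>,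
  which covers the coefficients (order 0) and their first derivatives (order 1).\<close>

definition C :: real where
  "C = (real CARD('n) + 10 * real CARD('n) ^ 3 * (A + A * S)) / l"

lemma C_nonneg: "0 \<le> C"
  using AS l by (simp add: C_def)

lemma second_order_estimate:
  assumes "smooth (ball 0 R) w" "2 \<le> p"
    and "wL2 \<rho> p (principal a w) \<le> X"
    and "\<And>j. wL2 \<rho> (p - 1) (pd j w) \<le> Y"
  shows "wL2 \<rho> p (pd i (pd k w)) \<le> C * (X + real p * Y)"
  unfolding C_def
proof (rule elliptic_estimate[OF \<rho> assms(1) sa _ _ _ l ell assms(2-4)])
  show "0 \<le> A + A * S" using AS by simp
  show "\<bar>a i j x\<bar> \<le> A + A * S" if "x \<in> ball 0 R" for x i j
  proof -
    have "\<bar>pd_list [] (a i j) x\<bar> \<le> A * S ^ length ([]::'n list) * fact (length ([]::'n list))"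
      using fa that unfolding fact_bound_def by blast
    moreover have "0 \<le> A * S" using AS by simp
    ultimately show ?thesis by simp
  qed
  show "\<bar>pd k (a i j) x\<bar> \<le> A + A * S" if "x \<in> ball 0 R" for x i j k
  proof -
    have "\<bar>pd_list [k] (a i j) x\<bar> \<le> A * S ^ length [k] * fact (length [k])"
      using fa that unfolding fact_bound_def by blast
    then show ?thesis using AS by simp
  qed
qed

end

subsection \<open>Iterates of the operator\<close>

text \<open>n! / (n - k)! is a product of k consecutive integers and grows when each is raised by q.
  So the Leibniz sums stay geometric when the bounds carry (n + q)! in place of n!.\<close>

lemma binomial_fact_shift:
  assumes "k \<le> n"
  shows "real (n choose k) * fact k * fact (n - k + q) \<le> fact (n + q)"
proof -
  have "fact n * fact (n - k + q) \<le> (fact (n + q) * fact (n - k) :: real)"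
  proof (induction q)
    case (Suc q)
    have "fact n * fact (n - k + Suc q) = real (n - k + Suc q) * (fact n * fact (n - k + q) :: real)"
      by simp
    also have "\<dots> \<le> real (n + Suc q) * (fact (n + q) * fact (n - k))"
      by (rule mult_mono[OF _ Suc]) auto
    also have "\<dots> = fact (n + Suc q) * fact (n - k)" by simp
    finally show ?case .
  qed simp
  then show ?thesis using assms by (simp add: binomial_fact field_simps)
qed

lemma quadratic_bound:
  fixes y P Q :: real
  assumes "y\<^sup>2 \<le> P + Q * y" "0 \<le> P" "0 \<le> Q"
  shows "y \<le> Q + sqrt P"
proof (rule ccontr)
  assume "\<not> ?thesis"
  then have y: "y > Q + sqrt P" by simp
  have "sqrt P * sqrt P < y * (y - Q)"
    using y assms by (intro mult_strict_mono') auto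
  then show False using assms by (simp add: power2_eq_square algebra_simps)
qed

text \<open>Interpolation yields the geometric mean of the factorials for orders 0 and 2, which must
  fit the one for order 1; the quotient under the root is (2k + 2) / (2k + 1), at most 2.\<close>

lemma sqrt_fact_bound: "sqrt (fact (2 * k) * fact (2 * k + 2)) \<le> sqrt 2 * fact (2 * k + 1)"
proof -
  define F where "F = (fact (2 * k) :: real)"
  have f: "fact (2 * k + 1) = (2 * real k + 1) * F" "fact (2 * k + 2) = (2 * real k + 2) * ((2 * real k + 1) * F)"
    by (simp_all add: F_def algebra_simps)
  have "F * fact (2 * k + 2) = (2 * real k + 2) * (2 * real k + 1) * F\<^sup>2"
    unfolding f by (simp add: power2_eq_square)
  also have "\<dots> \<le> (2 * (2 * real k + 1)) * (2 * real k + 1) * F\<^sup>2"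
    by (intro mult_right_mono) auto
  also have "\<dots> = 2 * (fact (2 * k + 1))\<^sup>2"
    unfolding f by (simp add: power2_eq_square)
  finally have "sqrt (F * fact (2 * k + 2)) \<le> sqrt (2 * (fact (2 * k + 1))\<^sup>2)" by (rule real_sqrt_le_mono)
  then show ?thesis by (simp add: F_def real_sqrt_mult)
qed

context elliptic_operator
begin

text \<open>Coefficient of the unknown in the quadratic inequality of
  \<open>gradient_estimate\<close>, up to \<open>N\<close>: first-order terms of the operator, p = 3
  from the elliptic estimate, 10 from interpolation.\<close>

definition E :: real where "E = C * real CARD('n) * A + 3 * C + 10"

text \<open>A sum of lower bounds: \<open>2 * S\<close> for the ratio of the geometric series, the
  term with \<open>C\<close> for the step by two orders, the last two for order one.\<close>

definition T :: real where
  "T = 1 + 2 * S + C * (3 + 2 * (real CARD('n))\<^sup>2 * A * S + 2 * real CARD('n) * A) + E + sqrt (2 * C)"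

lemma E_nonneg: "0 \<le> E"
  using C_nonneg AS by (simp add: E_def)

lemma T_bounds: "1 \<le> T" "2 * S \<le> T" "C * (3 + 2 * (real CARD('n))\<^sup>2 * A * S + 2 * real CARD('n) * A) \<le> T" "E + sqrt (2 * C) \<le> T"
proof -
  have "0 \<le> C * (3 + 2 * (real CARD('n))\<^sup>2 * A * S + 2 * real CARD('n) * A)" "0 \<le> sqrt (2 * C)" using C_nonneg AS by simp_all
  then show "1 \<le> T" "2 * S \<le> T" "C * (3 + 2 * (real CARD('n))\<^sup>2 * A * S + 2 * real CARD('n) * A) \<le> T" "E + sqrt (2 * C) \<le> T"
    using E_nonneg AS unfolding T_def by linarith+
qed

text \<open>The second-order estimate involves all gradient components, interpolation only one. For
  the largest component they combine into a quadratic inequality in one unknown.\<close>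

lemma gradient_estimate:
  assumes v: "smooth (ball 0 R) v"
    and N: "wL2 \<rho> 1 v \<le> N" and F: "wL2 \<rho> 1 (op v) \<le> F"
  shows "wL2 \<rho> 2 (pd i v) \<le> N * E + sqrt (N * (C * F))"
proof -
  have N0: "0 \<le> N" using N L2_nonneg order_trans by blast
  have F0: "0 \<le> F" using F L2_nonneg order_trans by blast
  define y where "y i = wL2 \<rho> 2 (pd i v)" for i
  obtain k where k: "\<And>i. y i \<le> y k"
  proof -
    have "Max (range y) \<in> range y" by (rule Max_in) auto
    then obtain k where "Max (range y) = y k" by blast
    then have "y i \<le> y k" for i using Max_ge[of "range y" "y i"] by simp
    then show ?thesis by (rule that)
  qed
  have y0: "0 \<le> y k" by (simp add: y_def L2_nonneg)
  \<comment> \<open>For the empty list the commutator sum is empty and the first-order sum has one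
    term, so only orders 0 and 1 matter.\<close>
  define M where "M q = (if q = 0 then N else y k)" for q :: nat
  have "L2 (\<lambda>x. wt \<rho> x ^ (0 + 3) * (\<Sum>i\<in>UNIV. \<Sum>j\<in>UNIV. a i j x * pd i (pd j (pd_list [] v)) x))
    \<le> wL2 \<rho> (0 + 1) (pd_list [] (op v))
      + real CARD('n) ^ 2 * (\<Sum>k=1..0. (0 choose k) * ((A * S ^ k * fact k) * M (0 - k + 2)))
      + real CARD('n) * (\<Sum>k\<le>0. (0 choose k) * ((A * S ^ k * fact k) * M (0 - k + 1)))"
  proof (rule principal_part_bound[of v "[]" M, unfolded list.size, OF v])
    fix ys :: "'n list" assume "length ys \<le> 0 + 1"
    then consider "ys = []" | j where "ys = [j]" by (cases ys) auto
    then show "wL2 \<rho> (length ys + 1) (pd_list ys v) \<le> M (length ys)"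
    proof cases
      case 1
      then show ?thesis using N by (simp add: M_def)
    next
      case (2 j)
      then show ?thesis using k[of j] by (simp add: M_def y_def numeral_2_eq_2)
    qed
  qed
  then have X: "wL2 \<rho> 3 (principal a v) \<le> F + real CARD('n) * (A * y k)"
    using F by (simp add: M_def)
  have "wL2 \<rho> 3 (pd k (pd k v)) \<le> C * ((F + real CARD('n) * (A * y k)) + real 3 * y k)"
    by (rule second_order_estimate[OF v _ X]) (use k in \<open>auto simp: y_def\<close>)
  moreover have "(y k)\<^sup>2 \<le> wL2 \<rho> 1 v * (wL2 \<rho> 3 (pd k (pd k v)) + 10 * y k)"
    unfolding y_def by (rule gradient_interpolation[OF \<rho> v])
  ultimately have "(y k)\<^sup>2 \<le> N * (C * ((F + real CARD('n) * (A * y k)) + real 3 * y k) + 10 * y k)"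
    using N N0 y0 by (elim order_trans) (intro mult_mono add_mono, auto simp: L2_nonneg)
  also have "\<dots> = N * (C * F) + N * E * y k" by (simp add: E_def algebra_simps)
  finally have "y k \<le> N * E + sqrt (N * (C * F))"
    by (rule quadratic_bound) (use N0 F0 C_nonneg E_nonneg in auto)
  then show ?thesis using k[of i] by (simp add: y_def)
qed

text \<open>In \<open>nxt\<close> the factorial is the one that order n gives for the next iterate;
  it already equals that of the conclusion.\<close>

lemma induction_step:
  fixes Z L :: real and "is" :: "'n list" and k :: nat
  defines "n \<equiv> length is" and "\<tau> \<equiv> T * sqrt L"
  assumes v: "smooth (ball 0 R) v" and Z: "0 \<le> Z" "1 \<le> L"
    and low: "\<And>ys. length ys \<le> n + 1 \<Longrightarrow>
        wL2 \<rho> (length ys + 1) (pd_list ys v) \<le> Z * \<tau> ^ length ys * fact (length ys + 2 * k)"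
    and nxt: "wL2 \<rho> (n + 1) (pd_list is (op v)) \<le> Z * L * \<tau> ^ n * fact (n + 2 + 2 * k)"
  shows "wL2 \<rho> (n + 3) (pd_list (i # j # is) v) \<le> Z * \<tau> ^ (n + 2) * fact (n + 2 + 2 * k)"
proof -
  have s: "1 \<le> sqrt L" using Z by simp
  have \<tau>T: "T \<le> \<tau>" using mult_left_mono[OF s, of T] T_bounds(1) by (simp add: \<tau>_def)
  have \<tau>1: "1 \<le> \<tau>" "0 < \<tau>" using \<tau>T T_bounds(1) by auto
  have T0: "0 < T" using T_bounds(1) by simp
  \<comment> \<open>A derivative moved to a coefficient costs \<open>S\<close> in place of \<tau>;
    the ratio is at most 1/2 because \<open>2 * S \<le> T\<close>.\<close>
  define \<theta> where "\<theta> = S / \<tau>"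
  have \<theta>: "0 \<le> \<theta>" "\<theta> \<le> S / T" "\<theta> \<le> 1 / 2" "S = \<theta> * \<tau>"
    using AS \<tau>1 \<tau>T T_bounds(2) T0 by (auto simp: \<theta>_def field_simps mult_left_mono)
  define M where "M q = Z * \<tau> ^ q * fact (q + 2 * k)" for q
  define Q where "Q = Z * \<tau> ^ (n + 2) * fact (n + 2 + 2 * k)"
  have Q0: "0 \<le> Q" using Z \<tau>1 by (simp add: Q_def)
  have term_le: "(n choose h) * ((A * S ^ h * fact h) * M (n - h + q)) \<le> (A * M (n + q)) * \<theta> ^ h"
    if "h \<le> n" for h q
  proof -
    have e: "\<tau> ^ h * \<tau> ^ (n - h + q) = \<tau> ^ (n + q)" using that by (simp flip: power_add)
    have "(n choose h) * ((A * S ^ h * fact h) * M (n - h + q))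
      = A * Z * (\<tau> ^ h * \<tau> ^ (n - h + q)) * \<theta> ^ h * (real (n choose h) * fact h * fact (n - h + (q + 2 * k)))"
      by (simp add: M_def \<theta>(4) power_mult_distrib add.assoc)
    also have "\<dots> \<le> A * Z * \<tau> ^ (n + q) * \<theta> ^ h * fact (n + (q + 2 * k))"
      unfolding e using binomial_fact_shift[OF that, of "q + 2 * k"] AS Z \<tau>1 \<theta>
      by (intro mult_left_mono) auto
    finally show ?thesis by (simp add: M_def mult_ac add.assoc)
  qed
  have M0: "0 \<le> M q" for q using Z \<tau>1 by (simp add: M_def)
  \<comment> \<open>Order n + 1 lacks one power of \<tau>, and this gains \<open>1 / T\<close> over
    the target \<open>Q\<close>.\<close>
  have M1: "M (n + 1) \<le> Q / T"
  proof -
    have "T * M (n + 1) \<le> \<tau> * (Z * \<tau> ^ (n + 1) * fact (n + 2 + 2 * k))"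
      unfolding M_def using Z \<tau>1 \<tau>T T0 by (intro mult_mono fact_mono) auto
    then show ?thesis using T0 by (simp add: Q_def field_simps)
  qed
  \<comment> \<open>Here no power of \<tau> is missing; the gain comes from the series starting at
    the first power of \<theta>.\<close>
  have S1: "(\<Sum>h=1..n. (n choose h) * ((A * S ^ h * fact h) * M (n - h + 2))) \<le> 2 * A * S * (Q / T)"
  proof -
    have "(\<Sum>h=1..n. (n choose h) * ((A * S ^ h * fact h) * M (n - h + 2))) \<le> (\<Sum>h=1..n. (A * M (n + 2)) * \<theta> ^ h)"
      by (intro sum_mono term_le) auto
    also have "\<dots> = (A * M (n + 2)) * (\<Sum>h=1..n. \<theta> ^ h)" by (simp add: sum_distrib_left)
    also have "\<dots> \<le> (A * M (n + 2)) * (2 * (S / T))"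
      using geometric_tail_le(1)[OF \<theta>(1,3), of n] \<theta>(2) AS M0[of "n + 2"] by (intro mult_left_mono) auto
    also have "M (n + 2) = Q" by (simp add: M_def Q_def)
    finally show ?thesis by (simp add: mult_ac)
  qed
  have S2: "(\<Sum>h\<le>n. (n choose h) * ((A * S ^ h * fact h) * M (n - h + 1))) \<le> 2 * A * (Q / T)"
  proof -
    have "(\<Sum>h\<le>n. (n choose h) * ((A * S ^ h * fact h) * M (n - h + 1))) \<le> (\<Sum>h\<le>n. (A * M (n + 1)) * \<theta> ^ h)"
      by (intro sum_mono term_le) auto
    also have "\<dots> = (A * M (n + 1)) * (\<Sum>h\<le>n. \<theta> ^ h)" by (simp add: sum_distrib_left)
    also have "\<dots> \<le> (A * (Q / T)) * 2"
      using geometric_tail_le(2)[OF \<theta>(1,3), of n] AS M0[of "n + 1"] M1 \<theta>(1) Q0 T0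
      by (intro mult_mono mult_left_mono) (auto intro!: sum_nonneg)
    finally show ?thesis by (simp add: mult_ac)
  qed
  \<comment> \<open>\<open>T * T * L\<close> equals the square of \<tau>, which pays for the extra
    \<open>L\<close>; one of the two gains \<open>1 / T\<close> suffices.\<close>
  have S0: "Z * L * \<tau> ^ n * fact (n + 2 + 2 * k) \<le> Q / T"
  proof -
    have "L = (sqrt L)\<^sup>2" using Z by simp
    then have "T * T * L = \<tau>\<^sup>2" by (simp add: \<tau>_def power_mult_distrib power2_eq_square)
    then have "T * (T * (Z * L * \<tau> ^ n * fact (n + 2 + 2 * k))) = Q"
      by (simp add: Q_def power_add power2_eq_square mult_ac)
    moreover have "1 * (T * (Z * L * \<tau> ^ n * fact (n + 2 + 2 * k))) \<le> T * (T * (Z * L * \<tau> ^ n * fact (n + 2 + 2 * k)))"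
      using T_bounds(1) Z \<tau>1 by (intro mult_right_mono) auto
    ultimately show ?thesis using T0 by (simp add: field_simps)
  qed
  \<comment> \<open>The factor p = n + 3 is at most twice n + 2 + 2k, the quotient of the factorials
    for orders n + 2 and n + 1.\<close>
  have SY: "real (n + 3) * M (n + 1) \<le> 2 * (Q / T)"
  proof -
    have P: "real (n + 3) * fact (n + 1 + 2 * k) \<le> 2 * (fact (n + 2 + 2 * k) :: real)"
    proof -
      have "real (n + 3) * fact (n + 1 + 2 * k) \<le> (2 * real (n + 2 + 2 * k)) * fact (n + 1 + 2 * k)"
        by (intro mult_right_mono) auto
      also have "\<dots> = 2 * fact (Suc (n + 1 + 2 * k))" unfolding fact_Suc by simp
      finally show ?thesis by simp
    qed
    have "T * (real (n + 3) * fact (n + 1 + 2 * k)) \<le> \<tau> * (2 * fact (n + 2 + 2 * k))"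
      by (rule mult_mono[OF \<tau>T P]) (use \<tau>1 in auto)
    then have "T * (real (n + 3) * fact (n + 1 + 2 * k)) * (Z * \<tau> ^ (n + 1)) \<le> \<tau> * (2 * fact (n + 2 + 2 * k)) * (Z * \<tau> ^ (n + 1))"
      by (rule mult_right_mono) (use Z \<tau>1 in auto)
    then have "T * (real (n + 3) * M (n + 1)) \<le> 2 * Q"
      by (simp add: M_def Q_def mult_ac)
    then show ?thesis using T0 by (simp add: field_simps)
  qed
  have w: "smooth (ball 0 R) (pd_list is v)" by (rule smooth_pd_list[OF v])
  have X: "wL2 \<rho> (n + 3) (principal a (pd_list is v))
    \<le> Q / T + (real CARD('n))\<^sup>2 * (2 * A * S * (Q / T)) + real CARD('n) * (2 * A * (Q / T))"
  proof -
    have "wL2 \<rho> (n + 3) (principal a (pd_list is v))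
    \<le> wL2 \<rho> (n + 1) (pd_list is (op v))
      + (real CARD('n))\<^sup>2 * (\<Sum>k=1..n. (n choose k) * ((A * S ^ k * fact k) * M (n - k + 2)))
      + real CARD('n) * (\<Sum>k\<le>n. (n choose k) * ((A * S ^ k * fact k) * M (n - k + 1)))"
      unfolding n_def by (rule principal_part_bound[OF v]) (use low in \<open>simp add: M_def n_def\<close>)
    also have "\<dots> \<le> Q / T + (real CARD('n))\<^sup>2 * (2 * A * S * (Q / T)) + real CARD('n) * (2 * A * (Q / T))"
      using nxt S0 S1 S2 by (intro add_mono mult_left_mono) auto
    finally show ?thesis .
  qed
  have Y: "wL2 \<rho> (n + 3 - 1) (pd h (pd_list is v)) \<le> M (n + 1)" for h
    using low[of "h # is"] by (simp add: M_def n_def)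
  have "wL2 \<rho> (n + 3) (pd i (pd j (pd_list is v)))
     \<le> C * ((Q / T + (real CARD('n))\<^sup>2 * (2 * A * S * (Q / T)) + real CARD('n) * (2 * A * (Q / T))) + real (n + 3) * M (n + 1))"
    by (rule second_order_estimate[OF w _ X Y]) simp
  also have "\<dots> \<le> C * ((Q / T + (real CARD('n))\<^sup>2 * (2 * A * S * (Q / T)) + real CARD('n) * (2 * A * (Q / T))) + 2 * (Q / T))"
    using SY C_nonneg by (intro mult_left_mono) auto
  \<comment> \<open>All contributions are multiples of \<open>Q / T\<close>: the 3 is 1 from
    \<open>nxt\<close> plus 2 from the gradient term, the rest are the Leibniz sums.\<close>
  also have "\<dots> = (C * (3 + 2 * (real CARD('n))\<^sup>2 * A * S + 2 * real CARD('n) * A)) * (Q / T)"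
    by (simp only: distrib_left distrib_right mult_ac) (simp add: algebra_simps)
  also have "\<dots> \<le> T * (Q / T)" using T_bounds(3) Q0 T0 by (intro mult_right_mono) auto
  also have "\<dots> = Q" using T0 by simp
  finally show ?thesis by (simp add: Q_def)
qed

text \<open>The induction is on the order with k arbitrary, because order n + 2 of
  \<open>V k\<close> refers to order n of \<open>V (Suc k)\<close>. The recursion for
  \<open>V\<close> is assumed on the ball only, where the weight lives.\<close>

lemma derivative_bounds:
  fixes V :: "nat \<Rightarrow> real^'n \<Rightarrow> real" and Z L :: real
  assumes V: "\<And>k. smooth (ball 0 R) (V k)"
    and step: "\<And>k x. x \<in> ball 0 R \<Longrightarrow> V (Suc k) x = op (V k) x"
    and Z: "0 \<le> Z" "1 \<le> L"
    and hyp: "\<And>k. wL2 \<rho> 1 (V k) \<le> Z * L ^ k * fact (2 * k)"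
  shows "wL2 \<rho> (length is + 1) (pd_list is (V k))
      \<le> Z * L ^ k * (T * sqrt L) ^ length is * fact (length is + 2 * k)"
proof (induction "length is" arbitrary: "is" k rule: less_induct)
  case less
  have op_eq: "wt \<rho> x ^ Suc p * pd_list js (op (V k)) x = wt \<rho> x ^ Suc p * pd_list js (V (Suc k)) x" for x p js k
    using in_wt[of x] pd_list_cong[OF open_ball, of x 0 R "op (V k)" "V (Suc k)" js] step[of _ k]
    by auto
  consider "is = []" | i where "is = [i]" | i j js where "is = i # j # js"
    by (cases "is"; cases "tl is") auto
  then show ?case
  proof cases
    case 1
    then show ?thesis using hyp[of k] by simp
  next
    case (2 i)
    define N F where "N = Z * L ^ k * fact (2 * k)" and "F = Z * L ^ Suc k * fact (2 * k + 2)"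
    have s: "1 \<le> sqrt L" using Z by simp
    have "wL2 \<rho> 1 (op (V k)) = wL2 \<rho> 1 (V (Suc k))"
      by (rule arg_cong[where f = L2], rule ext) (use op_eq[of _ 0 "[]" k] in simp)
    also have "\<dots> \<le> F" using hyp[of "Suc k"] by (simp add: F_def)
    finally have "wL2 \<rho> 2 (pd i (V k)) \<le> N * E + sqrt (N * (C * F))"
      using hyp[of k] V by (intro gradient_estimate) (auto simp: N_def)
    also have "N * E \<le> Z * L ^ k * sqrt L * fact (2 * k + 1) * E"
    proof -
      have "N * 1 \<le> (Z * L ^ k * fact (2 * k + 1)) * sqrt L"
        unfolding N_def using Z s by (intro mult_mono fact_mono) auto
      from mult_right_mono[OF this E_nonneg] show ?thesis by (simp add: mult_ac)
    qed
    \<comment> \<open>\<open>F\<close> belongs to the next iterate and carries one more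
      \<open>L\<close>; its geometric mean with \<open>N\<close> produces
      \<open>sqrt L\<close>.\<close>
    also have "sqrt (N * (C * F)) \<le> Z * L ^ k * sqrt L * fact (2 * k + 1) * sqrt (2 * C)"
    proof -
      have "N * (C * F) = (Z * L ^ k)\<^sup>2 * L * C * (fact (2 * k) * fact (2 * k + 2))"
        by (simp add: N_def F_def power2_eq_square mult_ac)
      moreover have "sqrt (y\<^sup>2 * L * C * G) = y * sqrt L * sqrt C * sqrt G" if "0 \<le> y" for y G
        using that by (simp add: real_sqrt_mult)
      ultimately have "sqrt (N * (C * F)) = (Z * L ^ k) * sqrt L * sqrt C * sqrt (fact (2 * k) * fact (2 * k + 2))"
        using Z by (simp only: mult_nonneg_nonneg zero_le_power order.trans[OF zero_le_one])
      also have "\<dots> \<le> (Z * L ^ k) * sqrt L * sqrt C * (sqrt 2 * fact (2 * k + 1))"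
        using Z C_nonneg by (intro mult_left_mono sqrt_fact_bound) auto
      finally show ?thesis by (simp add: real_sqrt_mult mult_ac)
    qed
    finally have "wL2 \<rho> 2 (pd i (V k)) \<le> Z * L ^ k * sqrt L * fact (2 * k + 1) * (E + sqrt (2 * C))"
      by (simp add: distrib_left)
    also have "\<dots> \<le> Z * L ^ k * sqrt L * fact (2 * k + 1) * T"
      using T_bounds(4) Z by (intro mult_left_mono) auto
    finally show ?thesis using 2 by (simp add: numeral_2_eq_2 mult_ac)
  next
    case (3 i j js)
    \<comment> \<open>The power \<open>L ^ k\<close> is absorbed into the constant \<open>Z\<close>
      of the step.\<close>
    have "wL2 \<rho> (length js + 3) (pd_list (i # j # js) (V k))
      \<le> (Z * L ^ k) * (T * sqrt L) ^ (length js + 2) * fact (length js + 2 + 2 * k)"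
    proof (rule induction_step[OF V _ Z(2)])
      show "0 \<le> Z * L ^ k" using Z by simp
      show "wL2 \<rho> (length ys + 1) (pd_list ys (V k))
        \<le> Z * L ^ k * (T * sqrt L) ^ length ys * fact (length ys + 2 * k)" if "length ys \<le> length js + 1" for ys
        using less[of ys k] that 3 by simp
      have "wL2 \<rho> (length js + 1) (pd_list js (op (V k)))
        = wL2 \<rho> (length js + 1) (pd_list js (V (Suc k)))"
        by (rule arg_cong[where f = L2], rule ext) (use op_eq[of _ "length js" js k] in simp)
      also have "\<dots> \<le> Z * L ^ Suc k * (T * sqrt L) ^ length js * fact (length js + 2 * Suc k)"
        using less[of js "Suc k"] 3 by simp
      finally show "wL2 \<rho> (length js + 1) (pd_list js (op (V k)))
        \<le> Z * L ^ k * L * (T * sqrt L) ^ length js * fact (length js + 2 + 2 * k)"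
        by (simp add: mult_ac)
    qed
    then show ?thesis using 3 by (simp add: eval_nat_numeral)
  qed
qed

end

subsection \<open>Pointwise bounds from L2 bounds\<close>

text \<open>Lebesgue measure as a product measure, so that the Sobolev inequality can be proved one
  coordinate at a time.\<close>

lemma lborel_eq_PiM_axis:
  "lborel = distr (\<Pi>\<^sub>M i\<in>(UNIV::'n::finite set). (lborel :: real measure)) borel (\<lambda>y. \<Sum>i\<in>UNIV. y i *\<^sub>R axis i (1::real))"
proof (rule lborel_eqI)
  interpret product_sigma_finite "\<lambda>_::'n. lborel :: real measure" ..
  let ?P = "\<Pi>\<^sub>M i\<in>(UNIV::'n set). (lborel :: real measure)"
  let ?f = "\<lambda>y. \<Sum>i\<in>UNIV. y i *\<^sub>R axis i (1::real) :: real^'n"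
  have [measurable]: "?f \<in> measurable ?P borel" by measurable
  fix l u :: "real^'n" assume le: "\<And>b. b \<in> Basis \<Longrightarrow> l \<bullet> b \<le> u \<bullet> b"
  have le': "l $ i \<le> u $ i" for i using le[of "axis i 1"] by (auto simp: inner_axis axis_in_Basis_iff)
  have fi: "?f y $ i = y i" for y i
    by (simp add: axis_def if_distrib cong: if_cong)
  have pre: "?f -` box l u \<inter> space ?P = (\<Pi>\<^sub>E i\<in>UNIV. {l $ i <..< u $ i})"
    by (rule set_eqI, simp only: vimage_eq Int_iff mem_box_cart fi) (auto simp: space_PiM PiE_iff)
  have "emeasure (distr ?P borel ?f) (box l u) = emeasure ?P (\<Pi>\<^sub>E i\<in>UNIV. {l $ i <..< u $ i})"
    by (subst emeasure_distr) (auto simp: pre)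
  also have "\<dots> = (\<Prod>i\<in>UNIV. emeasure lborel {l $ i <..< u $ i})"
    by (rule emeasure_PiM) auto
  also have "\<dots> = (\<Prod>i\<in>UNIV. ennreal (u $ i - l $ i))" using le' by simp
  also have "\<dots> = ennreal (\<Prod>i\<in>UNIV. u $ i - l $ i)" using le' by (intro prod_ennreal) auto
  also have "(\<Prod>i\<in>UNIV. u $ i - l $ i) = (\<Prod>b\<in>Basis. (u - l) \<bullet> b)"
  proof -
    have "(\<Prod>b\<in>range (\<lambda>i::'n. axis i (1::real)). (u - l) \<bullet> b) = (\<Prod>i\<in>UNIV. (u - l) \<bullet> axis i 1)"
      by (subst prod.reindex) (auto simp: inj_on_def axis_eq_axis)
    moreover have "range (\<lambda>i::'n. axis i (1::real)) = Basis" by (auto simp: Basis_vec_def)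
    ultimately show ?thesis by (simp add: inner_axis)
  qed
  finally show "emeasure (distr ?P borel ?f) (box l u) = (\<Prod>b\<in>Basis. (u - l) \<bullet> b)" .
qed simp

text \<open>The fundamental theorem applied to - (r - t) h(t)^2 / r, which is 0 at r and - h(0)^2 at
  0; completing a square removes the mixed term h h'.\<close>

lemma endpoint_bound:
  fixes h h' :: "real \<Rightarrow> real"
  assumes r: "0 < r" and h: "\<And>t. 0 \<le> t \<Longrightarrow> t \<le> r \<Longrightarrow> DERIV h t :> h' t"
    and h': "\<And>t. 0 \<le> t \<Longrightarrow> t \<le> r \<Longrightarrow> isCont h' t"
  shows "ennreal ((h 0)\<^sup>2) \<le> (\<integral>\<^sup>+ t. ennreal (2 / r * (h t)\<^sup>2 + r * (h' t)\<^sup>2) * indicator {0..r} t \<partial>lborel)"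
proof -
  have ch: "isCont h t" if "0 \<le> t" "t \<le> r" for t using h[OF that] by (rule DERIV_isCont)
  define g where "g t = - (r - t) * (h t)\<^sup>2 / r" for t
  define g' where "g' t = (h t)\<^sup>2 / r - 2 * (r - t) * h t * h' t / r" for t
  define f where "f t = 2 / r * (h t)\<^sup>2 + r * (h' t)\<^sup>2" for t
  have "DERIV g t :> g' t" if "0 \<le> t" "t \<le> r" for t
    unfolding g_def g'_def using r
    by (auto intro!: derivative_eq_intros h[OF that] simp: field_simps power2_eq_square)
  moreover have "isCont g' t" if "0 \<le> t" "t \<le> r" for t
    unfolding g'_def using r ch[OF that] h'[OF that] by (intro continuous_intros) auto
  ultimately have G: "has_bochner_integral lborel (\<lambda>t. g' t * indicator {0..r} t) (g r - g 0)"
    using r by (intro has_bochner_integral_FTC_Icc_real) auto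
  have fi: "integrable lborel (\<lambda>t. f t * indicator {0..r} t)"
    unfolding f_def using ch h' r by (intro borel_integrable_atLeastAtMost) (auto intro!: continuous_intros)
  have le: "g' t \<le> f t" if "0 \<le> t" "t \<le> r" for t
  proof -
    have "- 2 * (r - t) * h t * h' t \<le> (h t)\<^sup>2 + ((r - t) * h' t)\<^sup>2"
      using zero_le_power2[of "h t + (r - t) * h' t"] by (simp add: power2_eq_square algebra_simps)
    also have "((r - t) * h' t)\<^sup>2 \<le> r\<^sup>2 * (h' t)\<^sup>2"
      unfolding power_mult_distrib using that by (intro mult_right_mono power_mono) auto
    finally have "- 2 * (r - t) * h t * h' t \<le> (h t)\<^sup>2 + r\<^sup>2 * (h' t)\<^sup>2" by simp
    moreover have "r * g' t = (h t)\<^sup>2 - 2 * (r - t) * h t * h' t" "r * f t = 2 * (h t)\<^sup>2 + r\<^sup>2 * (h' t)\<^sup>2"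
      using r by (simp_all add: g'_def f_def right_diff_distrib distrib_left power2_eq_square)
    ultimately have "r * g' t \<le> r * f t" by linarith
    then show ?thesis using r by simp
  qed
  have "(h 0)\<^sup>2 = (\<integral>t. g' t * indicator {0..r} t \<partial>lborel)"
    using has_bochner_integral_integral_eq[OF G] r by (simp add: g_def)
  also have "\<dots> \<le> (\<integral>t. f t * indicator {0..r} t \<partial>lborel)"
    using G fi le by (intro integral_mono) (auto simp: has_bochner_integral_iff indicator_def)
  finally have "ennreal ((h 0)\<^sup>2) \<le> ennreal (\<integral>t. f t * indicator {0..r} t \<partial>lborel)" by (rule ennreal_leI)
  also have "\<dots> = (\<integral>\<^sup>+ t. ennreal (f t * indicator {0..r} t) \<partial>lborel)"
    using fi r by (intro nn_integral_eq_integral[symmetric]) (auto simp: f_def indicator_def)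
  also have "\<dots> = (\<integral>\<^sup>+ t. ennreal (f t) * indicator {0..r} t \<partial>lborel)"
    by (intro nn_integral_cong) (auto simp: indicator_def)
  finally show ?thesis unfolding f_def .
qed

definition cube :: "real \<Rightarrow> (real^'n::finite) set" where
  "cube r = {x. \<forall>i. 0 \<le> x $ i \<and> x $ i \<le> r}"

text \<open>What \<open>endpoint_bound\<close> leaves after use in every direction of the list:
  squares of mixed derivatives over all sublists, with a factor r for each direction taken and 2 / r
  for each omitted. Values in ennreal allow Tonelli without integrability.\<close>

primrec sobolev_density :: "real \<Rightarrow> 'n::finite list \<Rightarrow> (real^'n \<Rightarrow> real) \<Rightarrow> real^'n \<Rightarrow> ennreal" where
  "sobolev_density r [] f w = ennreal ((f w)\<^sup>2) * indicator (cube r) w"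
| "sobolev_density r (i # bs) f w = ennreal (2 / r) * sobolev_density r bs f w + ennreal r * sobolev_density r bs (pd i f) w"

lemma cube_cbox: "cube r = cbox (0::real^'n::finite) (\<chi> i. r)"
  by (auto simp: cube_def mem_box_cart)

lemma sobolev_density_measurable:
  assumes "smooth U f" "cube r \<subseteq> U"
  shows "sobolev_density r bs f \<in> borel_measurable borel"
  using assms(1)
proof (induction bs arbitrary: f)
  case Nil
  have c: "continuous_on (cube r) f" using smooth_continuous[OF Nil] assms(2) by (rule continuous_on_subset)
  have "cube r \<in> sets borel" by (simp add: cube_cbox)
  then have "(\<lambda>x. indicator (cube r) x *\<^sub>R (f x)\<^sup>2) \<in> borel_measurable borel"
    by (intro borel_measurable_continuous_on_indicator continuous_intros c)
  then have "(\<lambda>x. ennreal (indicator (cube r) x *\<^sub>R (f x)\<^sup>2)) \<in> borel_measurable borel" by simp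
  moreover have "sobolev_density r [] f = (\<lambda>x. ennreal (indicator (cube r) x *\<^sub>R (f x)\<^sup>2))"
    by (auto simp: fun_eq_iff indicator_def)
  ultimately show ?case by simp
next
  case (Cons i bs)
  have [measurable]: "sobolev_density r bs f \<in> borel_measurable borel" "sobolev_density r bs (pd i f) \<in> borel_measurable borel"
    using Cons.IH Cons.prems smooth_pd by blast+
  have "sobolev_density r (i # bs) f = (\<lambda>w. ennreal (2 / r) * sobolev_density r bs f w + ennreal r * sobolev_density r bs (pd i f) w)"
    by (simp add: fun_eq_iff)
  then show ?case by simp
qed

text \<open>Each direction offers a factor 2 / r or a derivative at the cost r y; the choices
  multiply to a power.\<close>

lemma sobolev_density_integral_bound:
  assumes r: "0 < r" and "0 \<le> W" "0 \<le> y" "smooth U f" "cube r \<subseteq> U"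
    and I: "\<And>zs. length zs \<le> length bs \<Longrightarrow>
      (\<integral>\<^sup>+ w. ennreal ((pd_list zs f w)\<^sup>2) * indicator (cube r) w \<partial>lborel) \<le> ennreal (W * y ^ length zs)"
  shows "(\<integral>\<^sup>+ w. sobolev_density r bs f w \<partial>lborel) \<le> ennreal (W * (2 / r + r * y) ^ length bs)"
  using assms(2,4) I
proof (induction bs arbitrary: f W)
  case Nil
  then show ?case using Nil(3)[of "[]"] by simp
next
  case (Cons i bs)
  note [measurable] = sobolev_density_measurable[OF Cons.prems(2) assms(5), of bs]
    sobolev_density_measurable[OF smooth_pd[OF Cons.prems(2), of i] assms(5), of bs]
  let ?B = "(2 / r + r * y) ^ length bs"
  have B0: "0 \<le> ?B" using r assms(3) by simp
  have "(\<integral>\<^sup>+ w. sobolev_density r (i # bs) f w \<partial>lborel)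
     = ennreal (2 / r) * (\<integral>\<^sup>+ w. sobolev_density r bs f w \<partial>lborel) + ennreal r * (\<integral>\<^sup>+ w. sobolev_density r bs (pd i f) w \<partial>lborel)"
    by (simp add: nn_integral_add nn_integral_cmult)
  also have "\<dots> \<le> ennreal (2 / r) * ennreal (W * ?B) + ennreal r * ennreal ((W * y) * ?B)"
  proof (intro add_mono mult_left_mono)
    show "(\<integral>\<^sup>+ w. sobolev_density r bs f w \<partial>lborel) \<le> ennreal (W * ?B)"
      using Cons.prems by (intro Cons.IH) auto
    show "(\<integral>\<^sup>+ w. sobolev_density r bs (pd i f) w \<partial>lborel) \<le> ennreal ((W * y) * ?B)"
    proof (rule Cons.IH)
      show "(\<integral>\<^sup>+ w. ennreal ((pd_list zs (pd i f) w)\<^sup>2) * indicator (cube r) w \<partial>lborel) \<le> ennreal ((W * y) * y ^ length zs)"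
        if "length zs \<le> length bs" for zs
        using Cons.prems(3)[of "zs @ [i]"] that by (simp add: pd_list_append mult_ac)
    qed (use Cons.prems assms(3) in \<open>auto intro: smooth_pd\<close>)
  qed auto
  also have "\<dots> = ennreal (2 / r * (W * ?B) + r * ((W * y) * ?B))"
    using r B0 Cons.prems(1) assms(3) by (simp add: ennreal_mult[symmetric] ennreal_plus[symmetric] del: ennreal_plus)
  also have "2 / r * (W * ?B) + r * ((W * y) * ?B) = W * (2 / r + r * y) ^ length (i # bs)"
    by (simp add: algebra_simps)
  finally show ?case .
qed

text \<open>Induction over the directions still to be integrated. In these z has coordinate 0, the
  endpoint to which \<open>endpoint_bound\<close> applies; the others are already free in the
  cube.\<close>

lemma pointwise_le_sobolev_density:
  fixes f :: "real^'n::finite \<Rightarrow> real"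
  assumes r: "0 < r" and U: "open U" "cube r \<subseteq> U"
    and "smooth U f" "distinct bs" "z \<in> cube r" "\<And>i. i \<in> set bs \<Longrightarrow> z $ i = 0"
  shows "ennreal ((f z)\<^sup>2) \<le> (\<integral>\<^sup>+ y. sobolev_density r bs f (z + (\<Sum>i\<in>set bs. y i *\<^sub>R axis i 1)) \<partial>(\<Pi>\<^sub>M i\<in>set bs. lborel))"
  using assms(4-)
proof (induction bs arbitrary: f z)
  case Nil
  then show ?case by (simp add: PiM_empty nn_integral_count_space_finite)
next
  case (Cons i bs)
  interpret product_sigma_finite "\<lambda>_::'n. lborel :: real measure" ..
  have bs: "distinct bs" "i \<notin> set bs" using Cons.prems by auto
  let ?e = "axis i 1 :: real^'n"
  let ?M = "\<Pi>\<^sub>M j\<in>set bs. (lborel :: real measure)"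
  define s where "s y = (\<Sum>j\<in>set bs. y j *\<^sub>R axis j 1 :: real^'n)" for y :: "'n \<Rightarrow> real"
  have zt: "z + t *\<^sub>R ?e \<in> cube r" if "0 \<le> t" "t \<le> r" for t
    using Cons.prems(3,4) that by (auto simp: cube_def axis_def)
  have ztU: "z + t *\<^sub>R ?e \<in> U" if "0 \<le> t" "t \<le> r" for t using zt[OF that] U by blast
  have sf: "smooth U f" "smooth U (pd i f)" using Cons.prems smooth_pd by blast+
  have [measurable]: "sobolev_density r bs f \<in> borel_measurable borel" "sobolev_density r bs (pd i f) \<in> borel_measurable borel"
    "sobolev_density r (i # bs) f \<in> borel_measurable borel"
    using sobolev_density_measurable[OF _ U(2)] sf by blast+
  have sm[measurable]: "s \<in> measurable ?M borel" unfolding s_def by measurable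
  have "ennreal ((f z)\<^sup>2) = ennreal ((f (z + 0 *\<^sub>R ?e))\<^sup>2)" by simp
  also have "\<dots> \<le> (\<integral>\<^sup>+ t. ennreal (2 / r * (f (z + t *\<^sub>R ?e))\<^sup>2 + r * (pd i f (z + t *\<^sub>R ?e))\<^sup>2) * indicator {0..r} t \<partial>lborel)"
  proof (rule endpoint_bound[OF r])
    fix t assume t: "0 \<le> t" "t \<le> r"
    show "DERIV (\<lambda>t. f (z + t *\<^sub>R ?e)) t :> pd i f (z + t *\<^sub>R ?e)"
      by (rule haspd_along[OF smooth_haspd[OF sf(1) ztU[OF t]]])
    show "isCont (\<lambda>t. pd i f (z + t *\<^sub>R ?e)) t"
      using haspd_along[OF smooth_haspd[OF sf(2) ztU[OF t]]] by (rule DERIV_isCont)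
  qed
  also have "\<dots> \<le> (\<integral>\<^sup>+ t. (\<integral>\<^sup>+ y. sobolev_density r (i # bs) f (z + t *\<^sub>R ?e + s y) \<partial>?M) \<partial>lborel)"
  proof (rule nn_integral_mono)
    fix t :: real
    show "ennreal (2 / r * (f (z + t *\<^sub>R ?e))\<^sup>2 + r * (pd i f (z + t *\<^sub>R ?e))\<^sup>2) * indicator {0..r} t
      \<le> (\<integral>\<^sup>+ y. sobolev_density r (i # bs) f (z + t *\<^sub>R ?e + s y) \<partial>?M)"
    proof (cases "0 \<le> t \<and> t \<le> r")
      case True
      then have t: "0 \<le> t" "t \<le> r" by auto
      have z0: "(z + t *\<^sub>R ?e) $ j = 0" if "j \<in> set bs" for j
        using Cons.prems(4)[of j] that bs by (auto simp: axis_def)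
      have "ennreal (2 / r * (f (z + t *\<^sub>R ?e))\<^sup>2 + r * (pd i f (z + t *\<^sub>R ?e))\<^sup>2)
        = ennreal (2 / r) * ennreal ((f (z + t *\<^sub>R ?e))\<^sup>2) + ennreal r * ennreal ((pd i f (z + t *\<^sub>R ?e))\<^sup>2)"
        using r by (subst (1 2) ennreal_mult[symmetric]) (auto simp: ennreal_plus[symmetric] simp del: ennreal_plus)
      also have "\<dots> \<le> ennreal (2 / r) * (\<integral>\<^sup>+ y. sobolev_density r bs f (z + t *\<^sub>R ?e + s y) \<partial>?M)
          + ennreal r * (\<integral>\<^sup>+ y. sobolev_density r bs (pd i f) (z + t *\<^sub>R ?e + s y) \<partial>?M)"
        unfolding s_def using sf bs(1) zt[OF t] z0
        by (intro add_mono mult_left_mono Cons.IH) auto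
      also have "\<dots> = (\<integral>\<^sup>+ y. sobolev_density r (i # bs) f (z + t *\<^sub>R ?e + s y) \<partial>?M)"
        by (simp add: nn_integral_add nn_integral_cmult)
      finally show ?thesis using t by simp
    qed simp
  qed
  also have "\<dots> = (\<integral>\<^sup>+ y. sobolev_density r (i # bs) f (z + (\<Sum>j\<in>set (i # bs). y j *\<^sub>R axis j 1)) \<partial>(\<Pi>\<^sub>M j\<in>set (i # bs). lborel))"
  proof -
    \<comment> \<open>Tonelli with the new direction as the outer variable.\<close>
    have "(\<integral>\<^sup>+ y. sobolev_density r (i # bs) f (z + (\<Sum>j\<in>set (i # bs). y j *\<^sub>R axis j 1)) \<partial>(\<Pi>\<^sub>M j\<in>insert i (set bs). lborel))
      = (\<integral>\<^sup>+ t. (\<integral>\<^sup>+ y. sobolev_density r (i # bs) f (z + (\<Sum>j\<in>set (i # bs). (y(i := t)) j *\<^sub>R axis j 1)) \<partial>?M) \<partial>lborel)"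
      by (rule product_nn_integral_insert_rev) (use bs in \<open>auto simp del: sobolev_density.simps\<close>)
    moreover have "z + (\<Sum>j\<in>set (i # bs). (y(i := t)) j *\<^sub>R axis j 1) = z + t *\<^sub>R ?e + s y" for y t
    proof -
      have "(\<Sum>j\<in>set bs. (y(i := t)) j *\<^sub>R axis j (1::real)) = s y"
        unfolding s_def by (rule sum.cong) (use bs in auto)
      then show ?thesis using bs by (simp add: add.assoc)
    qed
    ultimately show ?thesis by (simp only: list.set(2))
  qed
  finally show ?case .
qed

lemma pointwise_bound:
  fixes f :: "real^'n::finite \<Rightarrow> real"
  assumes r: "0 < r" and U: "open U" "cube r \<subseteq> U" and W: "0 \<le> W" "0 \<le> y" and f: "smooth U f"
    and I: "\<And>zs. length zs \<le> CARD('n) \<Longrightarrow>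
      (\<integral>\<^sup>+ w. ennreal ((pd_list zs f w)\<^sup>2) * indicator (cube r) w \<partial>lborel) \<le> ennreal (W * y ^ length zs)"
  shows "(f 0)\<^sup>2 \<le> W * (2 / r + r * y) ^ CARD('n)"
proof -
  obtain bs :: "'n list" where bs: "set bs = UNIV" "distinct bs"
    using finite_distinct_list[of "UNIV :: 'n set"] by auto
  then have len: "length bs = CARD('n)" using distinct_card by force
  let ?P = "\<Pi>\<^sub>M i\<in>(UNIV::'n set). (lborel :: real measure)"
  have [measurable]: "sobolev_density r bs f \<in> borel_measurable borel" by (rule sobolev_density_measurable[OF f U(2)])
  have "ennreal ((f 0)\<^sup>2) \<le> (\<integral>\<^sup>+ y. sobolev_density r bs f (0 + (\<Sum>i\<in>set bs. y i *\<^sub>R axis i 1)) \<partial>(\<Pi>\<^sub>M i\<in>set bs. lborel))"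
    using r by (intro pointwise_le_sobolev_density[OF r U f bs(2)]) (auto simp: cube_def)
  also have "\<dots> = (\<integral>\<^sup>+ y. sobolev_density r bs f (\<Sum>i\<in>UNIV. y i *\<^sub>R axis i 1) \<partial>?P)" by (simp add: bs)
  also have "\<dots> = (\<integral>\<^sup>+ w. sobolev_density r bs f w \<partial>distr ?P borel (\<lambda>y. \<Sum>i\<in>UNIV. y i *\<^sub>R axis i 1))"
    by (subst nn_integral_distr) auto
  also have "\<dots> = (\<integral>\<^sup>+ w. sobolev_density r bs f w \<partial>lborel)" by (simp only: lborel_eq_PiM_axis[symmetric])
  also have "\<dots> \<le> ennreal (W * (2 / r + r * y) ^ length bs)"
    by (rule sobolev_density_integral_bound[OF r W f U(2) I]) (simp add: len)
  finally show ?thesis using r W by (subst (asm) ennreal_le_iff) (auto simp: len)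
qed

subsection \<open>Multi-index norms and the final estimate\<close>

text \<open>The choice in \<open>mpartial\<close> is meaningful because every multi-index is the
  count function of some list.\<close>

lemma multiindex_list:
  fixes \<alpha> :: "'n::finite \<Rightarrow> nat"
  defines "xs \<equiv> SOME xs. \<forall>i. count_list xs i = \<alpha> i"
  shows "count_list xs = \<alpha>" "length xs = mi_order \<alpha>" "mpartial \<alpha> f = pd_list xs f"
proof -
  have M: "count (Abs_multiset \<alpha>) = \<alpha>" by (rule count_Abs_multiset) simp
  obtain ys where "mset ys = Abs_multiset \<alpha>" using ex_mset by blast
  then have "\<forall>i. count_list ys i = \<alpha> i" using M by (metis count_mset)
  then have "\<forall>i. count_list xs i = \<alpha> i" unfolding xs_def by (rule someI)
  then show c: "count_list xs = \<alpha>" by auto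
  show "length xs = mi_order \<alpha>"
    using sum_count_set[of xs UNIV] by (simp add: c mi_order_def)
  show "mpartial \<alpha> f = pd_list xs f" by (simp add: mpartial_def xs_def)
qed

text \<open>\<open>count_list\<close> is a left inverse of the choice of a list, so the
  multi-indices of order j inject into the words of length j.\<close>

lemma card_multiindices:
  "finite {\<alpha> :: 'n::finite \<Rightarrow> nat. mi_order \<alpha> = j}" "card {\<alpha> :: 'n \<Rightarrow> nat. mi_order \<alpha> = j} \<le> CARD('n) ^ j"
proof -
  let ?A = "{\<alpha> :: 'n \<Rightarrow> nat. mi_order \<alpha> = j}" and ?B = "{xs :: 'n list. set xs \<subseteq> UNIV \<and> length xs = j}"
  let ?h = "\<lambda>\<alpha>. SOME xs. \<forall>i. count_list xs i = \<alpha> i"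
  have inj: "inj_on ?h ?A" by (rule inj_on_inverseI[where g = count_list]) (rule multiindex_list(1))
  have sub: "?h ` ?A \<subseteq> ?B" using multiindex_list(2) by auto
  have fin: "finite ?B" by (rule finite_lists_length_eq) simp
  show "finite ?A" using inj_on_finite[OF inj sub fin] .
  have "card ?A \<le> card ?B" using card_inj_on_le[OF inj sub fin] .
  then show "card ?A \<le> CARD('n) ^ j" by (simp add: card_lists_length_eq[of "UNIV::'n set", simplified])
qed

lemma ennreal_sqrt_le:
  assumes "I \<le> ennreal (B\<^sup>2)" "0 \<le> B"
  shows "ennreal_sqrt I \<le> ennreal B"
proof -
  have "I \<noteq> \<infinity>" using assms(1) by (auto simp: top_unique)
  moreover have "sqrt (enn2real I) \<le> B"
    using enn2real_leI[OF _ assms(1)] assms(2) by (intro real_le_lsqrt) auto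
  ultimately show ?thesis by (simp add: ennreal_sqrt_def ennreal_leI)
qed

lemma ennreal_sqrt_leD:
  assumes "ennreal_sqrt I \<le> ennreal B" "0 \<le> B"
  shows "I \<le> ennreal (B\<^sup>2)"
proof (cases I)
  case (real x)
  then have "sqrt x \<le> B" using assms by (simp add: ennreal_sqrt_def ennreal_le_iff)
  then have "x \<le> B\<^sup>2" using real_sqrt_le_iff[of x "B\<^sup>2"] assms(2) by (simp add: real_le_rsqrt sqrt_le_D)
  then show ?thesis using real by (simp add: ennreal_leI)
next
  case top
  then show ?thesis using assms by (simp add: ennreal_sqrt_def top_unique)
qed

lemma knorm_0:
  fixes u :: "real^'n::finite \<Rightarrow> real"
  shows "knorm 0 R u = ennreal_sqrt (\<integral>\<^sup>+ x. ennreal ((u x)\<^sup>2) * indicator (ball 0 R) x \<partial>lborel)"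
proof -
  have "{\<alpha> :: 'n \<Rightarrow> nat. mi_order \<alpha> = 0} = {\<lambda>_. 0}" by (auto simp: mi_order_def fun_eq_iff)
  moreover have "mpartial (\<lambda>_. 0) u = u"
    using multiindex_list(2,3)[of "\<lambda>_::'n. 0"] by (simp add: mi_order_def)
  ultimately show ?thesis by (simp add: knorm_def)
qed

lemma nn_integral_csupp_square:
  assumes "csupp \<rho> f"
  shows "(\<integral>\<^sup>+ x. ennreal ((f x)\<^sup>2) \<partial>lborel) = ennreal ((L2 f)\<^sup>2)"
  unfolding L2_square by (rule nn_integral_eq_integral) (auto intro: csupp_integrable csupp_power2 assms)

text \<open>The weight is at most 1 and lives inside the larger ball, so the hypothesis of the
  theorem supplies order 0 of the induction.\<close>

lemma L2_le_knorm:
  fixes v :: "real^'n::finite \<Rightarrow> real"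
  assumes "0 < \<rho>" "\<rho> < R" "R \<le> 1" "continuous_on (ball 0 R) v" "knorm 0 2 v \<le> ennreal B" "0 \<le> B"
  shows "wL2 \<rho> 1 v \<le> B"
proof -
  have cs: "csupp \<rho> (\<lambda>x. wt \<rho> x ^ 1 * v x)" by (rule csupp_wt) (use assms in auto)
  have "ennreal ((wL2 \<rho> 1 v)\<^sup>2) = (\<integral>\<^sup>+ x. ennreal ((wt \<rho> x ^ 1 * v x)\<^sup>2) \<partial>lborel)"
    by (rule nn_integral_csupp_square[OF cs, symmetric])
  also have "\<dots> \<le> (\<integral>\<^sup>+ x. ennreal ((v x)\<^sup>2) * indicator (ball 0 2) x \<partial>lborel)"
  proof (rule nn_integral_mono)
    fix x :: "real^'n"
    show "ennreal ((wt \<rho> x ^ 1 * v x)\<^sup>2) \<le> ennreal ((v x)\<^sup>2) * indicator (ball 0 2) x"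
    proof (cases "norm x < 2")
      case True
      have "(wt \<rho> x)\<^sup>2 * (v x)\<^sup>2 \<le> 1 * (v x)\<^sup>2"
        using wt_nonneg[of \<rho> x] wt_le_1[of \<rho> x] assms by (intro mult_right_mono power_le_one) auto
      then show ?thesis using True by (simp add: power_mult_distrib ennreal_leI)
    next
      case False
      then show ?thesis using wt_zero[of \<rho> x] assms by simp
    qed
  qed
  also have "\<dots> \<le> ennreal (B\<^sup>2)"
    using assms by (intro ennreal_sqrt_leD) (simp_all add: knorm_0)
  finally have "(wL2 \<rho> 1 v)\<^sup>2 \<le> B\<^sup>2" by (simp add: ennreal_le_iff)
  then show ?thesis using assms(6) by (rule power2_le_imp_le)
qed

text \<open>On half the radius the weight is at least three quarters of the square of \<rho>, so
  removing it costs only a factor geometric in n.\<close>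

lemma nn_integral_ball_le_L2:
  fixes f :: "real^'n::finite \<Rightarrow> real"
  assumes "0 < \<rho>" "\<rho> < R" "continuous_on (ball 0 R) f" "wL2 \<rho> (n + 1) f \<le> B"
  shows "(\<integral>\<^sup>+ x. ennreal ((f x)\<^sup>2) * indicator (ball 0 (\<rho> / 2)) x \<partial>lborel)
    \<le> ennreal (((1 / (3 / 4 * \<rho>\<^sup>2)) ^ (n + 1) * B)\<^sup>2)"
proof -
  define \<kappa> where "\<kappa> = 3 / 4 * \<rho>\<^sup>2"
  have \<kappa>: "0 < \<kappa>" using assms by (simp add: \<kappa>_def)
  define c where "c = (1 / \<kappa>) ^ (n + 1)"
  have c: "0 \<le> c" using \<kappa> by (simp add: c_def)
  have cs: "csupp \<rho> (\<lambda>x. wt \<rho> x ^ (n + 1) * f x)" by (rule csupp_wt) (use assms in auto)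
  have m: "(\<lambda>x. ennreal ((wt \<rho> x ^ (n + 1) * f x)\<^sup>2)) \<in> borel_measurable lborel"
  proof -
    have "(\<lambda>x. (wt \<rho> x ^ (n + 1) * f x)\<^sup>2) \<in> borel_measurable lborel"
      using csupp_integrable[OF csupp_power2[OF cs]] by (rule borel_measurable_integrable)
    then show ?thesis by simp
  qed
  have "(\<integral>\<^sup>+ x. ennreal ((f x)\<^sup>2) * indicator (ball 0 (\<rho> / 2)) x \<partial>lborel)
    \<le> (\<integral>\<^sup>+ x. ennreal (c\<^sup>2) * ennreal ((wt \<rho> x ^ (n + 1) * f x)\<^sup>2) \<partial>lborel)"
  proof (rule nn_integral_mono)
    fix x :: "real^'n"
    show "ennreal ((f x)\<^sup>2) * indicator (ball 0 (\<rho> / 2)) x \<le> ennreal (c\<^sup>2) * ennreal ((wt \<rho> x ^ (n + 1) * f x)\<^sup>2)"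
    proof (cases "x \<in> ball 0 (\<rho> / 2)")
      case True
      have "(norm x)\<^sup>2 \<le> (\<rho> / 2)\<^sup>2" using True by (intro power_mono) auto
      then have "\<kappa> \<le> \<rho>\<^sup>2 - (norm x)\<^sup>2" by (simp add: \<kappa>_def power_divide)
      also have "\<dots> \<le> wt \<rho> x" by (simp add: wt_def)
      finally have "\<kappa> \<le> wt \<rho> x" .
      then have "1 \<le> c * wt \<rho> x ^ (n + 1)"
        using \<kappa> unfolding c_def power_mult_distrib[symmetric] by (intro one_le_power) (simp add: field_simps)
      then have "1 * \<bar>f x\<bar> \<le> (c * wt \<rho> x ^ (n + 1)) * \<bar>f x\<bar>" by (rule mult_right_mono) simp
      then have "\<bar>f x\<bar>\<^sup>2 \<le> (c * wt \<rho> x ^ (n + 1) * \<bar>f x\<bar>)\<^sup>2" by (intro power_mono) auto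
      then have "(f x)\<^sup>2 \<le> c\<^sup>2 * (wt \<rho> x ^ (n + 1) * f x)\<^sup>2" by (simp add: power_mult_distrib mult_ac)
      then show ?thesis using True by (simp add: ennreal_leI flip: ennreal_mult)
    qed simp
  qed
  also have "\<dots> = ennreal (c\<^sup>2) * ennreal ((wL2 \<rho> (n + 1) f)\<^sup>2)"
    unfolding nn_integral_csupp_square[OF cs, symmetric] by (rule nn_integral_cmult[OF m])
  also have "\<dots> \<le> ennreal (c\<^sup>2) * ennreal (B\<^sup>2)"
    using assms(4) by (intro mult_left_mono ennreal_leI power_mono) (auto simp: L2_nonneg)
  also have "\<dots> = ennreal ((c * B)\<^sup>2)" by (simp add: power_mult_distrib flip: ennreal_mult)
  finally show ?thesis unfolding c_def \<kappa>_def .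
qed

lemma cube_subset_ball:
  assumes "real CARD('n) * r < q"
  shows "cube r \<subseteq> ball (0 :: real^'n::finite) q"
proof
  fix x :: "real^'n" assume "x \<in> cube r"
  then have "norm x \<le> (\<Sum>i\<in>(UNIV::'n set). r)"
    by (intro order_trans[OF norm_le_l1_cart] sum_mono) (auto simp: cube_def)
  then show "x \<in> ball 0 q" using assms by simp
qed

text \<open>The power of 2 bounds a binomial coefficient; it becomes the 2 in
  \<open>2 * T * sqrt L0\<close>.\<close>

lemma fact_add_le: "fact (j + h) \<le> (2 ^ (j + h) * fact j * fact h :: real)"
proof -
  have "real ((j + h) choose h) \<le> 2 ^ (j + h)"
    using binomial_le_pow2[of "j + h" h] by (metis of_nat_le_iff of_nat_numeral of_nat_power)
  then have "real ((j + h) choose h) * (fact j * fact h) \<le> 2 ^ (j + h) * (fact j * fact h)"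
    by (rule mult_right_mono) simp
  moreover have "real ((j + h) choose h) * (fact j * fact h) = fact (j + h)" by (simp add: binomial_fact)
  ultimately show ?thesis by (simp add: mult.assoc)
qed

theorem theoremA1:
  fixes g :: "real^'n::finite \<Rightarrow> real^'n^'n"
  assumes "analytic_riemannian_metric_on g (ball 0 4)"
  shows "\<exists>K T \<rho>0. K > 0 \<and> T > 0 \<and> 0 < \<rho>0 \<and> \<rho>0 < 1 \<and>
    (\<forall>(u :: real^'n \<Rightarrow> real) (Z0::real) (L0::real).
       real_analytic_on u (ball 0 2) \<and> Z0 > 1 \<and> L0 > 1 \<and>
       (\<forall>k::nat. knorm 0 2 ((laplacian g ^^ k) u) \<le> ennreal (Z0 * L0 ^ k * fact (2 * k)))
       \<longrightarrow>
       (\<forall>j::nat. knorm j \<rho>0 u \<le> ennreal (Z0 * (T * sqrt L0) ^ j * fact j)) \<and>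
       (\<forall>\<alpha>::'n \<Rightarrow> nat. \<bar>mpartial \<alpha> u 0\<bar> \<le>
          K * Z0 * L0 powr (real CARD('n) / 4) * (2 * T * sqrt L0) ^ mi_order \<alpha> * fact (mi_order \<alpha>)))"
proof -
  obtain a :: "'n \<Rightarrow> 'n \<Rightarrow> real^'n \<Rightarrow> real" and b :: "'n \<Rightarrow> real^'n \<Rightarrow> real" and R A S l
    where R: "0 < R" "R \<le> 1" and co: "0 \<le> A" "0 \<le> S" "0 < l"
    "\<And>i j. smooth (ball 0 R) (a i j)" "\<And>i j. fact_bound (ball 0 R) (a i j) A S"
    "\<And>j. smooth (ball 0 R) (b j)" "\<And>j. fact_bound (ball 0 R) (b j) A S"
    "\<And>x \<xi>. x \<in> ball 0 R \<Longrightarrow> l * (\<Sum>i\<in>UNIV. (\<xi> i)\<^sup>2) \<le> (\<Sum>i\<in>UNIV. \<Sum>j\<in>UNIV. a i j x * \<xi> i * \<xi> j)"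
    and lap: "\<And>v x. smooth (ball 0 R) v \<Longrightarrow> x \<in> ball 0 R \<Longrightarrow>
       laplacian g v x = principal a v x + (\<Sum>j\<in>UNIV. b j x * pd j v x)"
    by (rule laplacian_coefficients[OF assms]) (rule that; simp)
  define \<rho> where "\<rho> = R / 2"
  have \<rho>: "0 < \<rho>" "\<rho> < R" "\<rho> < 1" using R by (auto simp: \<rho>_def)
  interpret E: elliptic_operator \<rho> R A S l a b
    using \<rho> R co by unfold_locales
  let ?m = "CARD('n)"
  have m1: "1 \<le> real ?m" by (simp add: Suc_leI)
  define \<kappa> where "\<kappa> = 3 / 4 * \<rho>\<^sup>2"
  have \<kappa>: "0 < \<kappa>" "\<kappa> \<le> 1" using \<rho> power_le_one[of \<rho> 2] by (auto simp: \<kappa>_def)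
  have \<kappa>1: "1 \<le> 1 / \<kappa>" using \<kappa> by simp
  \<comment> \<open>The dimension absorbs the number of multi-indices. The square absorbs the
    exponent j + 1 of \<open>1 / \<kappa>\<close>, which is at most 2j once j is positive.\<close>
  define T where "T = real ?m * (1 / \<kappa>)\<^sup>2 * E.T"
  have ET: "1 \<le> E.T" by (rule E.T_bounds)
  have T: "0 < T" using ET \<kappa> by (simp add: T_def)
  have T_ge: "(1 / \<kappa>) * E.T \<le> T"
  proof -
    have "1 * ((1 / \<kappa>) * (1 / \<kappa>)) \<le> real ?m * (1 / \<kappa>)\<^sup>2"
      using m1 unfolding power2_eq_square by (intro mult_right_mono) auto
    moreover have "(1 / \<kappa>) * 1 \<le> (1 / \<kappa>) * (1 / \<kappa>)" using \<kappa>1 \<kappa> by (intro mult_left_mono) auto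
    ultimately show ?thesis unfolding T_def using ET by (intro mult_right_mono) auto
  qed
  define \<rho>0 where "\<rho>0 = \<rho> / 2"
  have \<rho>0: "0 < \<rho>0" "\<rho>0 < 1" using \<rho> by (auto simp: \<rho>0_def)
  \<comment> \<open>Half of what \<open>cube_subset_ball\<close> permits, for the sake of its strict
    inequality.\<close>
  define c where "c = \<rho>0 / (2 * real ?m)"
  have c: "0 < c" using \<rho>0 by (simp add: c_def)
  \<comment> \<open>With side \<open>c / sqrt L0\<close> the Sobolev factor becomes exactly
    \<open>sqrt L0 * D\<close>.\<close>
  define D where "D = 2 / c + c * (2 * T)\<^sup>2"
  have D: "0 < D" using c by (simp add: D_def add_pos_nonneg)
  \<comment> \<open>One \<open>1 / \<kappa>\<close> is left from the exponent n + 1, the factorial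
    covers the additional derivatives, and the root is the Sobolev constant.\<close>
  define K where "K = (1 / \<kappa>) * fact ?m * sqrt (D ^ ?m)"
  have K: "0 < K" using \<kappa> D by (simp add: K_def)
  have main: "(\<forall>j::nat. knorm j \<rho>0 u \<le> ennreal (Z0 * (T * sqrt L0) ^ j * fact j)) \<and>
       (\<forall>\<alpha>::'n \<Rightarrow> nat. \<bar>mpartial \<alpha> u 0\<bar> \<le>
          K * Z0 * L0 powr (real CARD('n) / 4) * (2 * T * sqrt L0) ^ mi_order \<alpha> * fact (mi_order \<alpha>))"
    if u: "real_analytic_on u (ball 0 2)" and Z0: "Z0 > 1" and L0: "L0 > 1"
      and hyp: "\<forall>k::nat. knorm 0 2 ((laplacian g ^^ k) u) \<le> ennreal (Z0 * L0 ^ k * fact (2 * k))"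
    for u :: "real^'n \<Rightarrow> real" and Z0 L0 :: real
  proof -
    define s where "s = sqrt L0"
    have s: "1 \<le> s" using L0 by (simp add: s_def)
    define V where "V k = (laplacian g ^^ k) u" for k
    have su: "smooth (ball 0 R) u"
      using real_analytic_smooth[OF u] by (rule smooth_subset) (use R in auto)
    have step: "V (Suc k) x = E.op (V k) x" if "smooth (ball 0 R) (V k)" "x \<in> ball 0 R" for k x
      using lap[OF that] by (simp add: V_def E.op_def)
    have sV: "smooth (ball 0 R) (V k)" for k
    proof (induction k)
      case (Suc k)
      show ?case
        by (rule smooth_cong[OF open_ball _ E.smooth_op[OF Suc]]) (rule step[OF Suc, symmetric])
    qed (simp add: V_def su)
    have h0: "wL2 \<rho> 1 (V k) \<le> Z0 * L0 ^ k * fact (2 * k)" for k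
      using hyp Z0 L0 R \<rho> unfolding V_def[symmetric]
      by (intro L2_le_knorm[OF \<rho>(1,2)] smooth_continuous[OF sV]) auto
    have db: "wL2 \<rho> (length is + 1) (pd_list is u)
      \<le> Z0 * (E.T * s) ^ length is * fact (length is)" for "is"
      using E.derivative_bounds[OF sV step[OF sV] _ _ h0, of "is" 0] Z0 L0 by (simp add: V_def s_def)
    define Bd where "Bd n = (1 / \<kappa>) ^ (n + 1) * (Z0 * (E.T * s) ^ n * fact n)" for n
    have Bd0: "0 \<le> Bd n" for n using \<kappa> Z0 ET s by (simp add: Bd_def)
    have I: "(\<integral>\<^sup>+ x. ennreal ((pd_list is u x)\<^sup>2) * indicator (ball 0 \<rho>0) x \<partial>lborel)
      \<le> ennreal ((Bd (length is))\<^sup>2)" for "is"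
      unfolding Bd_def \<kappa>_def \<rho>0_def
      by (rule nn_integral_ball_le_L2[OF \<rho>(1,2) smooth_continuous[OF smooth_pd_list[OF su]] db])
    have part1: "knorm j \<rho>0 u \<le> ennreal (Z0 * (T * sqrt L0) ^ j * fact j)" for j
    proof (cases j)
      case 0
      \<comment> \<open>At order 0 no power of \<open>T\<close> can absorb
        \<open>1 / \<kappa>\<close>; the hypothesis for k = 0 is restricted to the smaller ball
        instead.\<close>
      have "knorm 0 2 u \<le> ennreal Z0" using hyp[rule_format, of 0] by simp
      then have "(\<integral>\<^sup>+ x. ennreal ((u x)\<^sup>2) * indicator (ball 0 2) x \<partial>lborel) \<le> ennreal (Z0\<^sup>2)"
        using Z0 by (intro ennreal_sqrt_leD) (simp_all add: knorm_0)
      moreover have "(\<integral>\<^sup>+ x. ennreal ((u x)\<^sup>2) * indicator (ball 0 \<rho>0) x \<partial>lborel)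
        \<le> (\<integral>\<^sup>+ x. ennreal ((u x)\<^sup>2) * indicator (ball 0 2) x \<partial>lborel)"
        using \<rho>0 by (intro nn_integral_mono mult_left_mono) (auto simp: indicator_def)
      ultimately have "knorm 0 \<rho>0 u \<le> ennreal Z0"
        unfolding knorm_0 using Z0 by (intro ennreal_sqrt_le) auto
      then show ?thesis using 0 by simp
    next
      case (Suc i)
      have "knorm j \<rho>0 u \<le> (\<Sum>\<alpha>\<in>{\<alpha>::'n \<Rightarrow> nat. mi_order \<alpha> = j}. ennreal (Bd j))"
        unfolding knorm_def
      proof (rule sum_mono)
        fix \<alpha> :: "'n \<Rightarrow> nat" assume "\<alpha> \<in> {\<alpha>. mi_order \<alpha> = j}"
        then show "ennreal_sqrt (\<integral>\<^sup>+ x. ennreal ((mpartial \<alpha> u x)\<^sup>2) * indicator (ball 0 \<rho>0) x \<partial>lborel) \<le> ennreal (Bd j)"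
          using I[of "SOME xs. \<forall>i. count_list xs i = \<alpha> i"] Bd0
          by (intro ennreal_sqrt_le) (simp_all add: multiindex_list(2,3))
      qed
      also have "\<dots> = ennreal (real (card {\<alpha>::'n \<Rightarrow> nat. mi_order \<alpha> = j}) * Bd j)"
        using Bd0[of j] by (simp add: ennreal_mult flip: ennreal_of_nat_eq_real_of_nat)
      also have "\<dots> \<le> ennreal (Z0 * (T * s) ^ j * fact j)"
      proof (rule ennreal_leI)
        have "real (card {\<alpha>::'n \<Rightarrow> nat. mi_order \<alpha> = j}) \<le> real ?m ^ j"
          using card_multiindices(2)[where 'n = 'n, of j] by (metis of_nat_le_iff of_nat_power)
        then have "real (card {\<alpha>::'n \<Rightarrow> nat. mi_order \<alpha> = j}) * Bd j \<le> real ?m ^ j * Bd j"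
          using Bd0[of j] by (rule mult_right_mono)
        also have "\<dots> = (1 / \<kappa>) ^ (j + 1) * (real ?m ^ j * (Z0 * (E.T * s) ^ j * fact j))"
          by (simp add: Bd_def)
        also have "\<dots> \<le> (1 / \<kappa>) ^ (2 * j) * (real ?m ^ j * (Z0 * (E.T * s) ^ j * fact j))"
          using \<kappa>1 Suc Z0 ET s by (intro mult_right_mono power_increasing) auto
        also have "\<dots> = Z0 * (T * s) ^ j * fact j"
          by (simp only: T_def power_mult_distrib power_mult) (simp add: mult_ac)
        finally show "real (card {\<alpha>::'n \<Rightarrow> nat. mi_order \<alpha> = j}) * Bd j \<le> Z0 * (T * s) ^ j * fact j" .
      qed
      finally show ?thesis by (simp add: s_def)
    qed
    have part2: "\<bar>mpartial \<alpha> u 0\<bar> \<le>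
        K * Z0 * L0 powr (real CARD('n) / 4) * (2 * T * sqrt L0) ^ mi_order \<alpha> * fact (mi_order \<alpha>)" for \<alpha> :: "'n \<Rightarrow> nat"
    proof -
      define xs where "xs = (SOME xs. \<forall>i. count_list xs i = \<alpha> i)"
      define j where "j = mi_order \<alpha>"
      have lx: "length xs = j" unfolding xs_def j_def by (rule multiindex_list(2))
      define f where "f = pd_list xs u"
      have f: "mpartial \<alpha> u = f" unfolding f_def xs_def by (rule multiindex_list(3))
      \<comment> \<open>This side makes both terms of the Sobolev factor of order s, and
        \<open>1 \<le> s\<close> keeps the cube in the ball.\<close>
      define r where "r = c / s"
      have r: "0 < r" "r \<le> c" using c s by (auto simp: r_def field_simps)
      have "real ?m * r \<le> real ?m * c" using r m1 by (intro mult_left_mono) auto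
      also have "\<dots> < \<rho>0" using \<rho>0 by (simp add: c_def)
      finally have cub: "cube r \<subseteq> ball (0::real^'n) \<rho>0" by (rule cube_subset_ball)
      also have "\<dots> \<subseteq> ball 0 R" using \<rho> by (auto simp: \<rho>0_def)
      finally have cubR: "cube r \<subseteq> ball (0::real^'n) R" .
      \<comment> \<open>At most \<open>?m\<close> further derivatives are taken:
        \<open>fact ?m\<close> covers their factorial, and each adds one factor
        \<open>2 * T * s\<close>.\<close>
      define W where "W = (1 / \<kappa>) * Z0 * (2 * T * s) ^ j * fact j * fact ?m"
      have W: "0 \<le> W" using \<kappa> Z0 T s by (simp add: W_def)
      have "(f 0)\<^sup>2 \<le> W\<^sup>2 * (2 / r + r * (2 * T * s)\<^sup>2) ^ ?m"
      proof (rule pointwise_bound[OF r(1) open_ball cubR])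
        show "smooth (ball 0 R) f" unfolding f_def by (rule smooth_pd_list[OF su])
        fix zs :: "'n list" assume zs: "length zs \<le> ?m"
        define h where "h = length zs"
        have "(\<integral>\<^sup>+ w. ennreal ((pd_list zs f w)\<^sup>2) * indicator (cube r) w \<partial>lborel)
          \<le> (\<integral>\<^sup>+ w. ennreal ((pd_list (zs @ xs) u w)\<^sup>2) * indicator (ball 0 \<rho>0) w \<partial>lborel)"
          using cub by (intro nn_integral_mono mult_mono) (auto simp: f_def pd_list_append indicator_def)
        also have "\<dots> \<le> ennreal ((Bd (length (zs @ xs)))\<^sup>2)" by (rule I)
        also have "length (zs @ xs) = j + h" by (simp add: lx h_def)
        also have "ennreal ((Bd (j + h))\<^sup>2) \<le> ennreal (W\<^sup>2 * ((2 * T * s)\<^sup>2) ^ h)"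
        proof (rule ennreal_leI)
          have "Bd (j + h) = (1 / \<kappa>) * Z0 * (((1 / \<kappa>) * E.T * s) ^ (j + h) * fact (j + h))"
            by (simp add: Bd_def power_mult_distrib power_divide)
          also have "\<dots> \<le> (1 / \<kappa>) * Z0 * ((T * s) ^ (j + h) * (2 ^ (j + h) * fact j * fact ?m))"
          proof -
            have "((1 / \<kappa>) * E.T * s) ^ (j + h) \<le> (T * s) ^ (j + h)"
              using T_ge s ET \<kappa> by (intro power_mono mult_right_mono) auto
            moreover have "fact (j + h) \<le> (2 ^ (j + h) * fact j * fact ?m :: real)"
            proof -
              have "fact h \<le> (fact ?m :: real)" using zs by (intro fact_mono) (simp add: h_def)
              then have "2 ^ (j + h) * fact j * fact h \<le> (2 ^ (j + h) * fact j * fact ?m :: real)"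
                by (intro mult_left_mono) auto
              then show ?thesis using fact_add_le[of j h] by linarith
            qed
            ultimately show ?thesis
              using \<kappa> Z0 T s by (intro mult_left_mono mult_mono) auto
          qed
          also have "\<dots> = W * (2 * T * s) ^ h"
            by (simp add: W_def power_add power_mult_distrib)
          finally have "(Bd (j + h))\<^sup>2 \<le> (W * (2 * T * s) ^ h)\<^sup>2" using Bd0 by (intro power_mono) auto
          moreover have "(W * y ^ h)\<^sup>2 = W\<^sup>2 * (y\<^sup>2) ^ h" for y
            by (simp add: power_mult_distrib power_mult[symmetric] mult.commute)
          ultimately show "(Bd (j + h))\<^sup>2 \<le> W\<^sup>2 * ((2 * T * s)\<^sup>2) ^ h" by simp
        qed
        finally show "(\<integral>\<^sup>+ w. ennreal ((pd_list zs f w)\<^sup>2) * indicator (cube r) w \<partial>lborel)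
          \<le> ennreal (W\<^sup>2 * ((2 * T * s)\<^sup>2) ^ length zs)" by (simp add: h_def)
      qed auto
      also have "2 / r + r * (2 * T * s)\<^sup>2 = s * D"
        using c s by (simp add: r_def D_def field_simps power2_eq_square)
      finally have "sqrt ((f 0)\<^sup>2) \<le> sqrt (W\<^sup>2 * (s * D) ^ ?m)" by (rule real_sqrt_le_mono)
      then have "\<bar>f 0\<bar> \<le> W * (sqrt (s ^ ?m) * sqrt (D ^ ?m))"
        using W by (simp add: real_sqrt_mult power_mult_distrib)
      also have "sqrt (s ^ ?m) = L0 powr (real ?m / 4)"
      proof -
        have "s ^ ?m = (L0 powr (1 / 2)) powr real ?m"
          using L0 by (simp add: s_def powr_half_sqrt powr_realpow)
        then have "sqrt (s ^ ?m) = ((L0 powr (1 / 2)) powr real ?m) powr (1 / 2)"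
          by (simp add: powr_half_sqrt)
        then show ?thesis by (simp add: powr_powr)
      qed
      also have "W * (L0 powr (real ?m / 4) * sqrt (D ^ ?m))
        = K * Z0 * L0 powr (real ?m / 4) * (2 * T * s) ^ j * fact j"
        by (simp add: W_def K_def mult_ac)
      finally show ?thesis by (simp add: f s_def j_def)
    qed
    show ?thesis using part1 part2 by blast
  qed
  show ?thesis
    by (rule exI[of _ K], rule exI[of _ T], rule exI[of _ \<rho>0]) (use K T \<rho>0 main in blast)
qed

end
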